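(* Let $(\mathscr{A},\delta)$ be a discrete quantum group. Then the algebra $$\mathscr{AP}=\{x\in M(\mathscr{A}):\ \delta(x)\in M(\mathscr{A})\otimes M(\mathscr{A})\}$$ with structure maps inherited from $M(\mathscr{A})$ (that is, the product, unit and involution of $M(\mathscr{A})$ and the restrictions to $\mathscr{AP}$ of the extensions to $M(\mathscr{A})$ of the comultiplication $\delta$, the counit $\varepsilon$ and the coinverse $\kappa$ of $(\mathscr{A},\delta)$) is a Hopf $*$-algebra.
   Context: All algebras are over $\mathbb{C}$; $\otimes$ is the algebraic tensor product. For an algebra $\mathscr{A}$ with non degenerate product, $M(\mathscr{A})$ is its multiplier algebra (pairs of linear maps $a\mapsto ma$, $a\mapsto am$ on $\mathscr{A}$ with $(bm)a=b(ma)$). A homomorphism $\Phi:\mathscr{A}\to M(\mathscr{B})$ is non degenerate if $\Phi(\mathscr{A})\mathscr{B}=\mathscr{B}\Phi(\mathscr{A})=\mathscr{B}$ (linear spans of products); it then extends uniquely to a unital homomorphism $M(\mathscr{A})\to M(\mathscr{B})$, denoted by the same symbol. A multiplier Hopf algebra is a pair $(\mathscr{A},\delta)$ of an algebra $\mathscr{A}$ with non degenerate product and a homomorphism $\delta:\mathscr{A}\to M(\mathscr{A}\otimes\mathscr{A})$ such that the maps $T_1(a\otimes b)=\delta(a)(I\otimes b)$ and $T_2(a\otimes b)=(a\otimes I)\delta(b)$ are bijections of $\mathscr{A}\otimes\mathscr{A}$ onto $\mathscr{A}\otimes\mathscr{A}$, and $T_2\otimes\mathrm{id}$ and $\mathrm{id}\otimes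 T_1$ commute on $\mathscr{A}\otimes\mathscr{A}\otimes\mathscr{A}$. Then $\delta$ is non degenerate. There is a multiplicative functional $\varepsilon$ on $\mathscr{A}$ (counit) with $(\mathrm{id}\otimes\varepsilon)((a\otimes I)\delta(b))=ab=(\varepsilon\otimes\mathrm{id})(\delta(a)(I\otimes b))$, and an antihomomorphism $\kappa:\mathscr{A}\to M(\mathscr{A})$ (coinverse, antipode) with $\mu[(\mathrm{id}\otimes\kappa)((a\otimes I)\delta(b))(I\otimes c)]=a\varepsilon(b)c$ and $\mu[(a\otimes I)(\kappa\otimes\mathrm{id})(\delta(b)(I\otimes c))]=a\varepsilon(b)c$ for all $a,b,c\in\mathscr{A}$, where $\mu$ is multiplication. It is a multiplier Hopf $*$-algebra if $\mathscr{A}$ is a $*$-algebra and $\delta$ is a $*$-homomorphism; in that case $\kappa$ is an antiisomorphism $\mathscr{A}\to\mathscr{A}$ and extends to an antiisomorphism $M(\mathscr{A})\to M(\mathscr{A})$. A discrete quantum group is a multiplier Hopf $*$-algebra $(\mathscr{A},\delta)$ such that $\mathscr{A}$ is a direct sum of full matrix algebras. In the claim, $\delta$ in the definition of $\mathscr{AP}$ is the extension $M(\mathscr{A})\to M(\mathscr{A}\otimes\mathscr{A})$, and $M(\mathscr{A})\otimes M(\mathscr{A})$ is regarded as a subalgebra of $M(\mathscr{A}\otimes\mathscr{A})$. *)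

theory Defs
  imports Complex_Main "HOL-Library.Multiset" "HOL-Library.FuncSet" "Jordan_Normal_Form.Matrix"
begin

section \<open>Complex algebras\<close>

class scaleC =
  fixes scaleC :: "complex \<Rightarrow> 'a \<Rightarrow> 'a" (infixr "*\<^sub>C" 75)

class complex_vector = scaleC + ab_group_add +
  assumes scaleC_add_right: "a *\<^sub>C (x + y) = a *\<^sub>C x + a *\<^sub>C y"
    and scaleC_add_left: "(a + b) *\<^sub>C x = a *\<^sub>C x + b *\<^sub>C x"
    and scaleC_scaleC: "a *\<^sub>C b *\<^sub>C x = (a * b) *\<^sub>C x"
    and scaleC_one: "1 *\<^sub>C x = x"

global_interpretation complex_vector:
  vector_space "scaleC :: complex \<Rightarrow> 'a \<Rightarrow> 'a::complex_vector"
  by standard (rule scaleC_add_right scaleC_add_left scaleC_scaleC scaleC_one)+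

abbreviation clinear :: "('a::complex_vector \<Rightarrow> 'b::complex_vector) \<Rightarrow> bool"
  where "clinear \<equiv> Vector_Spaces.linear scaleC scaleC"

text \<open>Algebras need not be unital. A unital algebra is one whose type is also in the class
  \<^class>\<open>monoid_mult\<close>; we do not use \<^class>\<open>ring_1\<close>, because multiplier algebras are unital
  without further assumptions, but \<open>0 \<noteq> 1\<close> may fail.\<close>

class complex_algebra = complex_vector + ring +
  assumes scaleC_mult_left: "(c *\<^sub>C x) * y = c *\<^sub>C (x * y)"
    and scaleC_mult_right: "x * (c *\<^sub>C y) = c *\<^sub>C (x * y)"

class star_algebra = complex_algebra +
  fixes star :: "'a \<Rightarrow> 'a"
  assumes star_add: "star (x + y) = star x + star y"
    and star_scaleC: "star (c *\<^sub>C x) = cnj c *\<^sub>C star x"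
    and star_mult: "star (x * y) = star y * star x"
    and star_star: "star (star x) = x"

instantiation complex :: star_algebra
begin
definition scaleC_complex :: "complex \<Rightarrow> complex \<Rightarrow> complex" where "scaleC_complex = (*)"
definition star_complex :: "complex \<Rightarrow> complex" where "star_complex = cnj"
instance by standard (simp_all add: scaleC_complex_def star_complex_def algebra_simps)
end

definition algebra_hom :: "('a::complex_algebra \<Rightarrow> 'b::complex_algebra) \<Rightarrow> bool"
  where "algebra_hom f \<longleftrightarrow> clinear f \<and> (\<forall>x y. f (x * y) = f x * f y)"

definition algebra_antihom :: "('a::complex_algebra \<Rightarrow> 'b::complex_algebra) \<Rightarrow> bool"
  where "algebra_antihom f \<longleftrightarrow> clinear f \<and> (\<forall>x y. f (x * y) = f y * f x)"

definition nondegenerate_product :: "'a::complex_algebra itself \<Rightarrow> bool"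
  where "nondegenerate_product _ \<longleftrightarrow>
    (\<forall>a::'a. (\<forall>b. a * b = 0) \<longrightarrow> a = 0) \<and> (\<forall>b::'a. (\<forall>a. a * b = 0) \<longrightarrow> b = 0)"

lemma clinearI:
  assumes "\<And>x y. f (x + y) = f x + f y" "\<And>c x. f (c *\<^sub>C x) = c *\<^sub>C f x"
  shows "clinear f"
  using assms by unfold_locales auto

lemma clinear_add: "clinear f \<Longrightarrow> f (x + y) = f x + f y"
  by (simp add: Vector_Spaces.linear_iff)

lemma clinear_scaleC: "clinear f \<Longrightarrow> f (c *\<^sub>C x) = c *\<^sub>C f x"
  by (simp add: Vector_Spaces.linear_iff)


section \<open>Algebraic tensor products\<close>

text \<open>A finite multiset \<open>{#(a\<^sub>1, b\<^sub>1), \<dots>, (a\<^sub>k, b\<^sub>k)#}\<close> stands for the formal sum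
  \<open>a\<^sub>1 \<otimes> b\<^sub>1 + \<dots> + a\<^sub>k \<otimes> b\<^sub>k\<close>; the tensor product consists of the formal sums modulo bilinearity.\<close>

inductive tensor_eq ::
  "('a::complex_vector \<times> 'b::complex_vector) multiset \<Rightarrow> ('a \<times> 'b) multiset \<Rightarrow> bool"
where
  refl: "tensor_eq p p"
| sym: "tensor_eq p q \<Longrightarrow> tensor_eq q p"
| trans: "tensor_eq p q \<Longrightarrow> tensor_eq q r \<Longrightarrow> tensor_eq p r"
| plus: "tensor_eq p q \<Longrightarrow> tensor_eq (p + r) (q + r)"
| add_left: "tensor_eq {#(a + a', b)#} {#(a, b), (a', b)#}"
| add_right: "tensor_eq {#(a, b + b')#} {#(a, b), (a, b')#}"
| scale: "tensor_eq {#(c *\<^sub>C a, b)#} {#(a, c *\<^sub>C b)#}"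
| zero: "tensor_eq {#(0, b)#} {#}"

quotient_type (overloaded) ('a, 'b) tensor = "('a::complex_vector \<times> 'b::complex_vector) multiset" / tensor_eq
  by (rule equivpI) (auto intro!: reflpI sympI transpI intro: tensor_eq.refl tensor_eq.sym tensor_eq.trans)

lift_definition pure_tensor ::
  "'a::complex_vector \<Rightarrow> 'b::complex_vector \<Rightarrow> ('a, 'b) tensor" (infixl "\<otimes>\<^sub>t" 70)
  is "\<lambda>a b. {#(a, b)#}" .

lemma tensor_eq_plus: "tensor_eq p q \<Longrightarrow> tensor_eq p' q' \<Longrightarrow> tensor_eq (p + p') (q + q')"
  by (metis add.commute tensor_eq.plus tensor_eq.trans)

lemma tensor_eq_map_left:
  assumes f: "\<And>x y. f (x + y) = f x + f y" "\<And>c x. f (c *\<^sub>C x) = c *\<^sub>C f x"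
    and "tensor_eq p q"
  shows "tensor_eq (image_mset (\<lambda>(a, b). (f a, b)) p) (image_mset (\<lambda>(a, b). (f a, b)) q)"
  using assms(3)
proof induction
  case (zero b)
  have "f 0 = 0" using f(1)[of 0 0] by simp
  then show ?case by (simp add: tensor_eq.zero)
qed (auto intro: tensor_eq.intros simp: f)

lemma image_mset_case_prod_compose:
  "image_mset (\<lambda>(a, b). (f a, b)) (image_mset (\<lambda>(a, b). (g a, b)) p) = image_mset (\<lambda>(a, b). (f (g a), b)) p"
  by (simp add: multiset.map_comp comp_def case_prod_unfold)

lemma tensor_eq_image_add:
  "tensor_eq (image_mset (\<lambda>(a, b). (f a + g a, b)) p)
     (image_mset (\<lambda>(a, b). (f a, b)) p + image_mset (\<lambda>(a, b). (g a, b)) p)"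
proof (induction p)
  case empty
  show ?case by (simp add: tensor_eq.refl)
next
  case (add x p)
  obtain a b where x: "x = (a, b)" by force
  have "tensor_eq ({#(f a + g a, b)#} + image_mset (\<lambda>(a, b). (f a + g a, b)) p)
     ({#(f a, b), (g a, b)#} + (image_mset (\<lambda>(a, b). (f a, b)) p + image_mset (\<lambda>(a, b). (g a, b)) p))"
    by (rule tensor_eq_plus[OF tensor_eq.add_left add.IH])
  then show ?case by (simp add: x add_mset_commute)
qed

instantiation tensor :: (complex_vector, complex_vector) complex_vector
begin

lift_definition zero_tensor :: "('a, 'b) tensor" is "{#}" .
lift_definition plus_tensor :: "('a, 'b) tensor \<Rightarrow> ('a, 'b) tensor \<Rightarrow> ('a, 'b) tensor"
  is "(+)" by (rule tensor_eq_plus)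
lift_definition uminus_tensor :: "('a, 'b) tensor \<Rightarrow> ('a, 'b) tensor"
  is "image_mset (\<lambda>(a, b). (- a, b))"
  by (rule tensor_eq_map_left) simp_all
lift_definition scaleC_tensor :: "complex \<Rightarrow> ('a, 'b) tensor \<Rightarrow> ('a, 'b) tensor"
  is "\<lambda>c. image_mset (\<lambda>(a, b). (c *\<^sub>C a, b))"
  by (rule tensor_eq_map_left) (simp_all add: scaleC_add_right scaleC_scaleC mult.commute)
definition minus_tensor :: "('a, 'b) tensor \<Rightarrow> ('a, 'b) tensor \<Rightarrow> ('a, 'b) tensor"
  where "minus_tensor s t = s + - t"

instance
proof
  fix s t u :: "('a, 'b) tensor" and c d :: complex
  show "s + t + u = s + (t + u)" "s + t = t + s" "0 + t = t"
    by (transfer; simp add: ac_simps tensor_eq.refl)+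
  show "- t + t = 0"
  proof transfer
    fix p :: "('a \<times> 'b) multiset"
    have "tensor_eq (image_mset (\<lambda>(a, b). (- a + a, b)) p)
     (image_mset (\<lambda>(a, b). (- a, b)) p + image_mset (\<lambda>(a, b). (a, b)) p)"
      by (rule tensor_eq_image_add)
    moreover have "tensor_eq (image_mset (\<lambda>(a, b). (- a + a, b)) p) {#}"
    proof (induction p)
      case (add x p)
      obtain a b where x: "x = (a, b)" by force
      show ?case
        using tensor_eq_plus[OF tensor_eq.zero[of b] add] by (simp add: x)
    qed (simp add: tensor_eq.refl)
    ultimately show "tensor_eq (image_mset (\<lambda>(a, b). (- a, b)) p + p) {#}"
      by (simp add: case_prod_unfold) (metis tensor_eq.sym tensor_eq.trans)
  qed
  show "s - t = s + - t" by (simp add: minus_tensor_def)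
  show "c *\<^sub>C (s + t) = c *\<^sub>C s + c *\<^sub>C t" by transfer (simp add: tensor_eq.refl)
  show "(c + d) *\<^sub>C t = c *\<^sub>C t + d *\<^sub>C t"
    by transfer (simp add: scaleC_add_left tensor_eq_image_add)
  show "c *\<^sub>C d *\<^sub>C t = (c * d) *\<^sub>C t"
    by transfer (simp add: image_mset_case_prod_compose scaleC_scaleC tensor_eq.refl)
  show "1 *\<^sub>C t = t"
    by transfer (simp add: scaleC_one tensor_eq.refl case_prod_unfold)
qed

end

lemma pure_tensor_add_left: "(a + a') \<otimes>\<^sub>t b = a \<otimes>\<^sub>t b + a' \<otimes>\<^sub>t b"
  by transfer (simp, metis add_mset_commute tensor_eq.add_left)

lemma pure_tensor_add_right: "a \<otimes>\<^sub>t (b + b') = a \<otimes>\<^sub>t b + a \<otimes>\<^sub>t b'"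
  by transfer (simp, metis add_mset_commute tensor_eq.add_right)

lemma pure_tensor_scaleC_left: "(c *\<^sub>C a) \<otimes>\<^sub>t b = c *\<^sub>C (a \<otimes>\<^sub>t b)"
  by transfer (simp add: tensor_eq.refl)

lemma pure_tensor_scaleC_right: "a \<otimes>\<^sub>t (c *\<^sub>C b) = c *\<^sub>C (a \<otimes>\<^sub>t b)"
  by transfer (simp add: tensor_eq.scale tensor_eq.sym)

lemma abs_tensor_sum: "abs_tensor p = (\<Sum>(a, b)\<in>#p. a \<otimes>\<^sub>t b)"
proof (induction p)
  case empty
  show ?case by (simp add: zero_tensor_def)
next
  case (add x p)
  obtain a b where x: "x = (a, b)" by force
  have "abs_tensor (add_mset x p) = a \<otimes>\<^sub>t b + abs_tensor p"
    by (simp add: x pure_tensor.abs_eq plus_tensor.abs_eq)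
  then show ?case by (simp add: add x)
qed

lemma tensor_induct [case_names pure add, induct type: tensor]:
  assumes pure: "\<And>a b. P (a \<otimes>\<^sub>t b)" and add: "\<And>s t. P s \<Longrightarrow> P t \<Longrightarrow> P (s + t)"
  shows "P t"
proof (induction t rule: tensor.abs_induct)
  case (1 p)
  have "0 = (0::'a) \<otimes>\<^sub>t (0::'b)" by transfer (simp add: tensor_eq.sym tensor_eq.zero)
  then have "P 0" using pure by metis
  then have "P (\<Sum>(a, b)\<in>#p. a \<otimes>\<^sub>t b)"
    by (induction p) (auto intro: pure add)
  then show ?case by (simp add: abs_tensor_sum)
qed

text \<open>For linear subspaces \<open>S\<close> and \<open>T\<close>, the tensor product of \<open>S\<close> and \<open>T\<close> is identified with the
  subspace \<open>tensor_span S T\<close>. If \<open>f\<close> is bilinear on \<open>S \<times> T\<close> (or, more generally, additive in each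
  variable and balanced, as for the involution below), then \<open>tensor_lift_on S T f t\<close> is the value
  \<open>\<Sum>\<^sub>i f a\<^sub>i b\<^sub>i\<close> for any decomposition \<open>t = \<Sum>\<^sub>i a\<^sub>i \<otimes> b\<^sub>i\<close> with \<open>a\<^sub>i \<in> S\<close> and \<open>b\<^sub>i \<in> T\<close>: it does not depend
  on the decomposition. The version on a subset serves maps that are linear on \<open>S\<close> and \<open>T\<close> only.\<close>

definition tensor_span :: "'a::complex_vector set \<Rightarrow> 'b::complex_vector set \<Rightarrow> ('a, 'b) tensor set"
  where "tensor_span S T = complex_vector.span {a \<otimes>\<^sub>t b | a b. a \<in> S \<and> b \<in> T}"

definition tensor_lift_on :: "'a::complex_vector set \<Rightarrow> 'b::complex_vector set \<Rightarrow>
    ('a \<Rightarrow> 'b \<Rightarrow> 'c::complex_vector) \<Rightarrow> ('a, 'b) tensor \<Rightarrow> 'c"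
  where "tensor_lift_on S T f t =
    (THE u. \<forall>p. set_mset p \<subseteq> S \<times> T \<and> t = (\<Sum>(a, b)\<in>#p. a \<otimes>\<^sub>t b) \<longrightarrow> u = (\<Sum>(a, b)\<in>#p. f a b))"

abbreviation tensor_lift :: "('a::complex_vector \<Rightarrow> 'b::complex_vector \<Rightarrow> 'c::complex_vector) \<Rightarrow>
    ('a, 'b) tensor \<Rightarrow> 'c"
  where "tensor_lift \<equiv> tensor_lift_on UNIV UNIV"

definition balanced :: "('a::complex_vector \<Rightarrow> 'b::complex_vector \<Rightarrow> 'c::complex_vector) \<Rightarrow> bool"
  where "balanced f \<longleftrightarrow> (\<forall>a a' b. f (a + a') b = f a b + f a' b) \<and>
    (\<forall>a b b'. f a (b + b') = f a b + f a b') \<and> (\<forall>c a b. f (c *\<^sub>C a) b = f a (c *\<^sub>C b))"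

lemma balancedI:
  assumes "\<And>a a' b. f (a + a') b = f a b + f a' b" "\<And>a b b'. f a (b + b') = f a b + f a b'"
    "\<And>c a b. f (c *\<^sub>C a) b = f a (c *\<^sub>C b)"
  shows "balanced f"
  using assms by (auto simp: balanced_def)

lemma tensor_eq_sum:
  assumes f: "balanced f" and "tensor_eq p q"
  shows "(\<Sum>(a, b)\<in>#p. f a b) = (\<Sum>(a, b)\<in>#q. f a b)"
  using assms(2)
proof induction
  case (zero b)
  have "f (0 + 0) b = f 0 b + f 0 b" using f unfolding balanced_def by blast
  then show ?case by simp
qed (use f in \<open>auto simp: balanced_def\<close>)

lemma tensor_lift_abs:
  assumes f: "balanced f"
  shows "tensor_lift f (abs_tensor p) = (\<Sum>(a, b)\<in>#p. f a b)"
  unfolding tensor_lift_on_def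
  by (rule the_equality)
     (auto simp: abs_tensor_sum[symmetric] tensor.abs_eq_iff intro: tensor_eq_sum[OF f] tensor_eq.refl)

lemma tensor_lift_pure:
  assumes "balanced f"
  shows "tensor_lift f (a \<otimes>\<^sub>t b) = f a b"
  using tensor_lift_abs[OF assms, of "{#(a, b)#}"] by (simp add: pure_tensor.abs_eq)

lemma tensor_lift_add:
  assumes "balanced f"
  shows "tensor_lift f (s + t) = tensor_lift f s + tensor_lift f t"
  by (induction s rule: tensor.abs_induct; induction t rule: tensor.abs_induct)
     (simp add: tensor_lift_abs[OF assms] plus_tensor.abs_eq)

lemma tensor_lift_scaleC:
  assumes "balanced f" and "\<And>a b. f (c *\<^sub>C a) b = c' *\<^sub>C f a b"
  shows "tensor_lift f (c *\<^sub>C t) = c' *\<^sub>C tensor_lift f t"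
proof (induction t)
  case (pure a b)
  show ?case
    by (simp add: pure_tensor_scaleC_left[symmetric] tensor_lift_pure[OF assms(1)] assms(2))
next
  case (add s t)
  then show ?case by (simp add: scaleC_add_right tensor_lift_add[OF assms(1)])
qed

lemma balanced_plus: "balanced f \<Longrightarrow> balanced g \<Longrightarrow> balanced (\<lambda>a b. f a b + g a b)"
  by (simp add: balanced_def ac_simps)

lemma tensor_lift_plus_fun:
  assumes "balanced f" "balanced g"
  shows "tensor_lift (\<lambda>a b. f a b + g a b) t = tensor_lift f t + tensor_lift g t"
  by (induction t)
     (simp_all add: tensor_lift_pure tensor_lift_add assms balanced_plus[OF assms] ac_simps)

definition tensor_map :: "('a::complex_vector \<Rightarrow> 'c::complex_vector) \<Rightarrow>
    ('b::complex_vector \<Rightarrow> 'd::complex_vector) \<Rightarrow> ('a, 'b) tensor \<Rightarrow> ('c, 'd) tensor"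
  where "tensor_map f g = tensor_lift (\<lambda>a b. f a \<otimes>\<^sub>t g b)"

lemma balanced_tensor_map: "clinear f \<Longrightarrow> clinear g \<Longrightarrow> balanced (\<lambda>a b. f a \<otimes>\<^sub>t g b)"
  by (rule balancedI) (simp_all add: clinear_add clinear_scaleC pure_tensor_add_left
      pure_tensor_add_right pure_tensor_scaleC_left pure_tensor_scaleC_right)

lemma tensor_map_pure: "clinear f \<Longrightarrow> clinear g \<Longrightarrow> tensor_map f g (a \<otimes>\<^sub>t b) = f a \<otimes>\<^sub>t g b"
  by (simp add: tensor_map_def tensor_lift_pure balanced_tensor_map)

lemma clinear_tensor_map:
  assumes "clinear f" "clinear g"
  shows "clinear (tensor_map f g)"
proof -
  note b = balanced_tensor_map[OF assms]
  show ?thesis unfolding tensor_map_def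
    by (rule clinearI) (rule tensor_lift_add[OF b], rule tensor_lift_scaleC[OF b],
      simp add: clinear_scaleC[OF assms(1)] pure_tensor_scaleC_left)
qed

definition tensor_assoc :: "(('a::complex_vector, 'b::complex_vector) tensor, 'c::complex_vector) tensor \<Rightarrow>
    ('a, ('b, 'c) tensor) tensor"
  where "tensor_assoc = tensor_lift (\<lambda>t c. tensor_lift (\<lambda>a b. a \<otimes>\<^sub>t (b \<otimes>\<^sub>t c)) t)"

definition tensor_assoc' :: "('a::complex_vector, ('b::complex_vector, 'c::complex_vector) tensor) tensor \<Rightarrow>
    (('a, 'b) tensor, 'c) tensor"
  where "tensor_assoc' = tensor_lift (\<lambda>a t. tensor_lift (\<lambda>b c. (a \<otimes>\<^sub>t b) \<otimes>\<^sub>t c) t)"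

lemmas pure_tensor_linear =
  pure_tensor_add_left pure_tensor_add_right pure_tensor_scaleC_left pure_tensor_scaleC_right

lemma balanced_assoc: "balanced (\<lambda>a b. a \<otimes>\<^sub>t (b \<otimes>\<^sub>t c))" "balanced (\<lambda>b c. (a \<otimes>\<^sub>t b) \<otimes>\<^sub>t c)"
  by (rule balancedI; simp add: pure_tensor_linear)+

lemma balanced_assoc2: "balanced (\<lambda>t c. tensor_lift (\<lambda>a b. a \<otimes>\<^sub>t (b \<otimes>\<^sub>t c)) t)"
proof (rule balancedI)
  show "tensor_lift (\<lambda>a b. a \<otimes>\<^sub>t (b \<otimes>\<^sub>t (c + d))) t =
    tensor_lift (\<lambda>a b. a \<otimes>\<^sub>t (b \<otimes>\<^sub>t c)) t + tensor_lift (\<lambda>a b. a \<otimes>\<^sub>t (b \<otimes>\<^sub>t d)) t"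
    for t :: "('a, 'b) tensor" and c d :: 'c
    by (simp add: tensor_lift_plus_fun balanced_assoc pure_tensor_add_left pure_tensor_add_right)
  show "tensor_lift (\<lambda>a b. a \<otimes>\<^sub>t (b \<otimes>\<^sub>t d)) (c *\<^sub>C t) =
    tensor_lift (\<lambda>a b. a \<otimes>\<^sub>t (b \<otimes>\<^sub>t (c *\<^sub>C d))) t" for c and t :: "('a, 'b) tensor" and d :: 'c
    by (induction t)
       (simp_all add: tensor_lift_add tensor_lift_pure balanced_assoc scaleC_add_right
          pure_tensor_scaleC_left[symmetric], simp add: pure_tensor_linear)
qed (simp add: tensor_lift_add balanced_assoc)

lemma balanced_assoc2': "balanced (\<lambda>a t. tensor_lift (\<lambda>b c. (a \<otimes>\<^sub>t b) \<otimes>\<^sub>t c) t)"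
proof (rule balancedI)
  show "tensor_lift (\<lambda>b c. ((a + a') \<otimes>\<^sub>t b) \<otimes>\<^sub>t c) t =
    tensor_lift (\<lambda>b c. (a \<otimes>\<^sub>t b) \<otimes>\<^sub>t c) t + tensor_lift (\<lambda>b c. (a' \<otimes>\<^sub>t b) \<otimes>\<^sub>t c) t"
    for t :: "('b, 'c) tensor" and a a' :: 'a
    by (simp add: tensor_lift_plus_fun balanced_assoc pure_tensor_add_left pure_tensor_add_right)
  show "tensor_lift (\<lambda>b c. ((k *\<^sub>C a) \<otimes>\<^sub>t b) \<otimes>\<^sub>t c) t =
    tensor_lift (\<lambda>b c. (a \<otimes>\<^sub>t b) \<otimes>\<^sub>t c) (k *\<^sub>C t)" for k and t :: "('b, 'c) tensor" and a :: 'a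
    by (induction t)
       (simp_all add: tensor_lift_add tensor_lift_pure balanced_assoc scaleC_add_right
          pure_tensor_scaleC_left[symmetric], simp add: pure_tensor_linear)
qed (simp add: tensor_lift_add balanced_assoc)

lemma tensor_assoc_pure: "tensor_assoc ((a \<otimes>\<^sub>t b) \<otimes>\<^sub>t c) = a \<otimes>\<^sub>t (b \<otimes>\<^sub>t c)"
  by (simp add: tensor_assoc_def tensor_lift_pure balanced_assoc2 balanced_assoc)

lemma tensor_assoc'_pure: "tensor_assoc' (a \<otimes>\<^sub>t (b \<otimes>\<^sub>t c)) = (a \<otimes>\<^sub>t b) \<otimes>\<^sub>t c"
  by (simp add: tensor_assoc'_def tensor_lift_pure balanced_assoc2' balanced_assoc)

lemma tensor_assoc_add: "tensor_assoc (s + t) = tensor_assoc s + tensor_assoc t"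
  by (simp add: tensor_assoc_def tensor_lift_add balanced_assoc2)

lemma tensor_assoc'_add: "tensor_assoc' (s + t) = tensor_assoc' s + tensor_assoc' t"
  by (simp add: tensor_assoc'_def tensor_lift_add balanced_assoc2')

lemma tensor_assoc'_assoc: "tensor_assoc' (tensor_assoc t) = t"
proof (induction t)
  case (pure s c)
  show ?case
    by (induction s) (simp_all add: tensor_assoc_pure tensor_assoc'_pure tensor_assoc_add
        tensor_assoc'_add pure_tensor_add_left)
qed (simp add: tensor_assoc_add tensor_assoc'_add)

lemma tensor_assoc_assoc': "tensor_assoc (tensor_assoc' t) = t"
proof (induction t)
  case (pure a s)
  show ?case
    by (induction s) (simp_all add: tensor_assoc_pure tensor_assoc'_pure tensor_assoc_add
        tensor_assoc'_add pure_tensor_add_right)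
qed (simp add: tensor_assoc_add tensor_assoc'_add)


subsection \<open>Tensor products of algebras\<close>

lemma balanced_times:
  fixes a :: "'a::complex_algebra" and b :: "'b::complex_algebra"
  shows "balanced (\<lambda>c d. (a * c) \<otimes>\<^sub>t (b * d))"
  by (rule balancedI)
     (simp_all add: distrib_left scaleC_mult_right pure_tensor_linear)

lemma balanced_times2:
  fixes s :: "('a::complex_algebra, 'b::complex_algebra) tensor"
  shows "balanced (\<lambda>a b. tensor_lift (\<lambda>c d. (a * c) \<otimes>\<^sub>t (b * d)) s)"
proof (rule balancedI)
  fix a a' :: 'a and b b' :: 'b and k :: complex
  show "tensor_lift (\<lambda>c d. ((a + a') * c) \<otimes>\<^sub>t (b * d)) s =
    tensor_lift (\<lambda>c d. (a * c) \<otimes>\<^sub>t (b * d)) s + tensor_lift (\<lambda>c d. (a' * c) \<otimes>\<^sub>t (b * d)) s"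
    by (simp add: tensor_lift_plus_fun balanced_times distrib_right pure_tensor_add_left pure_tensor_add_right)
  show "tensor_lift (\<lambda>c d. (a * c) \<otimes>\<^sub>t ((b + b') * d)) s =
    tensor_lift (\<lambda>c d. (a * c) \<otimes>\<^sub>t (b * d)) s + tensor_lift (\<lambda>c d. (a * c) \<otimes>\<^sub>t (b' * d)) s"
    by (simp add: tensor_lift_plus_fun balanced_times distrib_right pure_tensor_add_left pure_tensor_add_right)
  show "tensor_lift (\<lambda>c d. ((k *\<^sub>C a) * c) \<otimes>\<^sub>t (b * d)) s =
    tensor_lift (\<lambda>c d. (a * c) \<otimes>\<^sub>t ((k *\<^sub>C b) * d)) s"
    by (simp add: scaleC_mult_left pure_tensor_linear)
qed

instantiation tensor :: (complex_algebra, complex_algebra) complex_algebra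
begin

definition times_tensor :: "('a, 'b) tensor \<Rightarrow> ('a, 'b) tensor \<Rightarrow> ('a, 'b) tensor"
  where "t * s = tensor_lift (\<lambda>a b. tensor_lift (\<lambda>c d. (a * c) \<otimes>\<^sub>t (b * d)) s) t"

lemma tensor_mult_pure_left: "(a \<otimes>\<^sub>t b) * s = tensor_lift (\<lambda>c d. (a * c) \<otimes>\<^sub>t (b * d)) s"
  for a :: 'a and b :: 'b
  unfolding times_tensor_def by (rule tensor_lift_pure[OF balanced_times2])

lemma tensor_mult_pure: "(a \<otimes>\<^sub>t b) * (c \<otimes>\<^sub>t d) = (a * c) \<otimes>\<^sub>t (b * d)" for a c :: 'a and b d :: 'b
  unfolding tensor_mult_pure_left by (rule tensor_lift_pure[OF balanced_times])

lemma tensor_mult_add_left: "(s + t) * u = s * u + t * u" for s t u :: "('a, 'b) tensor"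
  by (simp add: times_tensor_def tensor_lift_add balanced_times2)

lemma tensor_mult_add_right: "u * (s + t) = u * s + u * t" for s t u :: "('a, 'b) tensor"
proof (induction u)
  case (pure a b)
  show ?case by (simp add: tensor_mult_pure_left tensor_lift_add balanced_times)
qed (simp add: tensor_mult_add_left)

lemma tensor_mult_scaleC_pure:
  "(c *\<^sub>C (a \<otimes>\<^sub>t b)) * (a' \<otimes>\<^sub>t b') = c *\<^sub>C ((a \<otimes>\<^sub>t b) * (a' \<otimes>\<^sub>t (b'::'b)))"
  "(a \<otimes>\<^sub>t b) * (c *\<^sub>C (a' \<otimes>\<^sub>t b')) = c *\<^sub>C ((a \<otimes>\<^sub>t b) * (a' \<otimes>\<^sub>t b'))" for a a' :: 'a
  by (simp_all add: pure_tensor_scaleC_left[symmetric] tensor_mult_pure scaleC_mult_left scaleC_mult_right)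

instance
proof
  fix s t u :: "('a, 'b) tensor" and c :: complex
  show "(s + t) * u = s * u + t * u" by (rule tensor_mult_add_left)
  show "s * (t + u) = s * t + s * u" by (rule tensor_mult_add_right)
  show "s * t * u = s * (t * u)"
  proof (induction s)
    case (pure a b)
    show ?case
    proof (induction t)
      case (pure c d)
      show ?case
        by (induction u) (simp_all add: tensor_mult_pure mult.assoc tensor_mult_add_right)
    qed (simp add: tensor_mult_add_left tensor_mult_add_right)
  qed (simp add: tensor_mult_add_left)
  show "(c *\<^sub>C s) * t = c *\<^sub>C (s * t)"
  proof (induction s)
    case (pure a b)
    show ?case
      by (induction t) (simp_all add: tensor_mult_scaleC_pure tensor_mult_add_right scaleC_add_right)
  qed (simp add: tensor_mult_add_left scaleC_add_right)
  show "s * (c *\<^sub>C t) = c *\<^sub>C (s * t)"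
  proof (induction s)
    case (pure a b)
    show ?case
      by (induction t) (simp_all add: tensor_mult_scaleC_pure tensor_mult_add_right scaleC_add_right)
  qed (simp add: tensor_mult_add_left scaleC_add_right)
qed

end

instantiation tensor :: ("{complex_algebra, monoid_mult}", "{complex_algebra, monoid_mult}") monoid_mult
begin

definition one_tensor :: "('a, 'b) tensor" where "one_tensor = 1 \<otimes>\<^sub>t 1"

instance
proof
  show "1 * t = t" "t * 1 = t" for t :: "('a, 'b) tensor"
    by (induction t) (simp_all add: tensor_mult_add_left tensor_mult_add_right,
      simp_all add: one_tensor_def tensor_mult_pure)
qed

end

instantiation tensor :: (star_algebra, star_algebra) star_algebra
begin

definition star_tensor :: "('a, 'b) tensor \<Rightarrow> ('a, 'b) tensor"
  where "star_tensor = tensor_lift (\<lambda>a b. star a \<otimes>\<^sub>t star b)"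

lemma balanced_star: "balanced (\<lambda>(a::'a) b. star a \<otimes>\<^sub>t (star b :: 'b))"
  by (rule balancedI) (simp_all add: star_add star_scaleC pure_tensor_linear)

lemma star_tensor_pure: "star (a \<otimes>\<^sub>t b) = star a \<otimes>\<^sub>t (star b :: 'b)" for a :: 'a
  by (simp add: star_tensor_def tensor_lift_pure balanced_star)

lemma star_tensor_add: "star (s + t) = star s + star t" for s t :: "('a, 'b) tensor"
  by (simp add: star_tensor_def tensor_lift_add balanced_star)

instance
proof
  fix s t :: "('a, 'b) tensor" and c :: complex
  show "star (s + t) = star s + star t" by (rule star_tensor_add)
  show "star (c *\<^sub>C t) = cnj c *\<^sub>C star t"
    unfolding star_tensor_def
    by (rule tensor_lift_scaleC[OF balanced_star]) (simp add: star_scaleC pure_tensor_linear)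
  show "star (star t) = t"
    by (induction t) (simp_all add: star_tensor_pure star_tensor_add star_star)
  show "star (s * t) = star t * star s"
  proof (induction s)
    case (pure a b)
    show ?case
      by (induction t) (simp_all add: star_tensor_pure star_tensor_add tensor_mult_pure star_mult
          tensor_mult_add_left tensor_mult_add_right)
  qed (simp add: star_tensor_add tensor_mult_add_left tensor_mult_add_right)
qed

end


section \<open>Multiplier algebras\<close>

typedef (overloaded) 'a multiplier =
  "{(l :: 'a::complex_algebra \<Rightarrow> 'a, r :: 'a \<Rightarrow> 'a).
     clinear l \<and> clinear r \<and> (\<forall>a b. r b * a = b * l a)}"
  by (rule exI[of _ "(\<lambda>a. a, \<lambda>a. a)"]) (auto intro: clinearI)

setup_lifting type_definition_multiplier

text \<open>\<open>lmult m a\<close> is \<open>ma\<close> and \<open>rmult m a\<close> is \<open>am\<close>.\<close>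

lift_definition lmult :: "'a::complex_algebra multiplier \<Rightarrow> 'a \<Rightarrow> 'a" is fst .
lift_definition rmult :: "'a::complex_algebra multiplier \<Rightarrow> 'a \<Rightarrow> 'a" is snd .

lemma multiplier_eqI:
  "(\<And>a. lmult m a = lmult n a) \<Longrightarrow> (\<And>a. rmult m a = rmult n a) \<Longrightarrow> m = n"
  by transfer (auto simp: prod_eq_iff)

lemma clinear_lmult: "clinear (lmult m)" and clinear_rmult: "clinear (rmult m)"
  by (transfer; auto)+

lemma rmult_lmult: "rmult m b * a = b * lmult m a"
  by transfer auto

instantiation multiplier :: (complex_algebra) "{complex_algebra, monoid_mult}"
begin

lift_definition zero_multiplier :: "'a multiplier" is "(\<lambda>_. 0, \<lambda>_. 0)"
  by (auto intro!: clinearI)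
lift_definition plus_multiplier :: "'a multiplier \<Rightarrow> 'a multiplier \<Rightarrow> 'a multiplier"
  is "\<lambda>(l, r) (l', r'). (\<lambda>a. l a + l' a, \<lambda>a. r a + r' a)"
  by (auto intro!: clinearI simp: clinear_add clinear_scaleC scaleC_add_right algebra_simps)
lift_definition uminus_multiplier :: "'a multiplier \<Rightarrow> 'a multiplier"
  is "\<lambda>(l, r). (\<lambda>a. - l a, \<lambda>a. - r a)"
  by (auto intro!: clinearI simp: clinear_add clinear_scaleC)
lift_definition minus_multiplier :: "'a multiplier \<Rightarrow> 'a multiplier \<Rightarrow> 'a multiplier"
  is "\<lambda>(l, r) (l', r'). (\<lambda>a. l a - l' a, \<lambda>a. r a - r' a)"
  by (auto intro!: clinearI simp: clinear_add clinear_scaleC complex_vector.scale_right_diff_distrib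
      algebra_simps)
lift_definition scaleC_multiplier :: "complex \<Rightarrow> 'a multiplier \<Rightarrow> 'a multiplier"
  is "\<lambda>c (l, r). (\<lambda>a. c *\<^sub>C l a, \<lambda>a. c *\<^sub>C r a)"
  by (auto intro!: clinearI simp: clinear_add clinear_scaleC scaleC_add_right scaleC_scaleC
      scaleC_mult_left scaleC_mult_right mult.commute)
lift_definition one_multiplier :: "'a multiplier" is "(\<lambda>a. a, \<lambda>a. a)"
  by (auto intro!: clinearI)
lift_definition times_multiplier :: "'a multiplier \<Rightarrow> 'a multiplier \<Rightarrow> 'a multiplier"
  is "\<lambda>(l, r) (l', r'). (\<lambda>a. l (l' a), \<lambda>a. r' (r a))"
  by (auto intro!: clinearI simp: clinear_add clinear_scaleC)

instance
  by standard
    (transfer; auto simp: fun_eq_iff algebra_simps scaleC_add_right scaleC_add_left scaleC_scaleC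
      scaleC_one clinear_add clinear_scaleC)+

end

instantiation multiplier :: (star_algebra) star_algebra
begin

lift_definition star_multiplier :: "'a multiplier \<Rightarrow> 'a multiplier"
  is "\<lambda>(l, r). (\<lambda>a. star (r (star a)), \<lambda>a. star (l (star a)))"
  by (auto intro!: clinearI simp: star_add star_scaleC clinear_add clinear_scaleC)
     (metis star_mult star_star)

instance
  by standard
    (transfer; auto simp: fun_eq_iff star_add star_scaleC star_star)+

end

lift_definition to_multiplier :: "'a::complex_algebra \<Rightarrow> 'a multiplier"
  is "\<lambda>a. (\<lambda>b. a * b, \<lambda>b. b * a)"
  by (auto intro!: clinearI simp: algebra_simps scaleC_mult_left scaleC_mult_right)

text \<open>The canonical map of \<open>M(A) \<otimes> M(B)\<close> into \<open>M(A \<otimes> B)\<close>. It is injective when the products of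
  \<open>A\<close> and \<open>B\<close> are nondegenerate, and then \<open>M(A) \<otimes> M(B)\<close> is identified with its range.\<close>

lift_definition multiplier_times :: "'a::complex_algebra multiplier \<Rightarrow> 'b::complex_algebra multiplier \<Rightarrow>
    ('a, 'b) tensor multiplier"
  is "\<lambda>(l, r) (l', r'). (tensor_map l l', tensor_map r r')"
proof (clarsimp simp: clinear_tensor_map)
  fix l r :: "'a \<Rightarrow> 'a" and l' r' :: "'b \<Rightarrow> 'b" and s t :: "('a, 'b) tensor"
  assume lin: "clinear l" "clinear r" "clinear l'" "clinear r'"
    and mult: "\<forall>a b. r b * a = b * l a" "\<forall>a b. r' b * a = b * l' a"
  show "tensor_map r r' t * s = t * tensor_map l l' s"
  proof (induction t)
    case (pure a b)
    show ?case
      by (induction s) (simp_all add: tensor_map_pure lin tensor_mult_pure mult distrib_left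
          clinear_add[OF clinear_tensor_map])
  qed (simp add: distrib_right clinear_add[OF clinear_tensor_map] lin)
qed

definition multiplier_tensor :: "('a::complex_algebra multiplier, 'b::complex_algebra multiplier) tensor \<Rightarrow>
    ('a, 'b) tensor multiplier"
  where "multiplier_tensor = tensor_lift multiplier_times"

text \<open>The unital extension to \<open>M(A)\<close> of a nondegenerate (anti)homomorphism \<open>\<Phi> : A \<rightarrow> B\<close>. The target
  is \<open>M(C)\<close> for an algebra \<open>C\<close>, or the field of complex numbers, which is its own multiplier algebra.\<close>

definition hom_extension :: "('a::complex_algebra \<Rightarrow> 'b::{complex_algebra, monoid_mult}) \<Rightarrow> 'a multiplier \<Rightarrow> 'b"
  where "hom_extension \<Phi> =
    (THE \<Psi>. algebra_hom \<Psi> \<and> \<Psi> 1 = 1 \<and> (\<forall>a. \<Psi> (to_multiplier a) = \<Phi> a))"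

definition antihom_extension :: "('a::complex_algebra \<Rightarrow> 'b::{complex_algebra, monoid_mult}) \<Rightarrow> 'a multiplier \<Rightarrow> 'b"
  where "antihom_extension \<Phi> =
    (THE \<Psi>. algebra_antihom \<Psi> \<and> \<Psi> 1 = 1 \<and> (\<forall>a. \<Psi> (to_multiplier a) = \<Phi> a))"


section \<open>Multiplier Hopf algebras\<close>

text \<open>\<open>hopf_T1\<close> and \<open>hopf_T2\<close> take values in \<open>M(A \<otimes> A)\<close>; that they map into \<open>A \<otimes> A\<close> is part of the
  axioms, and \<open>hopf_T1'\<close> and \<open>hopf_T2'\<close> are the resulting maps on \<open>A \<otimes> A\<close>.\<close>

definition hopf_T1 :: "('a::complex_algebra \<Rightarrow> ('a, 'a) tensor multiplier) \<Rightarrow>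
    ('a, 'a) tensor \<Rightarrow> ('a, 'a) tensor multiplier"
  where "hopf_T1 \<delta> = tensor_lift (\<lambda>a b. \<delta> a * multiplier_times 1 (to_multiplier b))"

definition hopf_T2 :: "('a::complex_algebra \<Rightarrow> ('a, 'a) tensor multiplier) \<Rightarrow>
    ('a, 'a) tensor \<Rightarrow> ('a, 'a) tensor multiplier"
  where "hopf_T2 \<delta> = tensor_lift (\<lambda>a b. multiplier_times (to_multiplier a) 1 * \<delta> b)"

definition hopf_T1' :: "('a::complex_algebra \<Rightarrow> ('a, 'a) tensor multiplier) \<Rightarrow>
    ('a, 'a) tensor \<Rightarrow> ('a, 'a) tensor"
  where "hopf_T1' \<delta> t = inv_into UNIV to_multiplier (hopf_T1 \<delta> t)"

definition hopf_T2' :: "('a::complex_algebra \<Rightarrow> ('a, 'a) tensor multiplier) \<Rightarrow>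
    ('a, 'a) tensor \<Rightarrow> ('a, 'a) tensor"
  where "hopf_T2' \<delta> t = inv_into UNIV to_multiplier (hopf_T2 \<delta> t)"

definition multiplier_hopf_algebra :: "('a::complex_algebra \<Rightarrow> ('a, 'a) tensor multiplier) \<Rightarrow> bool"
  where "multiplier_hopf_algebra \<delta> \<longleftrightarrow>
    nondegenerate_product TYPE('a) \<and>
    algebra_hom \<delta> \<and>
    bij_betw (hopf_T1 \<delta>) UNIV (range to_multiplier) \<and>
    bij_betw (hopf_T2 \<delta>) UNIV (range to_multiplier) \<and>
    (let T2_id = tensor_map (hopf_T2' \<delta>) (\<lambda>a. a);
         id_T1 = tensor_assoc' \<circ> tensor_map (\<lambda>a. a) (hopf_T1' \<delta>) \<circ> tensor_assoc
     in T2_id \<circ> id_T1 = id_T1 \<circ> T2_id)"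

definition multiplier_hopf_star_algebra :: "('a::star_algebra \<Rightarrow> ('a, 'a) tensor multiplier) \<Rightarrow> bool"
  where "multiplier_hopf_star_algebra \<delta> \<longleftrightarrow>
    multiplier_hopf_algebra \<delta> \<and> (\<forall>a. \<delta> (star a) = star (\<delta> a))"

definition is_counit :: "('a::complex_algebra \<Rightarrow> ('a, 'a) tensor multiplier) \<Rightarrow> ('a \<Rightarrow> complex) \<Rightarrow> bool"
  where "is_counit \<delta> \<epsilon> \<longleftrightarrow>
    algebra_hom \<epsilon> \<and>
    (\<forall>a b. tensor_lift (\<lambda>x y. \<epsilon> y *\<^sub>C x) (hopf_T2' \<delta> (a \<otimes>\<^sub>t b)) = a * b) \<and>
    (\<forall>a b. tensor_lift (\<lambda>x y. \<epsilon> x *\<^sub>C y) (hopf_T1' \<delta> (a \<otimes>\<^sub>t b)) = a * b)"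

definition counit :: "('a::complex_algebra \<Rightarrow> ('a, 'a) tensor multiplier) \<Rightarrow> 'a \<Rightarrow> complex"
  where "counit \<delta> = (THE \<epsilon>. is_counit \<delta> \<epsilon>)"

text \<open>The two identities are stated in \<open>M(A)\<close>, and \<open>\<mu>\<close> is the product \<open>M(A) \<otimes> M(A) \<rightarrow> M(A)\<close>.\<close>

definition is_coinverse :: "('a::complex_algebra \<Rightarrow> ('a, 'a) tensor multiplier) \<Rightarrow> ('a \<Rightarrow> 'a multiplier) \<Rightarrow> bool"
  where "is_coinverse \<delta> \<kappa> \<longleftrightarrow>
    algebra_antihom \<kappa> \<and>
    (let \<mu> = tensor_lift (*); \<iota> = to_multiplier in
      (\<forall>a b c. \<mu> (tensor_map \<iota> \<kappa> (hopf_T2' \<delta> (a \<otimes>\<^sub>t b)) * (1 \<otimes>\<^sub>t \<iota> c)) = \<iota> (counit \<delta> b *\<^sub>C (a * c))) \<and>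
      (\<forall>a b c. \<mu> ((\<iota> a \<otimes>\<^sub>t 1) * tensor_map \<kappa> \<iota> (hopf_T1' \<delta> (b \<otimes>\<^sub>t c))) = \<iota> (counit \<delta> b *\<^sub>C (a * c))))"

definition coinverse :: "('a::complex_algebra \<Rightarrow> ('a, 'a) tensor multiplier) \<Rightarrow> 'a \<Rightarrow> 'a multiplier"
  where "coinverse \<delta> = (THE \<kappa>. is_coinverse \<delta> \<kappa>)"


section \<open>Discrete quantum groups\<close>

definition matrix_direct_sum :: "'i set \<Rightarrow> ('i \<Rightarrow> nat) \<Rightarrow> ('i \<Rightarrow> complex mat) set"
  where "matrix_direct_sum I n =
    {x \<in> (\<Pi>\<^sub>E i\<in>I. carrier_mat (n i) (n i)). finite {i\<in>I. x i \<noteq> 0\<^sub>m (n i) (n i)}}"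

text \<open>The index set may be taken inside \<open>'a\<close> without loss of generality, because the units of
  the summands are pairwise distinct elements of the algebra. The family is nonempty (the zero
  algebra has no counit satisfying \<open>\<epsilon>(1) = 1\<close>). The isomorphism is one of algebras: how an
  involution acts on the summands is not prescribed.\<close>

definition direct_sum_of_matrix_algebras :: "'a::complex_algebra itself \<Rightarrow> bool"
  where "direct_sum_of_matrix_algebras _ \<longleftrightarrow>
    (\<exists>(I :: 'a set) n (\<phi> :: 'a \<Rightarrow> 'a \<Rightarrow> complex mat).
      I \<noteq> {} \<and> (\<forall>i\<in>I. n i > 0) \<and>
      bij_betw \<phi> UNIV (matrix_direct_sum I n) \<and>
      (\<forall>a b. \<forall>i\<in>I. \<phi> (a + b) i = \<phi> a i + \<phi> b i) \<and>
      (\<forall>c a. \<forall>i\<in>I. \<phi> (c *\<^sub>C a) i = c \<cdot>\<^sub>m \<phi> a i) \<and>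
      (\<forall>a b. \<forall>i\<in>I. \<phi> (a * b) i = \<phi> a i * \<phi> b i))"

definition discrete_quantum_group :: "('a::star_algebra \<Rightarrow> ('a, 'a) tensor multiplier) \<Rightarrow> bool"
  where "discrete_quantum_group \<delta> \<longleftrightarrow>
    multiplier_hopf_star_algebra \<delta> \<and> direct_sum_of_matrix_algebras TYPE('a)"


section \<open>Hopf *-algebras\<close>

definition clinear_on :: "'a::complex_vector set \<Rightarrow> ('a \<Rightarrow> 'b::complex_vector) \<Rightarrow> bool"
  where "clinear_on S f \<longleftrightarrow>
    (\<forall>x\<in>S. \<forall>y\<in>S. f (x + y) = f x + f y) \<and> (\<forall>c. \<forall>x\<in>S. f (c *\<^sub>C x) = c *\<^sub>C f x)"

definition unital_star_subalgebra :: "'a::{star_algebra, monoid_mult} set \<Rightarrow> bool"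
  where "unital_star_subalgebra S \<longleftrightarrow>
    complex_vector.subspace S \<and> 1 \<in> S \<and> (\<forall>x\<in>S. \<forall>y\<in>S. x * y \<in> S) \<and> (\<forall>x\<in>S. star x \<in> S)"

text \<open>\<open>S\<close>, with the product, unit and involution of the ambient algebra, is a Hopf *-algebra with
  comultiplication \<open>\<Delta>\<close>, counit \<open>\<epsilon>\<close> and coinverse \<open>\<kappa>\<close>. Only the values of these maps on \<open>S\<close> matter.
  The rules \<open>\<epsilon>(x\<^sup>*) = cnj (\<epsilon>(x))\<close>, \<open>\<kappa>(\<kappa>(x\<^sup>*)\<^sup>*) = x\<close> and the antimultiplicativity of \<open>\<kappa>\<close> are
  consequences of these axioms.\<close>

definition hopf_star_algebra :: "'a::{star_algebra, monoid_mult} set \<Rightarrow> ('a \<Rightarrow> ('a, 'a) tensor) \<Rightarrow>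
    ('a \<Rightarrow> complex) \<Rightarrow> ('a \<Rightarrow> 'a) \<Rightarrow> bool"
  where "hopf_star_algebra S \<Delta> \<epsilon> \<kappa> \<longleftrightarrow>
    unital_star_subalgebra S \<and>
    \<comment> \<open>\<open>\<Delta>\<close> is a unital *-homomorphism into \<open>S \<otimes> S\<close>\<close>
    (\<forall>x\<in>S. \<Delta> x \<in> tensor_span S S) \<and>
    clinear_on S \<Delta> \<and> \<Delta> 1 = 1 \<and> (\<forall>x\<in>S. \<forall>y\<in>S. \<Delta> (x * y) = \<Delta> x * \<Delta> y) \<and>
    (\<forall>x\<in>S. \<Delta> (star x) = star (\<Delta> x)) \<and>
    \<comment> \<open>\<open>(\<Delta> \<otimes> id) \<Delta> = (id \<otimes> \<Delta>) \<Delta>\<close>\<close>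
    (\<forall>x\<in>S. tensor_assoc (tensor_lift_on S S (\<lambda>a b. \<Delta> a \<otimes>\<^sub>t b) (\<Delta> x)) =
            tensor_lift_on S S (\<lambda>a b. a \<otimes>\<^sub>t \<Delta> b) (\<Delta> x)) \<and>
    \<comment> \<open>\<open>\<epsilon>\<close> is a unital homomorphism with \<open>(\<epsilon> \<otimes> id) \<Delta> = id = (id \<otimes> \<epsilon>) \<Delta>\<close>\<close>
    clinear_on S \<epsilon> \<and> \<epsilon> 1 = 1 \<and> (\<forall>x\<in>S. \<forall>y\<in>S. \<epsilon> (x * y) = \<epsilon> x * \<epsilon> y) \<and>
    (\<forall>x\<in>S. tensor_lift_on S S (\<lambda>a b. \<epsilon> a *\<^sub>C b) (\<Delta> x) = x) \<and>
    (\<forall>x\<in>S. tensor_lift_on S S (\<lambda>a b. \<epsilon> b *\<^sub>C a) (\<Delta> x) = x) \<and>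
    \<comment> \<open>\<open>\<mu> (\<kappa> \<otimes> id) \<Delta> = \<epsilon>(\<cdot>) 1 = \<mu> (id \<otimes> \<kappa>) \<Delta>\<close>\<close>
    (\<forall>x\<in>S. \<kappa> x \<in> S) \<and> clinear_on S \<kappa> \<and>
    (\<forall>x\<in>S. tensor_lift_on S S (\<lambda>a b. \<kappa> a * b) (\<Delta> x) = \<epsilon> x *\<^sub>C 1) \<and>
    (\<forall>x\<in>S. tensor_lift_on S S (\<lambda>a b. a * \<kappa> b) (\<Delta> x) = \<epsilon> x *\<^sub>C 1)"


section \<open>The algebra \<open>AP\<close>\<close>

definition AP :: "('a::complex_algebra \<Rightarrow> ('a, 'a) tensor multiplier) \<Rightarrow> 'a multiplier set"
  where "AP \<delta> = {x. hom_extension \<delta> x \<in> range multiplier_tensor}"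

definition AP_comult :: "('a::complex_algebra \<Rightarrow> ('a, 'a) tensor multiplier) \<Rightarrow>
    'a multiplier \<Rightarrow> ('a multiplier, 'a multiplier) tensor"
  where "AP_comult \<delta> x = inv_into UNIV multiplier_tensor (hom_extension \<delta> x)"

end

theory Submission
  imports Defs
begin

text \<open>Everything rests on one principle: multipliers are determined by, and can be constructed from,
  their action on the range of a nondegenerate map. The counit and the coinverse are read off from
  \<open>T\<^sub>1\<inverse>\<close> and \<open>T\<^sub>2\<inverse>\<close>, using that \<open>id \<otimes> T\<^sub>1\<inverse>\<close> commutes with \<open>T\<^sub>2 \<otimes> id\<close>, and extend to
  \<open>M(A)\<close> because they are nondegenerate. If \<open>\<delta>(x) = \<Sum> x\<^sub>i \<otimes> y\<^sub>i\<close> with \<open>x\<^sub>i, y\<^sub>i \<in> M(A)\<close>, then coassociativity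
  in the form \<open>\<Sum> \<delta>(x\<^sub>i) \<otimes> y\<^sub>i = \<Sum> x\<^sub>i \<otimes> \<delta>(y\<^sub>i)\<close> shows, after slicing one leg, that all slices of \<open>\<delta>(x)\<close>
  lie in \<open>AP\<close>, so that \<open>\<delta>(x) \<in> AP \<otimes> AP\<close>. Finally \<open>\<kappa>\<close> maps \<open>AP\<close> to itself since both \<open>\<delta> \<circ> \<kappa>\<close> and
  \<open>flip \<circ> (\<kappa> \<otimes> \<kappa>) \<circ> \<delta>\<close> are convolution inverses of \<open>\<delta>\<close> on \<open>AP\<close>.\<close>

section \<open>Linear maps and functionals\<close>

text \<open>The commutation axiom is coassociativity in covered form only: it concerns (a \<otimes>
  1 \<otimes> 1)(\<delta> \<otimes> id)(\<delta>(b)(1 \<otimes> c)), an element of A \<otimes> A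
  \<otimes> A. For a multiplier x whose \<delta>(x) has legs in M(A), an identity of multipliers is
  recovered by testing on the elements \<delta>(p)(r \<otimes> r') \<otimes> c and multiplying by a
  on the left. In Sweedler notation T1 sends a \<otimes> b to a1 \<otimes> a2 b, so its inverse
  should be a1 \<otimes> \<kappa>(a2) b; likewise the inverse of T2 should send a \<otimes> b to a
  \<kappa>(b1) \<otimes> b2. Hence \<mu> after the inverse of T1 must give \<epsilon>(a) b, and
  \<epsilon> \<otimes> id after it must give \<kappa>(a) b. These formulas become the constructions.
  Extensions, counit and coinverse are definite descriptions, so each existence proof comes with a
  uniqueness proof. An element e with \<epsilon>(e) = 1 then yields A = AA and the nondegeneracy of
  \<delta> and \<kappa>. The comultiplication is known to be linear on \<open>AP\<close> only; a
  linear projection onto \<open>AP\<close> makes it total, so that tensor products of maps can be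
  formed.\<close>

named_theorems clin

text \<open>Kept out of \<open>clin\<close>, the set of rules for structural linearity proofs,
  because as a bare introduction rule it fits every goal. Only instances with a fixed outer map are
  added.\<close>

lemma clinear_compose: "clinear f \<Longrightarrow> clinear g \<Longrightarrow> clinear (\<lambda>x. f (g x))"
  by (rule clinearI) (simp_all add: clinear_add clinear_scaleC)

lemma clinear_ident [clin]: "clinear (\<lambda>x. x)"
  by (rule clinearI) simp_all

lemma clinear_0: "clinear f \<Longrightarrow> f 0 = 0"
  using clinear_add[of f 0 0] by simp

lemma clinear_uminus: "clinear f \<Longrightarrow> f (- x) = - f x"
  using clinear_add[of f x "- x"] by (simp add: clinear_0 eq_neg_iff_add_eq_0 add.commute)

lemma clinear_diff: "clinear f \<Longrightarrow> f (x - y) = f x - f y"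
  using clinear_add[of f x "- y"] by (simp add: clinear_uminus)

lemma clinear_sum: "clinear f \<Longrightarrow> f (sum g A) = (\<Sum>a\<in>A. f (g a))"
  by (induction A rule: infinite_finite_induct) (simp_all add: clinear_0 clinear_add)

lemma clinear_zero_fun [clin]: "clinear (\<lambda>_. 0)"
  by (rule clinearI) simp_all

lemma clinear_plus_fun [clin]: "clinear f \<Longrightarrow> clinear g \<Longrightarrow> clinear (\<lambda>x. f x + g x)"
  by (rule clinearI) (simp_all add: clinear_add clinear_scaleC scaleC_add_right)

lemma clinear_minus_fun [clin]: "clinear f \<Longrightarrow> clinear g \<Longrightarrow> clinear (\<lambda>x. f x - g x)"
  by (rule clinearI)
     (simp_all add: clinear_add clinear_scaleC complex_vector.scale_right_diff_distrib)

lemma clinear_scaleC_fun [clin]: "clinear f \<Longrightarrow> clinear (\<lambda>x. c *\<^sub>C f x)"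
  by (rule clinearI) (simp_all add: clinear_add clinear_scaleC scaleC_add_right scaleC_scaleC mult.commute)

lemma clinear_functional_scaleC [clin]: "clinear f \<Longrightarrow> clinear (\<lambda>x. f x *\<^sub>C v)"
  by (rule clinearI)
     (simp_all add: clinear_add clinear_scaleC scaleC_add_left scaleC_scaleC scaleC_complex_def)

lemma clinear_times_left [clin]:
  fixes a :: "'a::complex_algebra"
  shows "clinear f \<Longrightarrow> clinear (\<lambda>x. f x * a)"
  by (rule clinearI) (simp_all add: clinear_add clinear_scaleC distrib_right scaleC_mult_left)

lemma clinear_times_right [clin]:
  fixes a :: "'a::complex_algebra"
  shows "clinear f \<Longrightarrow> clinear (\<lambda>x. a * f x)"
  by (rule clinearI) (simp_all add: clinear_add clinear_scaleC distrib_left scaleC_mult_right)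

lemma clinear_pure_left [clin]: "clinear f \<Longrightarrow> clinear (\<lambda>x. f x \<otimes>\<^sub>t b)"
  by (rule clinearI) (simp_all add: clinear_add clinear_scaleC pure_tensor_linear)

lemma clinear_pure_right [clin]: "clinear f \<Longrightarrow> clinear (\<lambda>x. a \<otimes>\<^sub>t f x)"
  by (rule clinearI) (simp_all add: clinear_add clinear_scaleC pure_tensor_linear)

lemma clinear_eq_on_span:
  assumes "clinear f" "clinear g" "\<And>x. x \<in> B \<Longrightarrow> f x = g x" "x \<in> complex_vector.span B"
  shows "f x = g x"
  using assms(4)
  by (induction rule: complex_vector.span_induct_alt)
     (simp_all add: assms clinear_0 clinear_add clinear_scaleC)

lemma clinear_in_subspace:
  assumes "clinear f" "complex_vector.subspace S" "\<And>x. x \<in> B \<Longrightarrow> f x \<in> S" "x \<in> complex_vector.span B"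
  shows "f x \<in> S"
  using assms(4)
  by (induction rule: complex_vector.span_induct_alt)
     (simp_all add: assms clinear_0 clinear_add clinear_scaleC complex_vector.subspace_0
       complex_vector.subspace_add complex_vector.subspace_scale)

lemma clinear_representation:
  assumes "complex_vector.independent B" "complex_vector.span B = UNIV"
  shows "clinear (\<lambda>x. complex_vector.representation B x b)"
  by (rule clinearI)
     (simp_all add: assms complex_vector.representation_add complex_vector.representation_scale
        scaleC_complex_def)

lemma exists_functional:
  fixes v :: "'a::complex_vector"
  assumes "v \<noteq> 0"
  obtains f :: "'a \<Rightarrow> complex" where "clinear f" "f v = 1"
proof -
  have ind: "complex_vector.independent {v}" using assms by simp
  let ?B = "complex_vector.extend_basis {v}"
  have B: "complex_vector.independent ?B" "complex_vector.span ?B = UNIV" "v \<in> ?B"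
    using ind complex_vector.independent_extend_basis complex_vector.span_extend_basis
      complex_vector.extend_basis_superset by blast+
  show thesis
    by (rule that[OF clinear_representation[OF B(1,2)]])
       (use B in \<open>simp add: complex_vector.representation_basis\<close>)
qed

lemma functionals_separate:
  assumes "\<And>f. clinear f \<Longrightarrow> f v = (0::complex)"
  shows "v = 0"
  using assms exists_functional[of v] by (metis zero_neq_one)

text \<open>A basis of \<open>S\<close> is extended to a basis of the whole space; the projection
  keeps the coordinates that belong to the basis of \<open>S\<close>.\<close>

lemma exists_projection:
  fixes S :: "'a::complex_vector set"
  assumes S: "complex_vector.subspace S"
  obtains P :: "'a \<Rightarrow> 'a" where "clinear P" "\<And>x. P x \<in> S" "\<And>x. x \<in> S \<Longrightarrow> P x = x"
proof -
  obtain B where B: "B \<subseteq> S" "complex_vector.independent B" "S \<subseteq> complex_vector.span B"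
    using complex_vector.maximal_independent_subset[of S] by metis
  let ?C = "complex_vector.extend_basis B"
  have C: "complex_vector.independent ?C" "complex_vector.span ?C = UNIV" "B \<subseteq> ?C"
    using B(2) complex_vector.independent_extend_basis complex_vector.span_extend_basis
      complex_vector.extend_basis_superset by blast+
  let ?P = "\<lambda>x. \<Sum>b | b \<in> B \<and> complex_vector.representation ?C x b \<noteq> 0.
    complex_vector.representation ?C x b *\<^sub>C b"
  have fin: "finite {b. b \<in> B \<and> complex_vector.representation ?C x b \<noteq> 0}" for x
    by (rule finite_subset[OF _ complex_vector.finite_representation[of ?C x]]) auto
  \<comment> \<open>The support depends on x; this allows the sums for x, y and x + y to run over
    one common finite set.\<close>
  have eq: "?P x = (\<Sum>b\<in>F. complex_vector.representation ?C x b *\<^sub>C b)"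
    if "finite F" "{b. b \<in> B \<and> complex_vector.representation ?C x b \<noteq> 0} \<subseteq> F" "F \<subseteq> B" for x F
    by (rule sum.mono_neutral_left) (use that in auto)
  have add: "?P (x + y) = ?P x + ?P y" for x y
  proof -
    let ?F = "{b. b \<in> B \<and> complex_vector.representation ?C x b \<noteq> 0} \<union>
      {b. b \<in> B \<and> complex_vector.representation ?C y b \<noteq> 0}"
    have rep: "complex_vector.representation ?C (x + y) b =
        complex_vector.representation ?C x b + complex_vector.representation ?C y b" for b
      using C by (simp add: complex_vector.representation_add)
    have fF: "finite ?F" using fin by blast
    have "?P (x + y) = (\<Sum>b\<in>?F. complex_vector.representation ?C (x + y) b *\<^sub>C b)"
      by (rule eq[OF fF]) (auto simp: rep)
    moreover have "?P x = (\<Sum>b\<in>?F. complex_vector.representation ?C x b *\<^sub>C b)"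
      by (rule eq[OF fF]) auto
    moreover have "?P y = (\<Sum>b\<in>?F. complex_vector.representation ?C y b *\<^sub>C b)"
      by (rule eq[OF fF]) auto
    ultimately show ?thesis
      by (simp only: rep scaleC_add_left sum.distrib)
  qed
  have scale: "?P (c *\<^sub>C x) = c *\<^sub>C ?P x" for c x
  proof -
    have rep: "complex_vector.representation ?C (c *\<^sub>C x) b = c * complex_vector.representation ?C x b" for b
      using C by (simp add: complex_vector.representation_scale)
    have "?P (c *\<^sub>C x) = (\<Sum>b | b \<in> B \<and> complex_vector.representation ?C x b \<noteq> 0.
        complex_vector.representation ?C (c *\<^sub>C x) b *\<^sub>C b)"
      by (rule eq[OF fin]) (auto simp: rep)
    then show ?thesis by (simp add: rep complex_vector.scale_sum_right scaleC_scaleC)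
  qed
  show thesis
  proof (rule that[of ?P])
    show "clinear ?P" by (rule clinearI) (fact add scale)+
    show "?P x \<in> S" for x
      by (rule complex_vector.subspace_sum[OF S])
         (use B in \<open>auto intro: complex_vector.subspace_scale[OF S]\<close>)
    show "?P x = x" if "x \<in> S" for x
    proof (rule clinear_eq_on_span[OF \<open>clinear ?P\<close> clinear_ident])
      show "x \<in> complex_vector.span B" using that B by auto
      fix b assume b: "b \<in> B"
      then have "complex_vector.representation ?C b = (\<lambda>v. if v = b then 1 else 0)"
        using C by (simp add: complex_vector.representation_basis subsetD)
      then have "?P b = (\<Sum>v\<in>{b}. complex_vector.representation ?C b v *\<^sub>C v)"
        by (intro eq) (use b in auto)
      then show "?P b = b" using \<open>complex_vector.representation ?C b = _\<close> by (simp add: scaleC_one)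
    qed
  qed
qed


section \<open>Tensor products of vector spaces\<close>

definition cbilinear :: "('a::complex_vector \<Rightarrow> 'b::complex_vector \<Rightarrow> 'c::complex_vector) \<Rightarrow> bool"
  where "cbilinear f \<longleftrightarrow> (\<forall>a. clinear (\<lambda>b. f a b)) \<and> (\<forall>b. clinear (\<lambda>a. f a b))"

lemma cbilinearI [clin]: "(\<And>a. clinear (\<lambda>b. f a b)) \<Longrightarrow> (\<And>b. clinear (\<lambda>a. f a b)) \<Longrightarrow> cbilinear f"
  by (simp add: cbilinear_def)

lemma cbilinear_balanced: "cbilinear f \<Longrightarrow> balanced f"
  unfolding cbilinear_def by (rule balancedI) (metis clinear_add clinear_scaleC)+

lemma tensor_lift_pure_tensor: "cbilinear f \<Longrightarrow> tensor_lift f (a \<otimes>\<^sub>t b) = f a b"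
  by (rule tensor_lift_pure[OF cbilinear_balanced])

lemma clinear_tensor_lift [clin]:
  assumes "cbilinear f" "clinear g"
  shows "clinear (\<lambda>x. tensor_lift f (g x))"
proof (rule clinear_compose[OF _ assms(2)], rule clinearI)
  note b = cbilinear_balanced[OF assms(1)]
  show "tensor_lift f (x + y) = tensor_lift f x + tensor_lift f y" for x y
    by (rule tensor_lift_add[OF b])
  show "tensor_lift f (c *\<^sub>C x) = c *\<^sub>C tensor_lift f x" for c x
    by (rule tensor_lift_scaleC[OF b]) (rule clinear_scaleC[of "\<lambda>a. f a b" for b], use assms(1) in \<open>simp add: cbilinear_def\<close>)
qed

lemma tensor_eqI:
  assumes "clinear F" "clinear G" "\<And>a b. F (a \<otimes>\<^sub>t b) = G (a \<otimes>\<^sub>t b)"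
  shows "F t = G t"
  by (induction t) (simp_all add: assms clinear_add)

lemma tensor_in_subspace:
  assumes "clinear F" "complex_vector.subspace S" "\<And>a b. F (a \<otimes>\<^sub>t b) \<in> S"
  shows "F t \<in> S"
  by (induction t) (simp_all add: assms clinear_add complex_vector.subspace_add)

lemma clinear_tensor_map_fun [clin]:
  "clinear f \<Longrightarrow> clinear g \<Longrightarrow> clinear h \<Longrightarrow> clinear (\<lambda>x. tensor_map f g (h x))"
  by (rule clinear_compose[OF clinear_tensor_map])

text \<open>Serves nested lifts: there the variable sits in the bilinear map and not in the tensor,
  so \<open>clinear_tensor_lift\<close> does not apply.\<close>

lemma clinear_tensor_lift_param:
  assumes "\<And>x. cbilinear (f x)" "\<And>a b. clinear (\<lambda>x. f x a b)"
  shows "clinear (\<lambda>x. tensor_lift (f x) t)"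
proof (induction t)
  case (pure a b)
  show ?case by (simp add: tensor_lift_pure_tensor assms)
next
  case (add s t)
  then show ?case
    by (simp add: clinear_add[OF clinear_tensor_lift[OF assms(1) clinear_ident]] clinear_plus_fun)
qed

lemma clinear_tensor_map_left [clin]:
  assumes "\<And>x. clinear (f x)" "\<And>a. clinear (\<lambda>x. f x a)" "clinear g"
  shows "clinear (\<lambda>x. tensor_map (f x) g t)"
  unfolding tensor_map_def by (rule clinear_tensor_lift_param) (intro clin assms)+

lemma clinear_tensor_map_right [clin]:
  assumes "\<And>x. clinear (g x)" "\<And>a. clinear (\<lambda>x. g x a)" "clinear f"
  shows "clinear (\<lambda>x. tensor_map f (g x) t)"
  unfolding tensor_map_def by (rule clinear_tensor_lift_param) (intro clin assms)+

lemma clinear_tensor_lift_comp: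
  assumes "clinear F" "cbilinear f"
  shows "F (tensor_lift f t) = tensor_lift (\<lambda>a b. F (f a b)) t"
proof -
  have *: "cbilinear (\<lambda>a b. F (f a b))"
    using assms(2) by (auto simp: cbilinear_def intro: clinear_compose[OF assms(1)])
  show ?thesis
    by (rule tensor_eqI) (intro clin clinear_compose[OF assms(1)] assms *
      | simp add: tensor_lift_pure_tensor assms *)+
qed

lemma tensor_lift_tensor_map:
  assumes "clinear g" "clinear h" "cbilinear f"
  shows "tensor_lift f (tensor_map g h t) = tensor_lift (\<lambda>a b. f (g a) (h b)) t"
proof -
  have *: "cbilinear (\<lambda>a b. f (g a) (h b))"
    using assms(3)
    by (auto simp: cbilinear_def intro: clinear_compose[OF _ assms(1)] clinear_compose[OF _ assms(2)])
  show ?thesis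
    by (rule tensor_eqI) (intro clin assms * | simp add: tensor_lift_pure_tensor tensor_map_pure assms *)+
qed

lemma tensor_map_tensor_map:
  assumes "clinear f" "clinear g" "clinear f'" "clinear g'"
  shows "tensor_map f g (tensor_map f' g' t) = tensor_map (\<lambda>x. f (f' x)) (\<lambda>x. g (g' x)) t"
  by (rule tensor_eqI; (intro clin assms clinear_compose[OF assms(1)] clinear_compose[OF assms(2)])?)
     (simp add: tensor_map_pure assms clinear_compose)

lemma tensor_map_ident: "tensor_map (\<lambda>x. x) (\<lambda>x. x) t = t"
  by (rule tensor_eqI; (intro clin)?) (simp add: tensor_map_pure clin)

section \<open>Slice maps and separation of tensors\<close>

abbreviation slice_left :: "('a::complex_vector \<Rightarrow> complex) \<Rightarrow> ('a, 'b::complex_vector) tensor \<Rightarrow> 'b"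
  where "slice_left f \<equiv> tensor_lift (\<lambda>a b. f a *\<^sub>C b)"

abbreviation slice_right :: "('b::complex_vector \<Rightarrow> complex) \<Rightarrow> ('a::complex_vector, 'b) tensor \<Rightarrow> 'a"
  where "slice_right f \<equiv> tensor_lift (\<lambda>a b. f b *\<^sub>C a)"

lemma cbilinear_slice_left [clin]: "clinear f \<Longrightarrow> cbilinear (\<lambda>a b. f a *\<^sub>C b)"
  by (intro clin)

lemma slice_pure:
  "clinear f \<Longrightarrow> slice_left f (a \<otimes>\<^sub>t b) = f a *\<^sub>C b"
  "clinear g \<Longrightarrow> slice_right g (a \<otimes>\<^sub>t b) = g b *\<^sub>C a"
  by (simp_all add: tensor_lift_pure_tensor clin)

text \<open>For a basis of the first space, a tensor is the finite sum of b \<otimes> (its slice by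
  the coordinate functional of b), so it vanishes with its slices.\<close>

lemma slice_left_separates:
  fixes t :: "('a::complex_vector, 'b::complex_vector) tensor"
  assumes "\<And>f. clinear f \<Longrightarrow> slice_left f t = 0"
  shows "t = 0"
proof -
  define B :: "'a set" where "B = complex_vector.extend_basis {}"
  define c where "c b x = complex_vector.representation B x b" for b x
  have B: "complex_vector.independent B" "complex_vector.span B = UNIV"
    unfolding B_def
    by (simp_all add: complex_vector.independent_extend_basis complex_vector.span_extend_basis
        complex_vector.independent_empty)
  have c: "clinear (c b)" for b
    unfolding c_def by (rule clinear_representation[OF B])
  \<comment> \<open>Quantifying over all finite supersets makes the claim additive: for a sum of two
    tensors the union of their index sets serves.\<close>
  have "\<exists>F. finite F \<and> (\<forall>F'. finite F' \<and> F \<subseteq> F' \<longrightarrow> t = (\<Sum>b\<in>F'. b \<otimes>\<^sub>t slice_left (c b) t))"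
    for t :: "('a, 'b) tensor"
  proof (induction t)
    case (pure x y)
    have "x \<otimes>\<^sub>t y = (\<Sum>b\<in>F'. b \<otimes>\<^sub>t slice_left (c b) (x \<otimes>\<^sub>t y))"
      if F': "finite F'" "{b. c b x \<noteq> 0} \<subseteq> F'" for F'
    proof -
      have "x = (\<Sum>b | c b x \<noteq> 0. c b x *\<^sub>C b)"
        unfolding c_def using B by (simp add: complex_vector.sum_nonzero_representation_eq)
      also have "\<dots> = (\<Sum>b\<in>F'. c b x *\<^sub>C b)"
        by (rule sum.mono_neutral_left) (use F' in auto)
      finally have "x \<otimes>\<^sub>t y = (\<Sum>b\<in>F'. (c b x *\<^sub>C b) \<otimes>\<^sub>t y)"
        using clinear_sum[of "\<lambda>x. x \<otimes>\<^sub>t y" "\<lambda>b. c b x *\<^sub>C b" F'] by (simp add: clin)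
      then show ?thesis by (subst slice_pure(1)[OF c]) (simp only: pure_tensor_linear)
    qed
    moreover have "finite {b. c b x \<noteq> 0}"
      unfolding c_def by (rule complex_vector.finite_representation)
    ultimately show ?case by blast
  next
    case (add s t)
    obtain F G where F: "finite F" "\<forall>F'. finite F' \<and> F \<subseteq> F' \<longrightarrow> s = (\<Sum>b\<in>F'. b \<otimes>\<^sub>t slice_left (c b) s)"
      and G: "finite G" "\<forall>F'. finite F' \<and> G \<subseteq> F' \<longrightarrow> t = (\<Sum>b\<in>F'. b \<otimes>\<^sub>t slice_left (c b) t)"
      using add by blast
    have "s + t = (\<Sum>b\<in>F'. b \<otimes>\<^sub>t slice_left (c b) (s + t))" if F': "finite F'" "F \<union> G \<subseteq> F'" for F'
    proof -
      have "s = (\<Sum>b\<in>F'. b \<otimes>\<^sub>t slice_left (c b) s)" "t = (\<Sum>b\<in>F'. b \<otimes>\<^sub>t slice_left (c b) t)"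
        using F G F' by blast+
      then show ?thesis
        by (simp add: clinear_add[OF clinear_tensor_lift[OF cbilinear_slice_left[OF c] clinear_ident]]
            pure_tensor_add_right sum.distrib)
    qed
    with F(1) G(1) show ?case by (intro exI[of _ "F \<union> G"]) auto
  qed
  then obtain F where "finite F" "t = (\<Sum>b\<in>F. b \<otimes>\<^sub>t slice_left (c b) t)" by blast
  moreover have "slice_left (c b) t = 0" for b by (rule assms[OF c])
  ultimately show ?thesis
    by (simp add: clinear_0[OF clinear_pure_right[OF clinear_ident]])
qed

text \<open>Both sides are f \<otimes> g applied to t. This Fubini rule transfers separation results
  from one leg to the other.\<close>

lemma slice_slice:
  assumes "clinear f" "clinear g"
  shows "g (slice_left f t) = f (slice_right g t)"
proof (rule tensor_eqI)
  show "clinear (\<lambda>t. g (slice_left f t))" "clinear (\<lambda>t. f (slice_right g t))"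
    by (intro clin assms clinear_compose[OF assms(1)] clinear_compose[OF assms(2)])+
  show "g (slice_left f (a \<otimes>\<^sub>t b)) = f (slice_right g (a \<otimes>\<^sub>t b))" for a b
    by (simp add: slice_pure(1)[OF assms(1)] slice_pure(2)[OF assms(2)] clinear_scaleC[OF assms(1)]
        clinear_scaleC[OF assms(2)] scaleC_complex_def)
qed

text \<open>By \<open>slice_slice\<close>, every g in \<Omega> annihilates each left slice of t, so
  all left slices vanish. A restricted family matters later, when only some slices are under
  control.\<close>

lemma slice_right_separates:
  fixes t :: "('a::complex_vector, 'b::complex_vector) tensor"
  assumes \<Omega>: "\<And>g. g \<in> \<Omega> \<Longrightarrow> clinear g" "\<And>v. (\<And>g. g \<in> \<Omega> \<Longrightarrow> g v = 0) \<Longrightarrow> v = 0"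
    and "\<And>g. g \<in> \<Omega> \<Longrightarrow> slice_right g t = 0"
  shows "t = 0"
proof (rule slice_left_separates)
  fix f :: "'a \<Rightarrow> complex" assume f: "clinear f"
  show "slice_left f t = 0"
  proof (rule \<Omega>(2))
    show "g (slice_left f t) = 0" if "g \<in> \<Omega>" for g
      using assms(3)[OF that] by (simp add: slice_slice[OF f \<Omega>(1)[OF that]] clinear_0 f)
  qed
qed

lemma slice_left_separates_on:
  fixes t :: "('a::complex_vector, 'b::complex_vector) tensor"
  assumes \<Omega>: "\<And>f. f \<in> \<Omega> \<Longrightarrow> clinear f" "\<And>v. (\<And>f. f \<in> \<Omega> \<Longrightarrow> f v = 0) \<Longrightarrow> v = 0"
    and "\<And>f. f \<in> \<Omega> \<Longrightarrow> slice_left f t = 0"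
  shows "t = 0"
proof (rule slice_right_separates[of "Collect clinear"])
  fix g :: "'b \<Rightarrow> complex" assume "g \<in> Collect clinear"
  then have g: "clinear g" by simp
  show "slice_right g t = 0"
  proof (rule \<Omega>(2))
    show "f (slice_right g t) = 0" if "f \<in> \<Omega>" for f
      using assms(3)[OF that] by (simp add: slice_slice[OF \<Omega>(1)[OF that] g, symmetric] clinear_0 g)
  qed
qed (auto intro: functionals_separate)

lemma slice_left_tensor_map:
  assumes "clinear f" "clinear g" "clinear h"
  shows "slice_left f (tensor_map g h t) = h (slice_left (\<lambda>x. f (g x)) t)"
  by (rule tensor_eqI;
      (intro clin clinear_compose[OF assms(1)] clinear_compose[OF assms(3)] assms)?)
     (simp add: slice_pure tensor_map_pure clinear_compose clinear_scaleC assms)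

lemma slice_right_tensor_map:
  assumes "clinear f" "clinear g" "clinear h"
  shows "slice_right f (tensor_map g h t) = g (slice_right (\<lambda>x. f (h x)) t)"
  by (rule tensor_eqI;
      (intro clin clinear_compose[OF assms(1)] clinear_compose[OF assms(2)] assms)?)
     (simp add: slice_pure tensor_map_pure clinear_compose clinear_scaleC assms)

text \<open>Functionals that factor through some \<open>F i\<close> already separate points, so
  slicing by them is enough. Nondegeneracy of A \<otimes> B and the embedding of M(A) \<otimes> M(B)
  both come from this.\<close>

lemma tensor_map_separates:
  fixes t :: "('a::complex_vector, 'b::complex_vector) tensor"
    and F :: "'i \<Rightarrow> 'a \<Rightarrow> 'c::complex_vector" and G :: "'j \<Rightarrow> 'b \<Rightarrow> 'd::complex_vector"
  assumes F: "\<And>i. clinear (F i)" "\<And>v. (\<And>i. F i v = 0) \<Longrightarrow> v = 0"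
    and G: "\<And>j. clinear (G j)" "\<And>v. (\<And>j. G j v = 0) \<Longrightarrow> v = 0"
    and t: "\<And>i j. tensor_map (F i) (G j) t = 0"
  shows "t = 0"
proof -
  have "slice_left (\<lambda>x. f (F i x)) t = 0" if f: "clinear f" for f :: "'c \<Rightarrow> complex" and i
    by (rule G(2))
       (use t[of i] in \<open>simp add: slice_left_tensor_map[OF f F(1) G(1), symmetric]
          clinear_0[OF clinear_tensor_lift[OF cbilinear_slice_left[OF f] clinear_ident]]\<close>)
  then show ?thesis
    by (intro slice_left_separates_on[of "{\<lambda>x. f (F i x) | f i. clinear f}"])
       (auto intro: clinear_compose F(1), rule F(2), rule functionals_separate, blast)
qed

lemma tensor_map_inj:
  assumes "clinear f" "inj f" "clinear g" "inj g" "tensor_map f g s = tensor_map f g t"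
  shows "s = t"
proof -
  have "tensor_map f g (s - t) = 0"
    using assms by (simp add: clinear_diff[OF clinear_tensor_map])
  then have "s - t = 0"
    by (intro tensor_map_separates[of "\<lambda>_::unit. f" "\<lambda>_::unit. g"])
       (use assms in \<open>auto dest: injD[of _ _ 0] simp: clinear_0\<close>)
  then show ?thesis by simp
qed

lemma clinear_tensor_assoc: "clinear tensor_assoc"
proof (rule clinearI)
  show "tensor_assoc (c *\<^sub>C x) = c *\<^sub>C tensor_assoc x" for c x
  proof (induction x)
    case (pure s z)
    show ?case
      by (induction s)
        (simp_all add: pure_tensor_add_left scaleC_add_right tensor_assoc_add tensor_assoc_pure,
         simp_all add: pure_tensor_scaleC_left[symmetric] tensor_assoc_pure)
  qed (simp add: scaleC_add_right tensor_assoc_add)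
qed (rule tensor_assoc_add)

lemma clinear_tensor_assoc': "clinear tensor_assoc'"
proof (rule clinearI)
  show "tensor_assoc' (c *\<^sub>C x) = c *\<^sub>C tensor_assoc' x" for c x
    using tensor_assoc'_assoc tensor_assoc_assoc'
    by (metis clinear_scaleC[OF clinear_tensor_assoc])
qed (rule tensor_assoc'_add)

lemmas clinear_tensor_assoc_fun [clin] =
  clinear_compose[OF clinear_tensor_assoc] clinear_compose[OF clinear_tensor_assoc']

lemma tensor3_eqI:
  assumes "clinear F" "clinear G" "\<And>a b c. F ((a \<otimes>\<^sub>t b) \<otimes>\<^sub>t c) = G ((a \<otimes>\<^sub>t b) \<otimes>\<^sub>t c)"
  shows "F t = G t"
proof (rule tensor_eqI[OF assms(1,2)])
  show "F (s \<otimes>\<^sub>t c) = G (s \<otimes>\<^sub>t c)" for s c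
    by (rule tensor_eqI[of "\<lambda>s. F (s \<otimes>\<^sub>t c)"])
       (intro clin clinear_compose[OF assms(1)] clinear_compose[OF assms(2)] | simp add: assms)+
qed

section \<open>Evaluating lifts on tensor products of subspaces\<close>

lemma tensor_span_imp_sum:
  assumes "complex_vector.subspace S" "t \<in> tensor_span S T"
  shows "\<exists>p. set_mset p \<subseteq> S \<times> T \<and> t = (\<Sum>(a, b)\<in>#p. a \<otimes>\<^sub>t b)"
  using assms(2) unfolding tensor_span_def
proof (induction rule: complex_vector.span_induct_alt)
  case base
  show ?case by (rule exI[of _ "{#}"]) simp
next
  case (step c x y)
  then obtain a b p where "a \<in> S" "b \<in> T" "x = a \<otimes>\<^sub>t b" "set_mset p \<subseteq> S \<times> T" "y = (\<Sum>(a, b)\<in>#p. a \<otimes>\<^sub>t b)"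
    by blast
  then show ?case
    using complex_vector.subspace_scale[OF assms(1)]
    by (intro exI[of _ "add_mset (c *\<^sub>C a, b) p"]) (auto simp: pure_tensor_linear)
qed

text \<open>Every admissible decomposition evaluates \<open>g\<close> on \<open>S\<close> and
  \<open>T\<close> only, where it is the globally bilinear \<open>f\<close>, so the definite
  description is met. Maps controlled on \<open>AP\<close> alone are handled this way.\<close>

lemma tensor_lift_on_eq:
  assumes "complex_vector.subspace S" "t \<in> tensor_span S T" "cbilinear f"
    and eq: "\<And>a b. a \<in> S \<Longrightarrow> b \<in> T \<Longrightarrow> g a b = f a b"
  shows "tensor_lift_on S T g t = tensor_lift f t"
proof -
  obtain p where p: "set_mset p \<subseteq> S \<times> T" "t = (\<Sum>(a, b)\<in>#p. a \<otimes>\<^sub>t b)"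
    using tensor_span_imp_sum[OF assms(1,2)] by blast
  have sum: "(\<Sum>(a, b)\<in>#q. g a b) = tensor_lift f t"
    if "set_mset q \<subseteq> S \<times> T" "t = (\<Sum>(a, b)\<in>#q. a \<otimes>\<^sub>t b)" for q
  proof -
    have "(\<Sum>(a, b)\<in>#q. g a b) = (\<Sum>(a, b)\<in>#q. f a b)"
      by (rule arg_cong[of _ _ sum_mset], rule image_mset_cong) (use that eq in auto)
    also have "\<dots> = tensor_lift f t"
      using tensor_lift_abs[OF cbilinear_balanced[OF assms(3)]] that(2) by (simp add: abs_tensor_sum)
    finally show ?thesis .
  qed
  show ?thesis unfolding tensor_lift_on_def[of S T]
  proof (rule the_equality)
    show "\<forall>p. set_mset p \<subseteq> S \<times> T \<and> t = (\<Sum>(a, b)\<in>#p. a \<otimes>\<^sub>t b) \<longrightarrow>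
        tensor_lift f t = (\<Sum>(a, b)\<in>#p. g a b)"
      using sum by simp
    show "u = tensor_lift f t"
      if "\<forall>p. set_mset p \<subseteq> S \<times> T \<and> t = (\<Sum>(a, b)\<in>#p. a \<otimes>\<^sub>t b) \<longrightarrow> u = (\<Sum>(a, b)\<in>#p. g a b)" for u
      using that[rule_format, of p] p sum[of p] by simp
  qed
qed

lemma tensor_lift_cong_tensor_span:
  assumes "complex_vector.subspace S" "t \<in> tensor_span S T" "cbilinear f" "cbilinear g"
    "\<And>a b. a \<in> S \<Longrightarrow> b \<in> T \<Longrightarrow> f a b = g a b"
  shows "tensor_lift f t = tensor_lift g t"
  using tensor_lift_on_eq[OF assms(1-3), of f] tensor_lift_on_eq[OF assms(1,2,4), of f] assms(5) by simp

lemma tensor_map_in_tensor_span: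
  assumes "clinear P" "clinear Q" "\<And>x. P x \<in> S" "\<And>y. Q y \<in> T"
  shows "tensor_map P Q t \<in> tensor_span S T"
  by (rule tensor_in_subspace)
     (auto simp: tensor_span_def tensor_map_pure assms intro: clinear_tensor_map assms complex_vector.span_base)

lemma tensor_map_on_tensor_span:
  assumes "clinear P" "clinear Q" "\<And>x. x \<in> S \<Longrightarrow> P x = P' x" "\<And>y. y \<in> T \<Longrightarrow> Q y = Q' y"
    and "clinear P'" "clinear Q'" "t \<in> tensor_span S T"
  shows "tensor_map P Q t = tensor_map P' Q' t"
  by (rule clinear_eq_on_span[OF _ _ _ assms(7)[unfolded tensor_span_def]])
     (auto simp: tensor_map_pure assms intro: clinear_tensor_map assms)


section \<open>Multiplier algebras\<close>

abbreviation nondeg :: "'a::complex_algebra itself \<Rightarrow> bool"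
  where "nondeg \<equiv> nondegenerate_product"

lemma nondeg_left:
  assumes "nondeg TYPE('a::complex_algebra)" "\<And>c. (a::'a) * c = b * c"
  shows "a = b"
proof -
  have "\<forall>c. (a - b) * c = 0" by (simp add: left_diff_distrib assms(2))
  then have "a - b = 0" using assms(1) unfolding nondegenerate_product_def by blast
  then show ?thesis by simp
qed

lemma nondeg_right:
  assumes "nondeg TYPE('a::complex_algebra)" "\<And>c. c * (a::'a) = c * b"
  shows "a = b"
proof -
  have "\<forall>c. c * (a - b) = 0" by (simp add: right_diff_distrib assms(2))
  then have "a - b = 0" using assms(1) unfolding nondegenerate_product_def by blast
  then show ?thesis by simp
qed

lemma tensor_mult_pure_map:
  fixes t :: "('a::complex_algebra, 'b::complex_algebra) tensor"
  shows "(a \<otimes>\<^sub>t b) * t = tensor_map ((*) a) ((*) b) t" "t * (a \<otimes>\<^sub>t b) = tensor_map (\<lambda>x. x * a) (\<lambda>y. y * b) t"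
  by (rule tensor_eqI; (intro clin)?; simp add: tensor_mult_pure tensor_map_pure clin)+

text \<open>Multiplication by a pure tensor is a tensor product of one-sided multiplications, and
  these separate points in each factor.\<close>

lemma nondeg_tensor:
  assumes A: "nondeg TYPE('a::complex_algebra)" and B: "nondeg TYPE('b::complex_algebra)"
  shows "nondeg TYPE(('a, 'b) tensor)"
  unfolding nondegenerate_product_def
proof (intro conjI allI impI)
  fix t :: "('a, 'b) tensor"
  show "t = 0" if "\<forall>s. t * s = 0"
  proof (rule tensor_map_separates[of "\<lambda>a x. x * a" "\<lambda>b y. y * b"])
    show "tensor_map (\<lambda>x. x * a) (\<lambda>y. y * b) t = 0" for a b
      using that tensor_mult_pure_map(2)[of t a b] by simp
    show "clinear (\<lambda>x. x * a)" "clinear (\<lambda>y. y * b)" for a :: 'a and b :: 'b by (intro clin)+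
    show "x = 0" if "\<And>a. x * a = 0" for x :: 'a
      using A that unfolding nondegenerate_product_def by blast
    show "y = 0" if "\<And>b. y * b = 0" for y :: 'b
      using B that unfolding nondegenerate_product_def by blast
  qed
  show "t = 0" if "\<forall>s. s * t = 0"
  proof (rule tensor_map_separates[of "(*)" "(*)"])
    show "tensor_map ((*) a) ((*) b) t = 0" for a b
      using that tensor_mult_pure_map(1)[of a b t] by simp
    show "clinear ((*) a)" "clinear ((*) b)" for a :: 'a and b :: 'b by (intro clin)+
    show "x = 0" if "\<And>a. a * x = 0" for x :: 'a
      using A that unfolding nondegenerate_product_def by blast
    show "y = 0" if "\<And>b. b * y = 0" for y :: 'b
      using B that unfolding nondegenerate_product_def by blast
  qed
qed

lemma lmult_simps [simp]:
  "lmult (m + n) a = lmult m a + lmult n a" "lmult (m * n) a = lmult m (lmult n a)"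
  "lmult 1 a = a" "lmult (c *\<^sub>C m) a = c *\<^sub>C lmult m a" "lmult (m - n) a = lmult m a - lmult n a"
  "lmult 0 a = 0" "lmult (to_multiplier b) a = b * a"
  by (transfer; auto)+

lemma rmult_simps [simp]:
  "rmult (m + n) a = rmult m a + rmult n a" "rmult (m * n) a = rmult n (rmult m a)"
  "rmult 1 a = a" "rmult (c *\<^sub>C m) a = c *\<^sub>C rmult m a" "rmult (m - n) a = rmult m a - rmult n a"
  "rmult 0 a = 0" "rmult (to_multiplier b) a = a * b"
  by (transfer; auto)+

lemma lmult_fun:
  "lmult (m + n) = (\<lambda>x. lmult m x + lmult n x)" "lmult (c *\<^sub>C m) = (\<lambda>x. c *\<^sub>C lmult m x)"
  "lmult (m * n) = (\<lambda>x. lmult m (lmult n x))" "lmult 1 = (\<lambda>x. x)" "lmult (to_multiplier a) = (*) a"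
  by (simp_all add: fun_eq_iff)

lemma rmult_fun:
  "rmult (m + n) = (\<lambda>x. rmult m x + rmult n x)" "rmult (c *\<^sub>C m) = (\<lambda>x. c *\<^sub>C rmult m x)"
  "rmult (m * n) = (\<lambda>x. rmult n (rmult m x))" "rmult 1 = (\<lambda>x. x)" "rmult (to_multiplier a) = (\<lambda>x. x * a)"
  by (simp_all add: fun_eq_iff)

lemma clinear_lmult_fun [clin]: "clinear f \<Longrightarrow> clinear (\<lambda>x. lmult m (f x))"
  by (rule clinear_compose[OF clinear_lmult])

lemma clinear_rmult_fun [clin]: "clinear f \<Longrightarrow> clinear (\<lambda>x. rmult m (f x))"
  by (rule clinear_compose[OF clinear_rmult])

lemma clinear_lmult_left [clin]: "clinear f \<Longrightarrow> clinear (\<lambda>x. lmult (f x) a)"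
  by (rule clinearI) (simp_all add: clinear_add clinear_scaleC)

lemma clinear_rmult_left [clin]: "clinear f \<Longrightarrow> clinear (\<lambda>x. rmult (f x) a)"
  by (rule clinearI) (simp_all add: clinear_add clinear_scaleC)

text \<open>The left action determines the right one through (b m) a = b (m a), since the factor a
  can be cancelled.\<close>

lemma multiplier_eqI_lmult:
  assumes "nondeg TYPE('a::complex_algebra)" "\<And>a::'a. lmult m a = lmult n a"
  shows "m = n"
proof (rule multiplier_eqI[OF assms(2)])
  show "rmult m a = rmult n a" for a
    by (rule nondeg_left[OF assms(1)]) (simp add: rmult_lmult assms(2))
qed

lemma multiplier_eqI_rmult:
  assumes "nondeg TYPE('a::complex_algebra)" "\<And>a::'a. rmult m a = rmult n a"
  shows "m = n"
proof (rule multiplier_eqI[OF _ assms(2)])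
  show "lmult m a = lmult n a" for a
    by (rule nondeg_right[OF assms(1)]) (simp add: rmult_lmult[symmetric] assms(2))
qed

lemma multiplier_exists:
  assumes "clinear l" "clinear r" "\<And>a b. r b * a = b * l a"
  shows "\<exists>m. lmult m = l \<and> rmult m = r"
  using assms
  by (intro exI[of _ "Abs_multiplier (l, r)"])
     (simp add: lmult.rep_eq rmult.rep_eq Abs_multiplier_inverse)

lemma multiplier_exists_lmult:
  assumes "clinear l" "clinear r" "\<And>a b. r b * a = b * l a"
  shows "\<exists>m. lmult m = l"
  using multiplier_exists[OF assms] by auto

lemma clinear_to_multiplier: "clinear to_multiplier"
  by (rule clinearI; transfer)
     (auto simp: fun_eq_iff distrib_left distrib_right scaleC_mult_left scaleC_mult_right)

lemmas clinear_to_multiplier_fun [clin] = clinear_compose[OF clinear_to_multiplier]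

lemma to_multiplier_mult: "to_multiplier (a * b) = to_multiplier a * to_multiplier b"
  by (rule multiplier_eqI) (simp_all add: mult.assoc)

lemma star_to_multiplier: "star (to_multiplier a) = to_multiplier (star (a::'a::star_algebra))"
  by transfer (auto simp: fun_eq_iff star_mult star_star)

lemma inj_to_multiplier: "nondeg TYPE('a::complex_algebra) \<Longrightarrow> inj (to_multiplier :: 'a \<Rightarrow> _)"
  by (rule injI, rule nondeg_left, assumption) (simp only: lmult_simps(7)[symmetric])

lemma lmult_mult_right:
  "nondeg TYPE('a::complex_algebra) \<Longrightarrow> lmult m (a * b) = lmult m a * (b::'a)"
  by (rule nondeg_right, assumption) (simp add: rmult_lmult[symmetric] mult.assoc[symmetric])

lemma rmult_mult_left:
  "nondeg TYPE('a::complex_algebra) \<Longrightarrow> rmult m (a * b) = a * rmult m (b::'a)"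
  by (rule nondeg_left, assumption) (simp add: rmult_lmult mult.assoc)

text \<open>The ideal property of A in M(A), used to turn actions of multipliers into products and
  back.\<close>

lemma mult_to_multiplier:
  assumes "nondeg TYPE('a::complex_algebra)"
  shows "m * to_multiplier (a::'a) = to_multiplier (lmult m a)"
    "to_multiplier a * m = to_multiplier (rmult m a)"
  by (rule multiplier_eqI; simp add: lmult_mult_right[OF assms] rmult_mult_left[OF assms] rmult_lmult)+


subsection \<open>Tensor products of multipliers\<close>

lemma lmult_multiplier_times: "lmult (multiplier_times m n) = tensor_map (lmult m) (lmult n)"
  and rmult_multiplier_times: "rmult (multiplier_times m n) = tensor_map (rmult m) (rmult n)"
  by (transfer; auto)+

lemma cbilinear_multiplier_times: "cbilinear multiplier_times"
  by (rule cbilinearI; rule clinearI; rule multiplier_eqI;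
      simp add: lmult_multiplier_times rmult_multiplier_times)
     (rule tensor_eqI; (intro clin clinear_lmult clinear_rmult)?;
      simp add: tensor_map_pure clin clinear_lmult clinear_rmult pure_tensor_linear)+

lemma clinear_multiplier_times [clin]:
  "clinear f \<Longrightarrow> clinear (\<lambda>x. multiplier_times m (f x))"
  "clinear f \<Longrightarrow> clinear (\<lambda>x. multiplier_times (f x) m)"
  using cbilinear_multiplier_times unfolding cbilinear_def
  by (fast intro: clinear_compose[of "multiplier_times m"] clinear_compose[of "\<lambda>x. multiplier_times x m"])+

lemma multiplier_times_mult:
  "multiplier_times m n * multiplier_times m' n' = multiplier_times (m * m') (n * n')"
  by (rule multiplier_eqI)
     (simp_all add: lmult_multiplier_times rmult_multiplier_times lmult_fun(3) rmult_fun(3)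
        tensor_map_tensor_map clinear_lmult clinear_rmult)

lemma multiplier_times_one: "multiplier_times 1 1 = 1"
  by (rule multiplier_eqI)
     (simp_all add: lmult_multiplier_times rmult_multiplier_times lmult_fun(4) rmult_fun(4) tensor_map_ident)

lemma multiplier_times_to_multiplier:
  "multiplier_times (to_multiplier a) (to_multiplier b) = to_multiplier (a \<otimes>\<^sub>t b)"
  by (rule multiplier_eqI)
     (simp_all add: lmult_multiplier_times rmult_multiplier_times lmult_fun(5) rmult_fun(5)
        tensor_mult_pure_map)

lemma star_multiplier_times:
  fixes m :: "'a::star_algebra multiplier" and n :: "'b::star_algebra multiplier"
  shows "star (multiplier_times m n) = multiplier_times (star m) (star n)"
proof (rule multiplier_eqI)
  have l: "lmult (star k) x = star (rmult k (star x))" and r: "rmult (star k) x = star (lmult k (star x))"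
    for k :: "'c::star_algebra multiplier" and x
    by (transfer; auto)+
  show "lmult (star (multiplier_times m n)) t = lmult (multiplier_times (star m) (star n)) t" for t
  proof (induction t)
    case (pure a b)
    show ?case
      by (simp add: l lmult_multiplier_times rmult_multiplier_times tensor_map_pure
          clinear_lmult clinear_rmult star_tensor_pure)
  qed (simp add: clinear_add[OF clinear_lmult])
  show "rmult (star (multiplier_times m n)) t = rmult (multiplier_times (star m) (star n)) t" for t
  proof (induction t)
    case (pure a b)
    show ?case
      by (simp add: r lmult_multiplier_times rmult_multiplier_times tensor_map_pure
          clinear_lmult clinear_rmult star_tensor_pure)
  qed (simp add: clinear_add[OF clinear_rmult])
qed

lemma multiplier_tensor_pure: "multiplier_tensor (m \<otimes>\<^sub>t n) = multiplier_times m n"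
  unfolding multiplier_tensor_def by (rule tensor_lift_pure_tensor[OF cbilinear_multiplier_times])

lemma clinear_multiplier_tensor: "clinear multiplier_tensor"
  unfolding multiplier_tensor_def by (rule clinear_tensor_lift[OF cbilinear_multiplier_times clinear_ident])

lemmas clinear_multiplier_tensor_fun [clin] = clinear_compose[OF clinear_multiplier_tensor]

lemma multiplier_tensor_mult: "multiplier_tensor (s * t) = multiplier_tensor s * multiplier_tensor t"
proof (rule tensor_eqI[of "\<lambda>s. multiplier_tensor (s * t)"])
  fix m n
  show "multiplier_tensor ((m \<otimes>\<^sub>t n) * t) = multiplier_tensor (m \<otimes>\<^sub>t n) * multiplier_tensor t"
    by (rule tensor_eqI[of "\<lambda>t. multiplier_tensor ((m \<otimes>\<^sub>t n) * t)"]) (intro clin |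
      simp add: tensor_mult_pure multiplier_tensor_pure multiplier_times_mult)+
qed (intro clin)+

lemma multiplier_tensor_one: "multiplier_tensor 1 = 1"
  by (simp add: one_tensor_def multiplier_tensor_pure multiplier_times_one)

lemma star_multiplier_tensor:
  fixes t :: "('a::star_algebra multiplier, 'b::star_algebra multiplier) tensor"
  shows "star (multiplier_tensor t) = multiplier_tensor (star t)"
  by (induction t) (simp_all add: multiplier_tensor_pure star_multiplier_times star_tensor_pure
    star_add clinear_add[OF clinear_multiplier_tensor])

text \<open>Since (m \<otimes> n)(a \<otimes> b) = m a \<otimes> n b, and evaluations at elements
  separate multipliers, \<open>tensor_map_separates\<close> applies to the evaluations.\<close>

lemma inj_multiplier_tensor:
  assumes "nondeg TYPE('a::complex_algebra)" "nondeg TYPE('b::complex_algebra)"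
  shows "inj (multiplier_tensor :: ('a multiplier, 'b multiplier) tensor \<Rightarrow> _)"
proof (rule injI)
  fix s t :: "('a multiplier, 'b multiplier) tensor"
  assume eq: "multiplier_tensor s = multiplier_tensor t"
  have "tensor_map (\<lambda>m. lmult m a) (\<lambda>n. lmult n b) u = lmult (multiplier_tensor u) (a \<otimes>\<^sub>t b)"
    for u :: "('a multiplier, 'b multiplier) tensor" and a b
    by (rule tensor_eqI)
       (intro clin | simp add: tensor_map_pure multiplier_tensor_pure lmult_multiplier_times clinear_lmult clin)+
  then have "tensor_map (\<lambda>m. lmult m a) (\<lambda>n. lmult n b) (s - t) = 0" for a b
    by (simp add: clinear_diff[OF clinear_multiplier_tensor] eq)
  moreover have "m = 0" if "\<And>a. lmult m a = 0" for m :: "'a multiplier"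
    by (rule multiplier_eqI_lmult[OF assms(1)]) (simp add: that)
  moreover have "m = 0" if "\<And>a. lmult m a = 0" for m :: "'b multiplier"
    by (rule multiplier_eqI_lmult[OF assms(2)]) (simp add: that)
  ultimately have "s - t = 0"
    using tensor_map_separates[of "\<lambda>a m. lmult m a" "\<lambda>b n. lmult n b" "s - t"]
    by (simp add: clin)
  then show "s = t" by simp
qed


subsection \<open>Extension of nondegenerate maps\<close>

text \<open>The construction principle behind all extensions: n is a fraction with denominators
  P(d), and \<open>PQ\<close> says that the two ways of computing P(d) n P(d') agree. No
  homomorphism is mentioned, so antihomomorphisms are covered by exchanging the roles of Q and
  R.\<close>

lemma multiplier_quotient_exists:
  fixes P Q R :: "'c \<Rightarrow> 'b::complex_algebra multiplier"
  assumes nd: "nondeg TYPE('b)"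
    and L: "complex_vector.span {lmult (P d) b | d b. True} = UNIV"
    and R: "complex_vector.span {rmult (P d) b | d b. True} = UNIV"
    and PQ: "\<And>d d'. P d * R d' = Q d * P d'"
  shows "\<exists>n. \<forall>d. P d * n = Q d \<and> n * P d = R d"
proof -
  have PQl: "lmult (P d) (lmult (R d') x) = lmult (Q d) (lmult (P d') x)" for d d' x
    using arg_cong[OF PQ, of "\<lambda>m. lmult m x" d d'] by simp
  have PQr: "rmult (R d') (rmult (P d) x) = rmult (P d') (rmult (Q d) x)" for d d' x
    using arg_cong[OF PQ, of "\<lambda>m. rmult m x" d d'] by simp
  have uniql: "y = y'" if "\<And>d. lmult (P d) y = lmult (P d) y'" for y y'
  proof (rule nondeg_right[OF nd])
    show "c * y = c * y'" for c
    proof (rule clinear_eq_on_span[of "\<lambda>c. c * y" "\<lambda>c. c * y'" "{rmult (P d) b | d b. True}"])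
      show "clinear (\<lambda>c. c * y)" "clinear (\<lambda>c. c * y')" by (intro clin)+
    qed (use that R in \<open>auto simp: rmult_lmult\<close>)
  qed
  have uniqr: "y = y'" if "\<And>d. rmult (P d) y = rmult (P d) y'" for y y'
  proof (rule nondeg_left[OF nd])
    show "y * c = y' * c" for c
    proof (rule clinear_eq_on_span[of "\<lambda>c. y * c" "\<lambda>c. y' * c" "{lmult (P d) b | d b. True}"])
      show "clinear (\<lambda>c. y * c)" "clinear (\<lambda>c. y' * c)" by (intro clin)+
    qed (use that L in \<open>auto simp: rmult_lmult[symmetric]\<close>)
  qed
  \<comment> \<open>The value n b has to be the unique solution y. For b = P(d') b' it is R(d') b',
    and solutions add up along the span.\<close>
  have "\<exists>y. \<forall>d. lmult (P d) y = lmult (Q d) b" for b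
  proof -
    have "b \<in> complex_vector.span {lmult (P d) b | d b. True}" using L by simp
    then show ?thesis
    proof (induction rule: complex_vector.span_induct_alt)
      case base
      show ?case by (rule exI[of _ 0]) (simp add: clinear_0[OF clinear_lmult])
    next
      case (step c x z)
      then obtain y d' b' where y: "\<forall>d. lmult (P d) y = lmult (Q d) z" and x: "x = lmult (P d') b'" by blast
      show ?case
        by (rule exI[of _ "c *\<^sub>C lmult (R d') b' + y"])
           (simp add: clinear_add[OF clinear_lmult] clinear_scaleC[OF clinear_lmult] x y PQl)
    qed
  qed
  then obtain l where l: "\<And>d b. lmult (P d) (l b) = lmult (Q d) b" by metis
  have "\<exists>y. \<forall>d. rmult (P d) y = rmult (R d) b" for b
  proof -
    have "b \<in> complex_vector.span {rmult (P d) b | d b. True}" using R by simp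
    then show ?thesis
    proof (induction rule: complex_vector.span_induct_alt)
      case base
      show ?case by (rule exI[of _ 0]) (simp add: clinear_0[OF clinear_rmult])
    next
      case (step c x z)
      then obtain y d' b' where y: "\<forall>d. rmult (P d) y = rmult (R d) z" and x: "x = rmult (P d') b'" by blast
      show ?case
        by (rule exI[of _ "c *\<^sub>C rmult (Q d') b' + y"])
           (simp add: clinear_add[OF clinear_rmult] clinear_scaleC[OF clinear_rmult] x y PQr)
    qed
  qed
  then obtain r where r: "\<And>d b. rmult (P d) (r b) = rmult (R d) b" by metis
  have lP: "l (lmult (P d) b) = lmult (R d) b" for d b
    by (rule uniql) (simp add: l PQl)
  have "clinear l"
    by (rule clinearI; rule uniql)
       (simp_all add: l clinear_add[OF clinear_lmult] clinear_scaleC[OF clinear_lmult])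
  moreover have "clinear r"
    by (rule clinearI; rule uniqr)
       (simp_all add: r clinear_add[OF clinear_rmult] clinear_scaleC[OF clinear_rmult])
  moreover have "r b * a = b * l a" for a b
  proof (rule clinear_eq_on_span[of "\<lambda>a. r b * a" "\<lambda>a. b * l a" "{lmult (P d) b | d b. True}"])
    show "clinear (\<lambda>a. r b * a)" "clinear (\<lambda>a. b * l a)" by (intro clin \<open>clinear l\<close>)+
  qed (use L in \<open>auto simp: lP rmult_lmult[symmetric] r\<close>)
  ultimately obtain n where n: "lmult n = l" "rmult n = r"
    using multiplier_exists[of l r] by blast
  have "P d * n = Q d" "n * P d = R d" for d
    by (rule multiplier_eqI_lmult[OF nd]; simp add: n l lP)+
  then show ?thesis by blast
qed

text \<open>Formulated with spans only, so that one notion serves the homomorphism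
  \<open>\<delta>\<close> and the antihomomorphism \<open>\<kappa>\<^sub>0\<close>.\<close>

definition nondegenerate_map :: "('a \<Rightarrow> 'b::complex_algebra multiplier) \<Rightarrow> bool"
  where "nondegenerate_map \<Phi> \<longleftrightarrow>
    complex_vector.span {lmult (\<Phi> a) b | a b. True} = UNIV \<and>
    complex_vector.span {rmult (\<Phi> a) b | a b. True} = UNIV"

lemma nondegenerate_mapI:
  assumes "\<And>x. x \<in> complex_vector.span {lmult (\<Phi> a) b | a b. True}"
    "\<And>x. x \<in> complex_vector.span {rmult (\<Phi> a) b | a b. True}"
  shows "nondegenerate_map \<Phi>"
  unfolding nondegenerate_map_def using assms by blast

lemma nondegenerate_map_cancel:
  assumes "nondeg TYPE('b::complex_algebra)" "nondegenerate_map (\<Phi> :: 'a \<Rightarrow> 'b multiplier)"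
    "\<And>a. m * \<Phi> a = n * \<Phi> a"
  shows "m = n"
proof (rule multiplier_eqI_lmult[OF assms(1)])
  have "lmult m (lmult (\<Phi> a) b) = lmult n (lmult (\<Phi> a) b)" for a b
    using arg_cong[OF assms(3), of "\<lambda>k. lmult k b" a] by simp
  then have "lmult m x = lmult n x" if "x \<in> {lmult (\<Phi> a) b | a b. True}" for x
    using that by blast
  then show "lmult m b = lmult n b" for b
    by (rule clinear_eq_on_span[OF clinear_lmult clinear_lmult])
       (assumption, use assms(2) in \<open>auto simp: nondegenerate_map_def\<close>)
qed

lemma nondegenerate_map_cancel_left:
  assumes "nondeg TYPE('b::complex_algebra)" "nondegenerate_map (\<Phi> :: 'a \<Rightarrow> 'b multiplier)"
    "\<And>a. \<Phi> a * m = \<Phi> a * n"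
  shows "m = n"
proof (rule multiplier_eqI_rmult[OF assms(1)])
  have "rmult m (rmult (\<Phi> a) b) = rmult n (rmult (\<Phi> a) b)" for a b
    using arg_cong[OF assms(3), of "\<lambda>k. rmult k b" a] by simp
  then have "rmult m x = rmult n x" if "x \<in> {rmult (\<Phi> a) b | a b. True}" for x
    using that by blast
  then show "rmult m b = rmult n b" for b
    by (rule clinear_eq_on_span[OF clinear_rmult clinear_rmult])
       (assumption, use assms(2) in \<open>auto simp: nondegenerate_map_def\<close>)
qed

text \<open>Existence takes Q(d) = \<Phi>(d m) and R(d) = \<Phi>(m d) as numerators. Any extension
  satisfies \<Psi>(m) \<Phi>(a) = \<Phi>(m a), where \<Phi>(a) can be cancelled. Uniqueness is
  exported because compatibility with the involution rests on it.\<close>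

lemma hom_extension_multiplier:
  fixes \<Phi> :: "'a::complex_algebra \<Rightarrow> 'b::complex_algebra multiplier"
  assumes ndA: "nondeg TYPE('a)" and ndB: "nondeg TYPE('b)"
    and \<Phi>: "algebra_hom \<Phi>" "nondegenerate_map \<Phi>"
  shows "algebra_hom (hom_extension \<Phi>)" "hom_extension \<Phi> 1 = 1" "hom_extension \<Phi> (to_multiplier a) = \<Phi> a"
    and "\<And>\<Psi>. algebra_hom \<Psi> \<Longrightarrow> \<Psi> 1 = 1 \<Longrightarrow> (\<And>a. \<Psi> (to_multiplier a) = \<Phi> a) \<Longrightarrow> \<Psi> = hom_extension \<Phi>"
proof -
  note cancel = nondegenerate_map_cancel[OF ndB \<Phi>(2)]
  have lin: "clinear \<Phi>" and mult: "\<And>a b. \<Phi> (a * b) = \<Phi> a * \<Phi> b" using \<Phi>(1) by (auto simp: algebra_hom_def)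
  have "\<exists>n. \<forall>d. \<Phi> d * n = \<Phi> (rmult m d) \<and> n * \<Phi> d = \<Phi> (lmult m d)" for m
    by (rule multiplier_quotient_exists)
       (use \<Phi>(2) ndB in \<open>auto simp: nondegenerate_map_def mult[symmetric] rmult_lmult\<close>)
  then obtain \<Psi> where \<Psi>: "\<And>m d. \<Psi> m * \<Phi> d = \<Phi> (lmult m d)" by metis
  have ext: "algebra_hom \<Psi>" "\<Psi> 1 = 1" "\<Psi> (to_multiplier a) = \<Phi> a" for a
    unfolding algebra_hom_def
    by ((intro conjI allI clinearI)?; rule cancel;
        simp add: \<Psi> distrib_right scaleC_mult_left clinear_add[OF lin] clinear_scaleC[OF lin] mult mult.assoc)+
  have uniq: "\<Psi>' = \<Psi>" if "algebra_hom \<Psi>'" "\<Psi>' 1 = 1" "\<And>a. \<Psi>' (to_multiplier a) = \<Phi> a" for \<Psi>'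
  proof (rule HOL.ext, rule cancel)
    show "\<Psi>' m * \<Phi> a = \<Psi> m * \<Phi> a" for m a
    proof -
      have "\<Psi>' m * \<Psi>' (to_multiplier a) = \<Psi>' (m * to_multiplier a)"
        using that(1) by (simp add: algebra_hom_def)
      then show ?thesis by (simp add: mult_to_multiplier(1)[OF ndA] that(3) \<Psi>)
    qed
  qed
  have "hom_extension \<Phi> = \<Psi>"
    unfolding hom_extension_def by (rule the_equality) (use ext uniq in blast)+
  with ext uniq show "algebra_hom (hom_extension \<Phi>)" "hom_extension \<Phi> 1 = 1"
      "hom_extension \<Phi> (to_multiplier a) = \<Phi> a"
      "\<And>\<Psi>. algebra_hom \<Psi> \<Longrightarrow> \<Psi> 1 = 1 \<Longrightarrow> (\<And>a. \<Psi> (to_multiplier a) = \<Phi> a) \<Longrightarrow> \<Psi> = hom_extension \<Phi>"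
    by blast+
qed

lemma antihom_extension_multiplier:
  fixes \<Phi> :: "'a::complex_algebra \<Rightarrow> 'b::complex_algebra multiplier"
  assumes ndA: "nondeg TYPE('a)" and ndB: "nondeg TYPE('b)"
    and \<Phi>: "algebra_antihom \<Phi>" "nondegenerate_map \<Phi>"
  shows "algebra_antihom (antihom_extension \<Phi>)" "antihom_extension \<Phi> 1 = 1"
    "antihom_extension \<Phi> (to_multiplier a) = \<Phi> a"
proof -
  note cancel = nondegenerate_map_cancel[OF ndB \<Phi>(2)]
  have lin: "clinear \<Phi>" and mult: "\<And>a b. \<Phi> (a * b) = \<Phi> b * \<Phi> a" using \<Phi>(1) by (auto simp: algebra_antihom_def)
  have "\<exists>n. \<forall>d. \<Phi> d * n = \<Phi> (lmult m d) \<and> n * \<Phi> d = \<Phi> (rmult m d)" for m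
    by (rule multiplier_quotient_exists)
       (use \<Phi>(2) ndB in \<open>auto simp: nondegenerate_map_def mult[symmetric] rmult_lmult\<close>)
  then obtain \<Psi> where \<Psi>: "\<And>m d. \<Psi> m * \<Phi> d = \<Phi> (rmult m d)" by metis
  have ext: "algebra_antihom \<Psi>" "\<Psi> 1 = 1" "\<Psi> (to_multiplier a) = \<Phi> a" for a
    unfolding algebra_antihom_def
    by ((intro conjI allI clinearI)?; rule cancel;
        simp add: \<Psi> distrib_right scaleC_mult_left clinear_add[OF lin] clinear_scaleC[OF lin] mult mult.assoc)+
  have uniq: "\<Psi>' = \<Psi>" if "algebra_antihom \<Psi>'" "\<Psi>' 1 = 1" "\<And>a. \<Psi>' (to_multiplier a) = \<Phi> a" for \<Psi>'
  proof (rule HOL.ext, rule cancel)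
    show "\<Psi>' m * \<Phi> a = \<Psi> m * \<Phi> a" for m a
    proof -
      have "\<Psi>' m * \<Psi>' (to_multiplier a) = \<Psi>' (to_multiplier a * m)"
        using that(1) by (simp add: algebra_antihom_def)
      then show ?thesis by (simp add: mult_to_multiplier(2)[OF ndA] that(3) \<Psi>)
    qed
  qed
  have "antihom_extension \<Phi> = \<Psi>"
    unfolding antihom_extension_def by (rule the_equality) (use ext uniq in blast)+
  with ext show "algebra_antihom (antihom_extension \<Phi>)" "antihom_extension \<Phi> 1 = 1"
      "antihom_extension \<Phi> (to_multiplier a) = \<Phi> a"
    by blast+
qed

text \<open>The type \<open>complex\<close> is not a multiplier type, so this case is separate. With
  \<epsilon>(e) = 1 the only candidate is m \<mapsto> \<epsilon>(m e).\<close>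

lemma hom_extension_functional:
  fixes \<epsilon> :: "'a::complex_algebra \<Rightarrow> complex"
  assumes nd: "nondeg TYPE('a)" and \<epsilon>: "algebra_hom \<epsilon>" "\<epsilon> e = 1"
  shows "algebra_hom (hom_extension \<epsilon>)" "hom_extension \<epsilon> 1 = 1" "hom_extension \<epsilon> (to_multiplier a) = \<epsilon> a"
proof -
  have lin: "clinear \<epsilon>" and mult: "\<And>a b. \<epsilon> (a * b) = \<epsilon> a * \<epsilon> b" using \<epsilon>(1) by (auto simp: algebra_hom_def)
  define \<Psi> where "\<Psi> m = \<epsilon> (lmult m e)" for m
  have eq: "\<epsilon> (lmult m a) = \<Psi> m * \<epsilon> a" for m a
  proof -
    have "\<epsilon> (lmult m a) = \<epsilon> (e * lmult m a)" by (simp add: mult \<epsilon>(2))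
    also have "\<dots> = \<epsilon> (rmult m e) * \<epsilon> a" by (simp add: rmult_lmult[symmetric] mult)
    also have "\<epsilon> (rmult m e) = \<epsilon> (rmult m e * e)" by (simp add: mult \<epsilon>(2))
    also have "\<dots> = \<Psi> m" by (simp add: rmult_lmult mult \<epsilon>(2) \<Psi>_def)
    finally show ?thesis .
  qed
  have ext: "algebra_hom \<Psi>" "\<Psi> 1 = 1" "\<Psi> (to_multiplier a) = \<epsilon> a" for a
  proof -
    have "clinear \<Psi>" unfolding \<Psi>_def by (intro clin clinear_compose[OF lin])
    moreover have "\<Psi> (m * n) = \<Psi> m * \<Psi> n" for m n
      by (simp add: \<Psi>_def[of "m * n"] eq \<epsilon>(2))
    ultimately show "algebra_hom \<Psi>" by (simp add: algebra_hom_def)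
    show "\<Psi> 1 = 1" "\<Psi> (to_multiplier a) = \<epsilon> a" by (simp_all add: \<Psi>_def mult \<epsilon>(2))
  qed
  have uniq: "\<Psi>' = \<Psi>" if "algebra_hom \<Psi>'" "\<Psi>' 1 = 1" "\<And>a. \<Psi>' (to_multiplier a) = \<epsilon> a" for \<Psi>'
  proof (rule HOL.ext)
    fix m
    have "\<Psi>' m = \<Psi>' m * \<Psi>' (to_multiplier e)" by (simp add: that(3) \<epsilon>(2))
    also have "\<dots> = \<Psi>' (m * to_multiplier e)" using that(1) by (simp add: algebra_hom_def)
    also have "\<dots> = \<Psi> m" by (simp add: mult_to_multiplier(1)[OF nd] that(3) \<Psi>_def)
    finally show "\<Psi>' m = \<Psi> m" .
  qed
  have "hom_extension \<epsilon> = \<Psi>"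
    unfolding hom_extension_def by (rule the_equality) (use ext uniq in blast)+
  with ext show "algebra_hom (hom_extension \<epsilon>)" "hom_extension \<epsilon> 1 = 1"
      "hom_extension \<epsilon> (to_multiplier a) = \<epsilon> a"
    by blast+
qed


section \<open>Counit and coinverse of a multiplier Hopf algebra\<close>

abbreviation mult_map :: "('a::complex_algebra, 'a) tensor \<Rightarrow> 'a"
  where "mult_map \<equiv> tensor_lift (*)"

lemma cbilinear_times [clin]: "cbilinear ((*) :: 'a::complex_algebra \<Rightarrow> _)"
  by (intro clin)

lemma mult_map_pure: "mult_map (a \<otimes>\<^sub>t b) = a * b"
  by (rule tensor_lift_pure_tensor[OF cbilinear_times])

text \<open>\<open>nonzero\<close> excludes the zero algebra, where the counit vanishes, and
  supplies an element against which scalars are read off.\<close>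

locale nonzero_multiplier_hopf_algebra =
  fixes \<delta> :: "'a::complex_algebra \<Rightarrow> ('a, 'a) tensor multiplier"
  assumes multiplier_hopf_algebra: "multiplier_hopf_algebra \<delta>"
    and nonzero: "\<exists>a::'a. a \<noteq> 0"
begin

abbreviation T1 :: "('a, 'a) tensor \<Rightarrow> ('a, 'a) tensor" where "T1 \<equiv> hopf_T1' \<delta>"
abbreviation T2 :: "('a, 'a) tensor \<Rightarrow> ('a, 'a) tensor" where "T2 \<equiv> hopf_T2' \<delta>"
abbreviation T1i :: "('a, 'a) tensor \<Rightarrow> ('a, 'a) tensor" where "T1i \<equiv> inv_into UNIV T1"
abbreviation T2i :: "('a, 'a) tensor \<Rightarrow> ('a, 'a) tensor" where "T2i \<equiv> inv_into UNIV T2"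

lemma nondegenerate: "nondeg TYPE('a)"
  using multiplier_hopf_algebra by (simp add: multiplier_hopf_algebra_def)

lemma nondegenerate_tensor: "nondeg TYPE(('a, 'a) tensor)"
  by (rule nondeg_tensor[OF nondegenerate nondegenerate])

lemma algebra_hom_comult: "algebra_hom \<delta>"
  using multiplier_hopf_algebra by (simp add: multiplier_hopf_algebra_def)

lemma comult_mult: "\<delta> (a * b) = \<delta> a * \<delta> b"
  using algebra_hom_comult by (simp add: algebra_hom_def)

lemma clinear_comult: "clinear \<delta>"
  using algebra_hom_comult by (simp add: algebra_hom_def)

lemmas clinear_comult_fun [clin] = clinear_compose[OF clinear_comult]

lemma to_multiplier2_eqD: "to_multiplier s = to_multiplier t \<Longrightarrow> s = t" for s t :: "('a, 'a) tensor"
  using inj_to_multiplier[OF nondegenerate_tensor] by (rule injD)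

lemma to_multiplier_T1: "to_multiplier (T1 t) = hopf_T1 \<delta> t"
  using multiplier_hopf_algebra bij_betw_apply[of "hopf_T1 \<delta>" UNIV "range to_multiplier" t]
  by (simp add: multiplier_hopf_algebra_def hopf_T1'_def f_inv_into_f)

lemma to_multiplier_T2: "to_multiplier (T2 t) = hopf_T2 \<delta> t"
  using multiplier_hopf_algebra bij_betw_apply[of "hopf_T2 \<delta>" UNIV "range to_multiplier" t]
  by (simp add: multiplier_hopf_algebra_def hopf_T2'_def f_inv_into_f)

lemma bij_T1: "bij T1"
proof -
  have "bij_betw (inv_into UNIV to_multiplier \<circ> hopf_T1 \<delta>) UNIV (UNIV :: ('a, 'a) tensor set)"
    using multiplier_hopf_algebra inj_to_multiplier[OF nondegenerate_tensor]
    by (intro bij_betw_trans bij_betw_inv_into) (auto simp: multiplier_hopf_algebra_def bij_betw_def)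
  moreover have "T1 = inv_into UNIV to_multiplier \<circ> hopf_T1 \<delta>" by (simp add: fun_eq_iff hopf_T1'_def)
  ultimately show ?thesis by simp
qed

lemma bij_T2: "bij T2"
proof -
  have "bij_betw (inv_into UNIV to_multiplier \<circ> hopf_T2 \<delta>) UNIV (UNIV :: ('a, 'a) tensor set)"
    using multiplier_hopf_algebra inj_to_multiplier[OF nondegenerate_tensor]
    by (intro bij_betw_trans bij_betw_inv_into) (auto simp: multiplier_hopf_algebra_def bij_betw_def)
  moreover have "T2 = inv_into UNIV to_multiplier \<circ> hopf_T2 \<delta>" by (simp add: fun_eq_iff hopf_T2'_def)
  ultimately show ?thesis by simp
qed

lemma T1_T1i [simp]: "T1 (T1i t) = t" and T1i_T1 [simp]: "T1i (T1 t) = t"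
  and T2_T2i [simp]: "T2 (T2i t) = t" and T2i_T2 [simp]: "T2i (T2 t) = t"
  using bij_T1 bij_T2 by (simp_all add: surj_f_inv_f inv_f_f bij_is_inj bij_is_surj)

lemma cbilinear_hopf:
  "cbilinear (\<lambda>a b. \<delta> a * multiplier_times 1 (to_multiplier b))"
  "cbilinear (\<lambda>a b. multiplier_times (to_multiplier a) 1 * \<delta> b)"
  by (intro clin)+

lemma T1_pure: "to_multiplier (T1 (a \<otimes>\<^sub>t b)) = \<delta> a * multiplier_times 1 (to_multiplier b)"
  unfolding to_multiplier_T1 hopf_T1_def by (rule tensor_lift_pure_tensor[OF cbilinear_hopf(1)])

lemma T2_pure: "to_multiplier (T2 (a \<otimes>\<^sub>t b)) = multiplier_times (to_multiplier a) 1 * \<delta> b"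
  unfolding to_multiplier_T2 hopf_T2_def by (rule tensor_lift_pure_tensor[OF cbilinear_hopf(2)])

lemma clinear_T1: "clinear T1"
  by (rule clinearI; rule to_multiplier2_eqD;
      simp add: to_multiplier_T1 clinear_add[OF clinear_to_multiplier] clinear_scaleC[OF clinear_to_multiplier])
     (simp_all add: hopf_T1_def clinear_add[OF clinear_tensor_lift[OF cbilinear_hopf(1) clinear_ident]]
        clinear_scaleC[OF clinear_tensor_lift[OF cbilinear_hopf(1) clinear_ident]])

lemma clinear_T2: "clinear T2"
  by (rule clinearI; rule to_multiplier2_eqD;
      simp add: to_multiplier_T2 clinear_add[OF clinear_to_multiplier] clinear_scaleC[OF clinear_to_multiplier])
     (simp_all add: hopf_T2_def clinear_add[OF clinear_tensor_lift[OF cbilinear_hopf(2) clinear_ident]]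
        clinear_scaleC[OF clinear_tensor_lift[OF cbilinear_hopf(2) clinear_ident]])

lemma clinear_T1i: "clinear T1i"
proof (rule clinearI)
  show "T1i (x + y) = T1i x + T1i y" for x y
    by (metis T1_T1i T1i_T1 clinear_add[OF clinear_T1])
  show "T1i (c *\<^sub>C x) = c *\<^sub>C T1i x" for c x
    by (metis T1_T1i T1i_T1 clinear_scaleC[OF clinear_T1])
qed

lemma clinear_T2i: "clinear T2i"
proof (rule clinearI)
  show "T2i (x + y) = T2i x + T2i y" for x y
    by (metis T2_T2i T2i_T2 clinear_add[OF clinear_T2])
  show "T2i (c *\<^sub>C x) = c *\<^sub>C T2i x" for c x
    by (metis T2_T2i T2i_T2 clinear_scaleC[OF clinear_T2])
qed

lemmas clinear_T [clin] = clinear_compose[OF clinear_T1] clinear_compose[OF clinear_T2]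
  clinear_compose[OF clinear_T1i] clinear_compose[OF clinear_T2i]

lemma to_multiplier_tensor_map:
  fixes s :: "('a, 'a) tensor"
  shows "to_multiplier (tensor_map (lmult m) (lmult n) s) = multiplier_times m n * to_multiplier s"
    and "to_multiplier (tensor_map (rmult m) (rmult n) s) = to_multiplier s * multiplier_times m n"
    and "to_multiplier (tensor_map ((*) a) (\<lambda>y. y) s) = multiplier_times (to_multiplier a) 1 * to_multiplier s"
    and "to_multiplier (tensor_map (\<lambda>x. x) ((*) b) s) = multiplier_times 1 (to_multiplier b) * to_multiplier s"
    and "to_multiplier (tensor_map (\<lambda>x. x * a) (\<lambda>y. y) s) = to_multiplier s * multiplier_times (to_multiplier a) 1"
    and "to_multiplier (tensor_map (\<lambda>x. x) (\<lambda>y. y * b) s) = to_multiplier s * multiplier_times 1 (to_multiplier b)"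
  by (simp_all add: mult_to_multiplier[OF nondegenerate_tensor] lmult_multiplier_times rmult_multiplier_times lmult_fun rmult_fun)

text \<open>Both sides are (a \<otimes> 1) \<delta>(p) (1 \<otimes> q).\<close>

lemma T2_times_right:
  "tensor_map (\<lambda>x. x) (\<lambda>y. y * q) (T2 (a \<otimes>\<^sub>t p)) = tensor_map ((*) a) (\<lambda>y. y) (T1 (p \<otimes>\<^sub>t q))"
  by (rule to_multiplier2_eqD) (simp add: to_multiplier_tensor_map T1_pure T2_pure mult.assoc)

lemma T2_comult_right: "T2 (tensor_map (\<lambda>x. x) (\<lambda>y. y * c) s) = rmult (\<delta> c) (T2 s)"
proof (rule tensor_eqI[where t = s])
  show "T2 (tensor_map (\<lambda>x. x) (\<lambda>y. y * c) (a \<otimes>\<^sub>t b)) = rmult (\<delta> c) (T2 (a \<otimes>\<^sub>t b))" for a b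
    by (rule to_multiplier2_eqD)
       (simp add: tensor_map_pure clin T2_pure mult_to_multiplier(2)[OF nondegenerate_tensor, symmetric] comult_mult mult.assoc)
qed (intro clin)+

text \<open>Both sides are (a \<otimes> b) \<delta>(c), with a \<otimes> b split as (1 \<otimes>
  b)(a \<otimes> 1).\<close>

lemma rmult_comult_pure: "rmult (\<delta> c) (a \<otimes>\<^sub>t b) = tensor_map (\<lambda>x. x) ((*) b) (T2 (a \<otimes>\<^sub>t c))"
  by (rule to_multiplier2_eqD)
     (simp add: to_multiplier_tensor_map T2_pure mult_to_multiplier(2)[OF nondegenerate_tensor, symmetric]
        multiplier_times_to_multiplier[symmetric] multiplier_times_mult mult.assoc[symmetric])

section \<open>The commutation axiom and the counit\<close>

abbreviation T2_id :: "(('a, 'a) tensor, 'a) tensor \<Rightarrow> (('a, 'a) tensor, 'a) tensor"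
  where "T2_id \<equiv> tensor_map T2 (\<lambda>x. x)"

abbreviation id_T1 :: "(('a, 'a) tensor, 'a) tensor \<Rightarrow> (('a, 'a) tensor, 'a) tensor"
  where "id_T1 \<equiv> \<lambda>t. tensor_assoc' (tensor_map (\<lambda>x. x) T1 (tensor_assoc t))"

lemma T2_id_T1_commute: "T2_id (id_T1 t) = id_T1 (T2_id t)"
  using multiplier_hopf_algebra
  by (simp add: multiplier_hopf_algebra_def Let_def fun_eq_iff)

lemma id_T1_pure: "id_T1 (tensor_assoc' (a \<otimes>\<^sub>t u)) = tensor_assoc' (a \<otimes>\<^sub>t T1 u)"
  by (simp add: tensor_assoc_assoc' tensor_map_pure clin clinear_T1)

text \<open>Commuting \<open>T\<^sub>2 \<otimes> id\<close> with the inverse of \<open>id \<otimes> T\<^sub>1\<close> and applying \<open>id \<otimes> h\<close> yields the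
  identities that characterise the counit (\<open>h\<close> the product) and the coinverse (\<open>h = \<epsilon> \<otimes> id\<close>).\<close>

lemma T2_slice_T1i:
  assumes h: "clinear h"
  shows "tensor_map (\<lambda>x. x) (\<lambda>y. h (T1i (y \<otimes>\<^sub>t c))) (T2 (a \<otimes>\<^sub>t b)) =
    tensor_map (\<lambda>x. x) h (tensor_assoc (T2_id (tensor_assoc' (a \<otimes>\<^sub>t T1i (b \<otimes>\<^sub>t c)))))"
    (is "?lhs = tensor_map _ h (tensor_assoc ?z)")
proof -
  \<comment> \<open>Writing b \<otimes> c as T1 of its preimage lets the axiom move id \<otimes> T1
    outside, where its inverse cancels it.\<close>
  have "T2 (a \<otimes>\<^sub>t b) \<otimes>\<^sub>t c = T2_id (tensor_assoc' (a \<otimes>\<^sub>t T1 (T1i (b \<otimes>\<^sub>t c))))"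
    by (simp add: tensor_assoc'_pure tensor_map_pure clin clinear_T2)
  also have "\<dots> = id_T1 ?z"
    by (simp only: id_T1_pure[symmetric] T2_id_T1_commute)
  finally have "tensor_map (\<lambda>x. x) T1i (tensor_assoc (T2 (a \<otimes>\<^sub>t b) \<otimes>\<^sub>t c)) = tensor_assoc ?z"
    by (simp add: tensor_assoc_assoc' tensor_map_tensor_map clin clinear_T1 clinear_T1i tensor_map_ident)
  moreover have "tensor_map (\<lambda>x. x) (\<lambda>y. h (T1i (y \<otimes>\<^sub>t c))) s =
      tensor_map (\<lambda>x. x) h (tensor_map (\<lambda>x. x) T1i (tensor_assoc (s \<otimes>\<^sub>t c)))" for s :: "('a, 'a) tensor"
    by (rule tensor_eqI)
       (intro clin clinear_compose[OF h] h clinear_T1i |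
        simp add: tensor_map_pure tensor_assoc_pure clin h clinear_T1i clinear_compose[OF h])+
  ultimately show ?thesis by simp
qed

text \<open>This is (id \<otimes> \<epsilon>)(T2(a \<otimes> b)) = a b before \<epsilon> is known: y
  \<mapsto> \<mu>(T1i(y \<otimes> c)) stands in for y \<mapsto> \<epsilon>(y) c.\<close>

lemma counit_key:
  "tensor_map (\<lambda>x. x) (\<lambda>y. mult_map (T1i (y \<otimes>\<^sub>t c))) (T2 (a \<otimes>\<^sub>t b)) = (a * b) \<otimes>\<^sub>t c"
proof -
  \<comment> \<open>For u = p \<otimes> q both sides are (a \<otimes> 1) \<delta>(p) (1 \<otimes>
    q); at u = T1i(b \<otimes> c) the right side is (a \<otimes> 1)(b \<otimes> c).\<close>
  have "tensor_map (\<lambda>x. x) mult_map (tensor_assoc (T2_id (tensor_assoc' (a \<otimes>\<^sub>t u)))) =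
      tensor_map ((*) a) (\<lambda>y. y) (T1 u)" for u
  proof (rule tensor_eqI[where t = u])
    fix p q
    have "tensor_map (\<lambda>x. x) mult_map (tensor_assoc (s \<otimes>\<^sub>t q)) = tensor_map (\<lambda>x. x) (\<lambda>y. y * q) s"
      for s :: "('a, 'a) tensor"
      by (rule tensor_eqI)
         (intro clin | simp add: tensor_map_pure tensor_assoc_pure clin mult_map_pure)+
    then show "tensor_map (\<lambda>x. x) mult_map (tensor_assoc (T2_id (tensor_assoc' (a \<otimes>\<^sub>t (p \<otimes>\<^sub>t q))))) =
      tensor_map ((*) a) (\<lambda>y. y) (T1 (p \<otimes>\<^sub>t q))"
      by (simp add: tensor_assoc'_pure tensor_map_pure clin clinear_T2 T2_times_right)
  qed (intro clin clinear_T2)+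
  then show ?thesis
    by (simp add: T2_slice_T1i clin tensor_map_pure)
qed

lemma counit_exists:
  "\<exists>\<epsilon>. clinear \<epsilon> \<and> (\<forall>s. slice_right \<epsilon> (T2 s) = mult_map s) \<and> (\<forall>s. slice_left \<epsilon> (T1 s) = mult_map s)"
proof -
  obtain a0 :: 'a where a0: "a0 \<noteq> 0" using nonzero by blast
  obtain f :: "'a \<Rightarrow> complex" where f: "clinear f" "f a0 = 1" using exists_functional[OF a0] by blast
  \<comment> \<open>Forced by \<open>counit_key\<close>: if T2(s) = a0 \<otimes> b, it reads a0
    \<otimes> \<mu>(T1i(b \<otimes> c)) = \<mu>(s) \<otimes> c, and applying f to the first leg
    gives \<mu>(T1i(b \<otimes> c)) = f(\<mu>(s)) c.\<close>
  define \<epsilon> where "\<epsilon> b = f (mult_map (T2i (a0 \<otimes>\<^sub>t b)))" for b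
  have lin: "clinear \<epsilon>" unfolding \<epsilon>_def by (intro clin clinear_compose[OF f(1)])
  have gen: "tensor_map (\<lambda>x. x) (\<lambda>y. mult_map (T1i (y \<otimes>\<^sub>t c))) (T2 s) = mult_map s \<otimes>\<^sub>t c" for s c
    by (rule tensor_eqI) (intro clin | simp add: counit_key mult_map_pure)+
  have E: "mult_map (T1i (b \<otimes>\<^sub>t c)) = \<epsilon> b *\<^sub>C c" for b c
  proof -
    have "a0 \<otimes>\<^sub>t mult_map (T1i (b \<otimes>\<^sub>t c)) = mult_map (T2i (a0 \<otimes>\<^sub>t b)) \<otimes>\<^sub>t c"
      using gen[of c "T2i (a0 \<otimes>\<^sub>t b)"] by (simp add: tensor_map_pure clin)
    from arg_cong[OF this, of "slice_left f"] show ?thesis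
      by (simp add: slice_pure f scaleC_one \<epsilon>_def)
  qed
  have right: "slice_right \<epsilon> (T2 s) = mult_map s" for s
  proof -
    have *: "tensor_map (\<lambda>x. x) (\<lambda>y. \<epsilon> y *\<^sub>C a0) t = slice_right \<epsilon> t \<otimes>\<^sub>t a0" for t :: "('a, 'a) tensor"
      by (rule tensor_eqI) (intro clin lin | simp add: tensor_map_pure clin lin slice_pure pure_tensor_linear)+
    have "slice_right \<epsilon> (T2 s) \<otimes>\<^sub>t a0 = mult_map s \<otimes>\<^sub>t a0"
      using gen[of a0 s] by (simp add: E *)
    from arg_cong[OF this, of "slice_right f"] show ?thesis
      by (simp add: slice_pure f scaleC_one)
  qed
  have "mult_map (T1i s) = slice_left \<epsilon> s" for s
    by (rule tensor_eqI) (intro clin lin | simp add: E slice_pure lin)+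
  from this[of "T1 s" for s] have left: "slice_left \<epsilon> (T1 s) = mult_map s" for s by simp
  show ?thesis using lin right left by blast
qed

text \<open>Only multiplicativity is missing. As T2 is onto, (id \<otimes> \<epsilon>)(w
  \<delta>(c)) = (id \<otimes> \<epsilon>)(w) c for all w. At w = a \<otimes> b this compares
  \<epsilon>(b y) with \<epsilon>(b) \<epsilon>(y) on the second legs y of T2(a \<otimes> c), and
  surjectivity of T2 reaches every y.\<close>

lemma is_counit_exists: "\<exists>\<epsilon>. is_counit \<delta> \<epsilon>"
proof -
  obtain \<epsilon> :: "'a \<Rightarrow> complex" where lin: "clinear \<epsilon>" and right: "\<And>s. slice_right \<epsilon> (T2 s) = mult_map s"
    and left: "\<And>s. slice_left \<epsilon> (T1 s) = mult_map s" using counit_exists by blast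
  note [clin] = lin clinear_compose[OF lin]
  have *: "slice_right \<epsilon> (rmult (\<delta> c) (T2 s)) = slice_right \<epsilon> (T2 s) * c" for c s
  proof -
    have "mult_map (tensor_map (\<lambda>x. x) (\<lambda>y. y * c) s) = mult_map s * c"
      by (rule tensor_eqI) (intro clin | simp add: tensor_map_pure clin mult_map_pure mult.assoc)+
    then show ?thesis by (simp add: T2_comult_right[symmetric] right)
  qed
  have **: "slice_right (\<lambda>y. \<epsilon> (b * y)) (T2 s) = \<epsilon> b *\<^sub>C slice_right \<epsilon> (T2 s)" for b s
  proof (rule tensor_eqI[where t = s])
    fix a c
    have "slice_right (\<lambda>y. \<epsilon> (b * y)) (T2 (a \<otimes>\<^sub>t c)) = slice_right \<epsilon> (rmult (\<delta> c) (T2 (T2i (a \<otimes>\<^sub>t b))))"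
      by (simp add: rmult_comult_pure slice_right_tensor_map clin)
    also have "\<dots> = (\<epsilon> b *\<^sub>C a) * c" by (subst *) (simp add: slice_pure lin)
    also have "\<dots> = \<epsilon> b *\<^sub>C slice_right \<epsilon> (T2 (a \<otimes>\<^sub>t c))" by (simp add: right mult_map_pure scaleC_mult_left)
    finally show "slice_right (\<lambda>y. \<epsilon> (b * y)) (T2 (a \<otimes>\<^sub>t c)) = \<epsilon> b *\<^sub>C slice_right \<epsilon> (T2 (a \<otimes>\<^sub>t c))" .
  qed (intro clin)+
  obtain a0 :: 'a where a0: "a0 \<noteq> 0" using nonzero by blast
  obtain f :: "'a \<Rightarrow> complex" where f: "clinear f" "f a0 = 1" using exists_functional[OF a0] by blast
  have "\<epsilon> (b * c) = \<epsilon> b * \<epsilon> c" for b c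
  proof -
    have "\<epsilon> (b * c) *\<^sub>C a0 = (\<epsilon> b * \<epsilon> c) *\<^sub>C a0"
      using **[of b "T2i (a0 \<otimes>\<^sub>t c)"] by (simp add: slice_pure clin scaleC_scaleC)
    from arg_cong[OF this, of f] show ?thesis
      by (simp add: clinear_scaleC[OF f(1)] f(2) scaleC_complex_def)
  qed
  then have "is_counit \<delta> \<epsilon>"
    by (simp add: is_counit_def algebra_hom_def lin right left mult_map_pure)
  then show ?thesis by blast
qed

lemma is_counit_slices:
  assumes "is_counit \<delta> \<epsilon>"
  shows "slice_right \<epsilon> (T2 s) = mult_map s" "slice_left \<epsilon> (T1 s) = mult_map s"
proof -
  have lin: "clinear \<epsilon>" using assms by (simp add: is_counit_def algebra_hom_def)
  show "slice_right \<epsilon> (T2 s) = mult_map s"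
    by (rule tensor_eqI) (intro clin lin | use assms in \<open>simp add: is_counit_def mult_map_pure\<close>)+
  show "slice_left \<epsilon> (T1 s) = mult_map s"
    by (rule tensor_eqI) (intro clin lin | use assms in \<open>simp add: is_counit_def mult_map_pure\<close>)+
qed

text \<open>With a0 \<otimes> b = T2(s), every counit satisfies \<epsilon>(b) a0 = \<mu>(s), which
  settles uniqueness.\<close>

lemma is_counit_counit: "is_counit \<delta> (counit \<delta>)"
proof -
  have "\<epsilon> = \<epsilon>'" if "is_counit \<delta> \<epsilon>" "is_counit \<delta> \<epsilon>'" for \<epsilon> \<epsilon>'
  proof (rule ext)
    fix b
    obtain a0 :: 'a where a0: "a0 \<noteq> 0" using nonzero by blast
    obtain f :: "'a \<Rightarrow> complex" where f: "clinear f" "f a0 = 1" using exists_functional[OF a0] by blast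
    have lin: "clinear \<epsilon>" "clinear \<epsilon>'" using that by (simp_all add: is_counit_def algebra_hom_def)
    have "\<epsilon> b *\<^sub>C a0 = \<epsilon>' b *\<^sub>C a0"
      using is_counit_slices(1)[OF that(1), of "T2i (a0 \<otimes>\<^sub>t b)"]
        is_counit_slices(1)[OF that(2), of "T2i (a0 \<otimes>\<^sub>t b)"] by (simp add: slice_pure lin)
    from arg_cong[OF this, of f] show "\<epsilon> b = \<epsilon>' b"
      by (simp add: clinear_scaleC[OF f(1)] f(2) scaleC_complex_def)
  qed
  then show ?thesis
    unfolding counit_def using is_counit_exists by (metis theI)
qed

abbreviation \<epsilon> :: "'a \<Rightarrow> complex" where "\<epsilon> \<equiv> counit \<delta>"

lemma algebra_hom_counit: "algebra_hom \<epsilon>" and counit_mult: "\<epsilon> (a * b) = \<epsilon> a * \<epsilon> b" and clinear_counit: "clinear \<epsilon>"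
  using is_counit_counit by (simp_all add: is_counit_def algebra_hom_def)

lemmas [clin] = clinear_counit clinear_compose[OF clinear_counit]

lemma counit_T2: "slice_right \<epsilon> (T2 s) = mult_map s" and counit_T1: "slice_left \<epsilon> (T1 s) = mult_map s"
  by (rule is_counit_slices[OF is_counit_counit])+

lemma counit_T1i: "mult_map (T1i s) = slice_left \<epsilon> s"
  using counit_T1[of "T1i s"] by simp

text \<open>If \<epsilon> vanished, the counit law would make all products zero, against
  nondegeneracy of a nonzero algebra.\<close>

lemma counit_nonzero: obtains e where "\<epsilon> e = 1"
proof -
  have "\<exists>a. \<epsilon> a \<noteq> 0"
  proof (rule ccontr)
    assume "\<not> ?thesis"
    then have 0: "\<epsilon> a = 0" for a by blast
    have "slice_left \<epsilon> t = 0" for t :: "('a, 'a) tensor"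
      by (rule tensor_eqI) (intro clin | subst slice_pure(1)[OF clinear_counit] | simp add: 0)+
    then have "a * b = 0" for a b :: 'a
      using counit_T1[of "a \<otimes>\<^sub>t b"] by (simp add: mult_map_pure)
    then show False using nondegenerate nonzero unfolding nondegenerate_product_def by blast
  qed
  then obtain a where "\<epsilon> a \<noteq> 0" by blast
  then have "\<epsilon> (inverse (\<epsilon> a) *\<^sub>C a) = 1" by (simp add: clinear_scaleC[OF clinear_counit] scaleC_complex_def)
  then show thesis by (rule that)
qed

text \<open>By the counit law, a = \<epsilon>(e) a is the product map applied to
  \<open>T1i (e \<otimes>\<^sub>t a)\<close>, hence a sum of products.\<close>

lemma span_products: "complex_vector.span {a * b | a b :: 'a. True} = UNIV"
proof -
  obtain e where e: "\<epsilon> e = 1" by (rule counit_nonzero)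
  have "mult_map s \<in> complex_vector.span {a * b | a b :: 'a. True}" for s
    by (rule tensor_in_subspace) (intro clin | auto simp: mult_map_pure intro: complex_vector.span_base)+
  moreover have "a = mult_map (T1i (e \<otimes>\<^sub>t a))" for a
    by (simp add: counit_T1i slice_pure clin e scaleC_one)
  ultimately show ?thesis by (metis UNIV_eq_I)
qed

text \<open>Since \<delta>(a)(r \<otimes> b) = T1(a \<otimes> b)(r \<otimes> 1) and T1 is onto, the
  first span contains all x r \<otimes> q, and products span the algebra. The other side uses T2 in
  the same way.\<close>

lemma nondegenerate_comult: "nondegenerate_map \<delta>"
proof (rule nondegenerate_mapI)
  fix t :: "('a, 'a) tensor"
  let ?S = "complex_vector.span {lmult (\<delta> a) b | a b. True}"
  let ?R = "complex_vector.span {rmult (\<delta> a) b | a b. True}"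
  have T1: "tensor_map (\<lambda>x. x * r) (\<lambda>y. y) (T1 (a \<otimes>\<^sub>t b)) = lmult (\<delta> a) (r \<otimes>\<^sub>t b)" for a b r
    by (rule to_multiplier2_eqD)
       (simp add: to_multiplier_tensor_map T1_pure mult_to_multiplier(1)[OF nondegenerate_tensor, symmetric]
          multiplier_times_to_multiplier[symmetric] multiplier_times_mult mult.assoc)
  have T2: "tensor_map (\<lambda>x. x) ((*) r) (T2 (a \<otimes>\<^sub>t b)) = rmult (\<delta> b) (a \<otimes>\<^sub>t r)" for a b r
    by (rule rmult_comult_pure[symmetric])
  have S: "tensor_map (\<lambda>x. x * r) (\<lambda>y. y) (T1 u) \<in> ?S" for r u
    by (rule tensor_in_subspace) (intro clin | auto simp: T1 intro: complex_vector.span_base)+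
  have R: "tensor_map (\<lambda>x. x) ((*) r) (T2 u) \<in> ?R" for r u
    by (rule tensor_in_subspace) (intro clin | auto simp: T2 intro: complex_vector.span_base)+
  show "t \<in> ?S"
  proof (rule tensor_in_subspace[OF clinear_ident])
    show "p \<otimes>\<^sub>t q \<in> ?S" for p q
    proof (rule clinear_in_subspace[of "\<lambda>p. p \<otimes>\<^sub>t q"])
      show "x \<otimes>\<^sub>t q \<in> ?S" if "x \<in> {a * b | a b. True}" for x
      proof -
        from that obtain a b where "x = a * b" by blast
        then show ?thesis using S[of b "T1i (a \<otimes>\<^sub>t q)"] by (simp add: tensor_map_pure clin)
      qed
      show "p \<in> complex_vector.span {a * b | a b. True}" unfolding span_products by simp
    qed (intro clin | simp)+
  qed simp
  show "t \<in> ?R"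
  proof (rule tensor_in_subspace[OF clinear_ident])
    show "p \<otimes>\<^sub>t q \<in> ?R" for p q
    proof (rule clinear_in_subspace[of "\<lambda>q. p \<otimes>\<^sub>t q"])
      show "p \<otimes>\<^sub>t x \<in> ?R" if "x \<in> {a * b | a b. True}" for x
      proof -
        from that obtain a b where "x = a * b" by blast
        then show ?thesis using R[of a "T2i (p \<otimes>\<^sub>t b)"] by (simp add: tensor_map_pure clin)
      qed
      show "q \<in> complex_vector.span {a * b | a b. True}" unfolding span_products by simp
    qed (intro clin | simp)+
  qed simp
qed

section \<open>The coinverse\<close>

lemma coinverse_key:
  "tensor_lift (\<lambda>x y. x * slice_left \<epsilon> (T1i (y \<otimes>\<^sub>t c))) (T2 s) = slice_right \<epsilon> s * c"
proof (rule tensor_eqI[where t = s])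
  fix a b
  \<comment> \<open>For u = p \<otimes> q, applying \<epsilon> to the middle leg of T2(a \<otimes>
    p) \<otimes> q leaves a p \<otimes> q by the counit law.\<close>
  have *: "mult_map (tensor_map (\<lambda>x. x) (slice_left \<epsilon>) (tensor_assoc (T2_id (tensor_assoc' (a \<otimes>\<^sub>t u))))) =
      a * mult_map u" for u
  proof (rule tensor_eqI[where t = u])
    fix p q
    have "mult_map (tensor_map (\<lambda>x. x) (slice_left \<epsilon>) (tensor_assoc (s \<otimes>\<^sub>t q))) = slice_right \<epsilon> s * q"
      for s :: "('a, 'a) tensor"
      by (rule tensor_eqI)
         (intro clin | simp add: tensor_map_pure tensor_assoc_pure clin mult_map_pure slice_pure
            scaleC_mult_left scaleC_mult_right)+
    then show "mult_map (tensor_map (\<lambda>x. x) (slice_left \<epsilon>) (tensor_assoc (T2_id (tensor_assoc' (a \<otimes>\<^sub>t (p \<otimes>\<^sub>t q)))))) =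
        a * mult_map (p \<otimes>\<^sub>t q)"
      by (simp add: tensor_assoc'_pure tensor_map_pure clin clinear_T2 counit_T2 mult_map_pure mult.assoc)
  qed (intro clin clinear_T2)+
  have "tensor_lift (\<lambda>x y. x * slice_left \<epsilon> (T1i (y \<otimes>\<^sub>t c))) (T2 (a \<otimes>\<^sub>t b)) =
      mult_map (tensor_map (\<lambda>x. x) (\<lambda>y. slice_left \<epsilon> (T1i (y \<otimes>\<^sub>t c))) (T2 (a \<otimes>\<^sub>t b)))"
    by (rule tensor_lift_tensor_map[symmetric]) (intro clin)+
  also have "\<dots> = a * mult_map (T1i (b \<otimes>\<^sub>t c))"
    by (simp add: T2_slice_T1i clin *)
  also have "\<dots> = slice_right \<epsilon> (a \<otimes>\<^sub>t b) * c"
    by (simp add: counit_T1i slice_pure clin scaleC_mult_left scaleC_mult_right)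
  finally show "tensor_lift (\<lambda>x y. x * slice_left \<epsilon> (T1i (y \<otimes>\<^sub>t c))) (T2 (a \<otimes>\<^sub>t b)) =
      slice_right \<epsilon> (a \<otimes>\<^sub>t b) * c" .
qed (intro clin)+

text \<open>Expecting T1i(a \<otimes> b) = a1 \<otimes> \<kappa>(a2) b and T2i(b \<otimes> a) = b
  \<kappa>(a1) \<otimes> a2, the slices are the two actions of \<kappa>(a). Their compatibility is
  \<open>coinverse_key\<close> at the preimage of b \<otimes> a under T2.\<close>

lemma coinverse_multiplier_exists:
  "\<exists>k. (\<forall>b. lmult k b = slice_left \<epsilon> (T1i (a \<otimes>\<^sub>t b))) \<and> (\<forall>b. rmult k b = slice_right \<epsilon> (T2i (b \<otimes>\<^sub>t a)))"
proof -
  have "\<exists>k. lmult k = (\<lambda>b. slice_left \<epsilon> (T1i (a \<otimes>\<^sub>t b))) \<and> rmult k = (\<lambda>b. slice_right \<epsilon> (T2i (b \<otimes>\<^sub>t a)))"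
  proof (rule multiplier_exists)
    show "slice_right \<epsilon> (T2i (b \<otimes>\<^sub>t a)) * c = b * slice_left \<epsilon> (T1i (a \<otimes>\<^sub>t c))" for b c
      using coinverse_key[of c "T2i (b \<otimes>\<^sub>t a)"] by (simp add: tensor_lift_pure_tensor clin)
  qed (intro clin)+
  then show ?thesis by (metis)
qed

definition \<kappa>\<^sub>0 :: "'a \<Rightarrow> 'a multiplier"
  where "\<kappa>\<^sub>0 a = (SOME k. (\<forall>b. lmult k b = slice_left \<epsilon> (T1i (a \<otimes>\<^sub>t b))) \<and>
    (\<forall>b. rmult k b = slice_right \<epsilon> (T2i (b \<otimes>\<^sub>t a))))"

lemma lmult_\<kappa>\<^sub>0: "lmult (\<kappa>\<^sub>0 a) b = slice_left \<epsilon> (T1i (a \<otimes>\<^sub>t b))"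
  and rmult_\<kappa>\<^sub>0: "rmult (\<kappa>\<^sub>0 a) b = slice_right \<epsilon> (T2i (b \<otimes>\<^sub>t a))"
  using someI_ex[OF coinverse_multiplier_exists[of a]] unfolding \<kappa>\<^sub>0_def by blast+

lemma clinear_\<kappa>\<^sub>0: "clinear \<kappa>\<^sub>0"
proof -
  have 1: "clinear (\<lambda>a. slice_left \<epsilon> (T1i (a \<otimes>\<^sub>t b)))" for b by (intro clin)
  show ?thesis
    by (rule clinearI; rule multiplier_eqI_lmult[OF nondegenerate])
       (simp_all add: lmult_\<kappa>\<^sub>0 clinear_add[OF 1] clinear_scaleC[OF 1])
qed

text \<open>Since (1 \<otimes> a) T2(p \<otimes> q) = (p \<otimes> a) \<delta>(q), its preimage
  under T2 is T2i(p \<otimes> a)(1 \<otimes> q). As \<epsilon> is multiplicative, id \<otimes>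
  \<epsilon> sends this to \<epsilon>(q) p \<kappa>(a). By linearity it remains to replace p
  \<otimes> q by T2i(c \<otimes> b).\<close>

lemma \<kappa>\<^sub>0_mult: "\<kappa>\<^sub>0 (a * b) = \<kappa>\<^sub>0 b * \<kappa>\<^sub>0 a"
proof (rule multiplier_eqI_rmult[OF nondegenerate])
  fix c
  have "slice_right \<epsilon> (T2i (tensor_map (\<lambda>x. x) ((*) a) (T2 s))) = rmult (\<kappa>\<^sub>0 a) (slice_right \<epsilon> s)" for s
  proof (rule tensor_eqI[where t = s])
    fix p q
    let ?w = "T2i (p \<otimes>\<^sub>t a)"
    have "tensor_map (\<lambda>x. x) ((*) a) (T2 (p \<otimes>\<^sub>t q)) = T2 (tensor_map (\<lambda>x. x) (\<lambda>y. y * q) ?w)"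
      by (simp add: T2_comult_right rmult_comult_pure)
    moreover have "slice_right \<epsilon> (tensor_map (\<lambda>x. x) (\<lambda>y. y * q) w) = \<epsilon> q *\<^sub>C slice_right \<epsilon> w"
      for w :: "('a, 'a) tensor"
      by (rule tensor_eqI)
         (intro clin | simp add: tensor_map_pure clin slice_pure counit_mult scaleC_scaleC mult.commute)+
    ultimately show "slice_right \<epsilon> (T2i (tensor_map (\<lambda>x. x) ((*) a) (T2 (p \<otimes>\<^sub>t q)))) =
        rmult (\<kappa>\<^sub>0 a) (slice_right \<epsilon> (p \<otimes>\<^sub>t q))"
      by (simp add: slice_pure clin clinear_scaleC[OF clinear_rmult] rmult_\<kappa>\<^sub>0)
  qed (intro clin)+
  from this[of "T2i (c \<otimes>\<^sub>t b)"] show "rmult (\<kappa>\<^sub>0 (a * b)) c = rmult (\<kappa>\<^sub>0 b * \<kappa>\<^sub>0 a) c"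
    by (simp add: rmult_\<kappa>\<^sub>0 tensor_map_pure clin)
qed

text \<open>With s replaced by T2 s or T1 s, these are the antipode laws freed of their outer
  factors.\<close>

lemma \<kappa>\<^sub>0_T2: "tensor_lift (\<lambda>x y. rmult (\<kappa>\<^sub>0 y) x) s = slice_right \<epsilon> (T2i s)"
  and \<kappa>\<^sub>0_T1: "tensor_lift (\<lambda>x y. lmult (\<kappa>\<^sub>0 x) y) s = slice_left \<epsilon> (T1i s)"
  by (rule tensor_eqI;
      (intro clin clinear_lmult_left clinear_rmult_left clinear_compose[OF clinear_\<kappa>\<^sub>0])?;
      subst tensor_lift_pure_tensor;
      (intro clin clinear_lmult_left clinear_rmult_left clinear_compose[OF clinear_\<kappa>\<^sub>0])?;
      simp add: lmult_\<kappa>\<^sub>0 rmult_\<kappa>\<^sub>0)+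

text \<open>Brings one side of the antipode law from M(A) into A, where nondegeneracy removes the
  factor c.\<close>

lemma coinverse_left_expression:
  assumes "clinear k"
  shows "mult_map (tensor_map to_multiplier k s * (1 \<otimes>\<^sub>t to_multiplier c)) =
    to_multiplier (tensor_lift (\<lambda>x y. rmult (k y) x) s * (c :: 'a))"
proof -
  note [clin] = clinear_compose[OF assms]
  have "cbilinear (\<lambda>x y. rmult (k y) (x :: 'a))" by (intro clin)
  note [clin] = clinear_tensor_lift[OF this]
  show ?thesis
    by (rule tensor_eqI)
       (intro clin assms clinear_to_multiplier | simp add: tensor_map_pure clinear_to_multiplier assms tensor_mult_pure
          mult_map_pure tensor_lift_pure_tensor[OF \<open>cbilinear _\<close>] to_multiplier_mult
          mult_to_multiplier(2)[OF nondegenerate, symmetric] mult.assoc)+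
qed

lemma coinverse_right_expression:
  assumes "clinear k"
  shows "mult_map ((to_multiplier a \<otimes>\<^sub>t 1) * tensor_map k to_multiplier s) =
    to_multiplier ((a :: 'a) * tensor_lift (\<lambda>x y. lmult (k x) y) s)"
proof -
  note [clin] = clinear_compose[OF assms]
  have "cbilinear (\<lambda>x y. lmult (k x) (y :: 'a))" by (intro clin)
  note [clin] = clinear_tensor_lift[OF this]
  show ?thesis
    by (rule tensor_eqI)
       (intro clin assms clinear_to_multiplier | simp add: tensor_map_pure clinear_to_multiplier assms tensor_mult_pure
          mult_map_pure tensor_lift_pure_tensor[OF \<open>cbilinear _\<close>] to_multiplier_mult
          mult_to_multiplier(1)[OF nondegenerate, symmetric] mult.assoc)+
qed

lemma is_coinverse_\<kappa>\<^sub>0: "is_coinverse \<delta> \<kappa>\<^sub>0"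
  unfolding is_coinverse_def Let_def coinverse_left_expression[OF clinear_\<kappa>\<^sub>0]
    coinverse_right_expression[OF clinear_\<kappa>\<^sub>0] \<kappa>\<^sub>0_T1 \<kappa>\<^sub>0_T2
  by (simp add: algebra_antihom_def clinear_\<kappa>\<^sub>0 \<kappa>\<^sub>0_mult slice_pure clin scaleC_mult_left scaleC_mult_right)

text \<open>Because T2 is onto, the antipode law at the preimage of a \<otimes> b determines a
  \<kappa>(b).\<close>

lemma is_coinverse_unique:
  assumes "is_coinverse \<delta> k"
  shows "k = \<kappa>\<^sub>0"
proof (rule ext, rule multiplier_eqI_rmult[OF nondegenerate], rule nondeg_left[OF nondegenerate])
  fix b a c
  have lin: "clinear k" using assms by (simp add: is_coinverse_def algebra_antihom_def)
  have bil: "cbilinear (\<lambda>x y. rmult (k y) (x :: 'a))" by (intro clin clinear_compose[OF lin])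
  have "tensor_lift (\<lambda>x y. rmult (k y) x) (T2 (a \<otimes>\<^sub>t b)) * c = slice_right \<epsilon> (a \<otimes>\<^sub>t b) * c" for a b c
  proof (rule injD[OF inj_to_multiplier[OF nondegenerate]])
    show "to_multiplier (tensor_lift (\<lambda>x y. rmult (k y) x) (T2 (a \<otimes>\<^sub>t b)) * c) =
        to_multiplier (slice_right \<epsilon> (a \<otimes>\<^sub>t b) * c)"
      using assms unfolding is_coinverse_def Let_def coinverse_left_expression[OF lin]
      by (simp add: slice_pure clin scaleC_mult_left)
  qed
  then have *: "tensor_lift (\<lambda>x y. rmult (k y) x) (T2 (a \<otimes>\<^sub>t b)) = slice_right \<epsilon> (a \<otimes>\<^sub>t b)" for a b
    by (rule nondeg_left[OF nondegenerate])
  have "tensor_lift (\<lambda>x y. rmult (k y) x) (T2 s) = slice_right \<epsilon> s" for s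
    by (rule tensor_eqI[of "\<lambda>s. tensor_lift (\<lambda>x y. rmult (k y) x) (T2 s)" _, OF _ _ *])
       (intro clin clinear_tensor_lift[OF bil])+
  from this[of "T2i (a \<otimes>\<^sub>t b)"] show "rmult (k b) a * c = rmult (\<kappa>\<^sub>0 b) a * c"
    by (simp add: tensor_lift_pure_tensor[OF bil] rmult_\<kappa>\<^sub>0)
qed

lemma coinverse_eq: "coinverse \<delta> = \<kappa>\<^sub>0"
  unfolding coinverse_def by (rule the_equality) (simp_all add: is_coinverse_\<kappa>\<^sub>0 is_coinverse_unique)

text \<open>With \<epsilon>(e) = 1, the antipode law on T1(e \<otimes> a) writes a as a sum of terms
  \<kappa>(x) y; T2(a \<otimes> e) gives the other side.\<close>

lemma nondegenerate_\<kappa>\<^sub>0: "nondegenerate_map \<kappa>\<^sub>0"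
proof (rule nondegenerate_mapI)
  fix a :: 'a
  obtain e where e: "\<epsilon> e = 1" by (rule counit_nonzero)
  have bil: "cbilinear (\<lambda>x y. lmult (\<kappa>\<^sub>0 x) y)" "cbilinear (\<lambda>x y. rmult (\<kappa>\<^sub>0 y) x)"
    by (intro clin clinear_compose[OF clinear_\<kappa>\<^sub>0])+
  have "tensor_lift (\<lambda>x y. lmult (\<kappa>\<^sub>0 x) y) s \<in> complex_vector.span {lmult (\<kappa>\<^sub>0 a) b | a b. True}" for s
    by (rule tensor_in_subspace)
       (intro clinear_tensor_lift[OF bil(1)] clin |
        force simp: tensor_lift_pure_tensor[OF bil(1)] intro: complex_vector.span_base)+
  from this[of "T1 (e \<otimes>\<^sub>t a)"] show "a \<in> complex_vector.span {lmult (\<kappa>\<^sub>0 a) b | a b. True}"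
    by (simp add: \<kappa>\<^sub>0_T1 slice_pure clin e scaleC_one)
  have "tensor_lift (\<lambda>x y. rmult (\<kappa>\<^sub>0 y) x) s \<in> complex_vector.span {rmult (\<kappa>\<^sub>0 a) b | a b. True}" for s
    by (rule tensor_in_subspace)
       (intro clinear_tensor_lift[OF bil(2)] clin |
        force simp: tensor_lift_pure_tensor[OF bil(2)] intro: complex_vector.span_base)+
  from this[of "T2 (a \<otimes>\<^sub>t e)"] show "a \<in> complex_vector.span {rmult (\<kappa>\<^sub>0 a) b | a b. True}"
    by (simp add: \<kappa>\<^sub>0_T2 slice_pure clin e scaleC_one)
qed


section \<open>Coassociativity on multipliers\<close>

abbreviation \<delta>\<^sub>M :: "'a multiplier \<Rightarrow> ('a, 'a) tensor multiplier" where "\<delta>\<^sub>M \<equiv> hom_extension \<delta>"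
abbreviation \<epsilon>\<^sub>M :: "'a multiplier \<Rightarrow> complex" where "\<epsilon>\<^sub>M \<equiv> hom_extension \<epsilon>"
abbreviation \<kappa>\<^sub>M :: "'a multiplier \<Rightarrow> 'a multiplier" where "\<kappa>\<^sub>M \<equiv> antihom_extension (coinverse \<delta>)"

lemmas \<delta>\<^sub>M_extension = hom_extension_multiplier[OF nondegenerate nondegenerate_tensor algebra_hom_comult nondegenerate_comult]

lemma \<delta>\<^sub>M_mult: "\<delta>\<^sub>M (m * n) = \<delta>\<^sub>M m * \<delta>\<^sub>M n" and clinear_\<delta>\<^sub>M: "clinear \<delta>\<^sub>M"
  using \<delta>\<^sub>M_extension(1) by (simp_all add: algebra_hom_def)

lemmas \<delta>\<^sub>M_one = \<delta>\<^sub>M_extension(2)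
lemmas \<delta>\<^sub>M_to_multiplier = \<delta>\<^sub>M_extension(3)

lemma \<epsilon>\<^sub>M: "\<epsilon>\<^sub>M (m * n) = \<epsilon>\<^sub>M m * \<epsilon>\<^sub>M n" "clinear \<epsilon>\<^sub>M" "\<epsilon>\<^sub>M 1 = 1" "\<epsilon>\<^sub>M (to_multiplier a) = \<epsilon> a"
proof -
  obtain e where e: "\<epsilon> e = 1" by (rule counit_nonzero)
  show "\<epsilon>\<^sub>M (m * n) = \<epsilon>\<^sub>M m * \<epsilon>\<^sub>M n" "clinear \<epsilon>\<^sub>M" "\<epsilon>\<^sub>M 1 = 1" "\<epsilon>\<^sub>M (to_multiplier a) = \<epsilon> a"
    using hom_extension_functional[OF nondegenerate algebra_hom_counit e] by (auto simp: algebra_hom_def)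
qed

lemma algebra_antihom_\<kappa>\<^sub>0: "algebra_antihom \<kappa>\<^sub>0"
  by (simp add: algebra_antihom_def clinear_\<kappa>\<^sub>0 \<kappa>\<^sub>0_mult)

lemma \<kappa>\<^sub>M: "\<kappa>\<^sub>M (m * n) = \<kappa>\<^sub>M n * \<kappa>\<^sub>M m" "clinear \<kappa>\<^sub>M" "\<kappa>\<^sub>M 1 = 1" "\<kappa>\<^sub>M (to_multiplier a) = \<kappa>\<^sub>0 a"
  using antihom_extension_multiplier[OF nondegenerate nondegenerate algebra_antihom_\<kappa>\<^sub>0 nondegenerate_\<kappa>\<^sub>0]
  by (auto simp: algebra_antihom_def coinverse_eq)

lemmas [clin] = clinear_\<delta>\<^sub>M \<epsilon>\<^sub>M(2) \<kappa>\<^sub>M(2) clinear_\<kappa>\<^sub>0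
  clinear_compose[OF clinear_\<delta>\<^sub>M] clinear_compose[OF \<epsilon>\<^sub>M(2)] clinear_compose[OF \<kappa>\<^sub>M(2)]
  clinear_compose[OF clinear_\<kappa>\<^sub>0]

lemma comult_lmult: "\<delta> (lmult m a) = \<delta>\<^sub>M m * \<delta> a" and comult_rmult: "\<delta> (rmult m a) = \<delta> a * \<delta>\<^sub>M m"
  by (simp_all add: \<delta>\<^sub>M_to_multiplier[symmetric] mult_to_multiplier[OF nondegenerate, symmetric] \<delta>\<^sub>M_mult)

lemma counit_lmult: "\<epsilon> (lmult m a) = \<epsilon>\<^sub>M m * \<epsilon> a" and counit_rmult: "\<epsilon> (rmult m a) = \<epsilon> a * \<epsilon>\<^sub>M m"
  by (simp_all add: \<epsilon>\<^sub>M(4)[symmetric] mult_to_multiplier[OF nondegenerate, symmetric] \<epsilon>\<^sub>M(1))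

lemma \<kappa>\<^sub>0_lmult: "\<kappa>\<^sub>0 (lmult m a) = \<kappa>\<^sub>0 a * \<kappa>\<^sub>M m" and \<kappa>\<^sub>0_rmult: "\<kappa>\<^sub>0 (rmult m a) = \<kappa>\<^sub>M m * \<kappa>\<^sub>0 a"
  by (simp_all add: \<kappa>\<^sub>M(4)[symmetric] mult_to_multiplier[OF nondegenerate, symmetric] \<kappa>\<^sub>M(1))

lemma T1_lmult: "T1 (tensor_map (lmult m) (\<lambda>y. y) s) = lmult (\<delta>\<^sub>M m) (T1 s)"
proof (rule tensor_eqI[where t = s])
  show "T1 (tensor_map (lmult m) (\<lambda>y. y) (a \<otimes>\<^sub>t b)) = lmult (\<delta>\<^sub>M m) (T1 (a \<otimes>\<^sub>t b))" for a b
    by (rule to_multiplier2_eqD)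
       (simp add: tensor_map_pure clin T1_pure mult_to_multiplier(1)[OF nondegenerate_tensor, symmetric] comult_lmult
          clinear_lmult mult.assoc)
qed (intro clin clinear_lmult)+

lemma T2_rmult: "T2 (tensor_map (\<lambda>x. x) (rmult m) s) = rmult (\<delta>\<^sub>M m) (T2 s)"
proof (rule tensor_eqI[where t = s])
  show "T2 (tensor_map (\<lambda>x. x) (rmult m) (a \<otimes>\<^sub>t b)) = rmult (\<delta>\<^sub>M m) (T2 (a \<otimes>\<^sub>t b))" for a b
    by (rule to_multiplier2_eqD)
       (simp add: tensor_map_pure clin T2_pure mult_to_multiplier(2)[OF nondegenerate_tensor, symmetric] comult_rmult
          clinear_rmult mult.assoc)
qed (intro clin clinear_rmult)+

section \<open>Covered coassociativity in the triple tensor product\<close>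

abbreviation left_leg :: "'a \<Rightarrow> (('a, 'a) tensor, 'a) tensor \<Rightarrow> (('a, 'a) tensor, 'a) tensor"
  where "left_leg a \<equiv> tensor_map (tensor_map ((*) a) (\<lambda>x. x)) (\<lambda>x. x)"

abbreviation right_legs :: "'a \<Rightarrow> 'a \<Rightarrow> (('a, 'a) tensor, 'a) tensor \<Rightarrow> (('a, 'a) tensor, 'a) tensor"
  where "right_legs r r' \<equiv> tensor_map (tensor_map (\<lambda>x. x * r) (\<lambda>x. x * r')) (\<lambda>x. x)"

text \<open>Left multiplication by 1 \<otimes> \<delta>(n); the associators are there because triple
  tensors are bracketed to the left.\<close>

abbreviation last_legs :: "'a multiplier \<Rightarrow> (('a, 'a) tensor, 'a) tensor \<Rightarrow> (('a, 'a) tensor, 'a) tensor"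
  where "last_legs n z \<equiv> tensor_assoc' (tensor_map (\<lambda>x. x) (lmult (\<delta>\<^sub>M n)) (tensor_assoc z))"

text \<open>Stands for (\<delta> \<otimes> id)(w)(r \<otimes> 1); the factor r keeps the result
  inside A \<otimes> A \<otimes> A.\<close>

abbreviation comult_left :: "('a, 'a) tensor \<Rightarrow> ('a, 'a) tensor \<Rightarrow> (('a, 'a) tensor, 'a) tensor"
  where "comult_left r \<equiv> tensor_lift (\<lambda>p c. lmult (\<delta> p) r \<otimes>\<^sub>t c)"

lemma left_leg_separates:
  assumes "\<And>a. left_leg a z = left_leg a z'"
  shows "z = z'"
proof -
  have "z - z' = 0"
  proof (rule tensor_map_separates[of "\<lambda>a. tensor_map ((*) a) (\<lambda>x. x)" "\<lambda>_::unit. \<lambda>x. x"])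
    show "v = 0" if v: "\<And>a. tensor_map ((*) a) (\<lambda>x. x) v = 0" for v :: "('a, 'a) tensor"
    proof (rule tensor_map_separates[of "(*)" "\<lambda>_::unit. \<lambda>x. x"])
      show "x = 0" if "\<And>a. a * x = 0" for x :: 'a
        using nondegenerate that unfolding nondegenerate_product_def by blast
    qed (use v in \<open>simp_all add: clin\<close>)
    show "tensor_map (tensor_map ((*) a) (\<lambda>x. x)) (\<lambda>x. x) (z - z') = 0" for a
      using assms[of a] by (simp add: clinear_diff[OF clinear_tensor_map] clin)
  qed (simp_all add: clin)
  then show ?thesis by simp
qed

text \<open>Both sides are (a \<otimes> 1 \<otimes> 1)(\<delta> \<otimes> id)(w)(r \<otimes> r'
  \<otimes> 1); the right side exhibits T2 \<otimes> id, to which the axiom applies.\<close>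

lemma left_leg_comult_left:
  "left_leg a (comult_left (r \<otimes>\<^sub>t r') w) = right_legs r r' (T2_id (tensor_assoc' (a \<otimes>\<^sub>t w)))"
proof (rule tensor_eqI[where t = w])
  fix p c
  have "tensor_map ((*) a) (\<lambda>x. x) (lmult (\<delta> p) (r \<otimes>\<^sub>t r')) = tensor_map (\<lambda>x. x * r) (\<lambda>x. x * r') (T2 (a \<otimes>\<^sub>t p))"
    by (rule to_multiplier2_eqD)
       (simp add: to_multiplier_tensor_map mult_to_multiplier(1)[OF nondegenerate_tensor, symmetric] T2_pure
          tensor_mult_pure_map(2)[symmetric] to_multiplier_mult mult.assoc)
  then show "left_leg a (comult_left (r \<otimes>\<^sub>t r') (p \<otimes>\<^sub>t c)) =
      right_legs r r' (T2_id (tensor_assoc' (a \<otimes>\<^sub>t (p \<otimes>\<^sub>t c))))"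
    by (simp add: tensor_lift_pure_tensor clin tensor_map_pure tensor_assoc'_pure clinear_T2)
qed (intro clin)+

lemma lmult_comult_left:
  "lmult (multiplier_tensor (tensor_map \<delta>\<^sub>M (\<lambda>y. y) t)) (comult_left r w) =
    comult_left r (lmult (multiplier_tensor t) w)"
proof (rule tensor_eqI[where t = t])
  show "lmult (multiplier_tensor (tensor_map \<delta>\<^sub>M (\<lambda>y. y) (m \<otimes>\<^sub>t n))) (comult_left r w) =
    comult_left r (lmult (multiplier_tensor (m \<otimes>\<^sub>t n)) w)" for m n
    by (rule tensor_eqI[where t = w])
       (intro clin | simp add: tensor_lift_pure_tensor clin tensor_map_pure multiplier_tensor_pure
          lmult_multiplier_times clinear_lmult comult_lmult)+
qed (intro clin)+

lemma id_T1_lmult: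
  "id_T1 (tensor_map (tensor_map (\<lambda>x. x) (lmult n)) (\<lambda>x. x) z) = last_legs n (id_T1 z)"
proof (rule tensor3_eqI[where t = z])
  fix p q c
  have "T1 (lmult n q \<otimes>\<^sub>t c) = lmult (\<delta>\<^sub>M n) (T1 (q \<otimes>\<^sub>t c))"
    by (simp add: T1_lmult[symmetric] tensor_map_pure clin clinear_lmult)
  then show "id_T1 (tensor_map (tensor_map (\<lambda>x. x) (lmult n)) (\<lambda>x. x) ((p \<otimes>\<^sub>t q) \<otimes>\<^sub>t c)) =
      last_legs n (id_T1 ((p \<otimes>\<^sub>t q) \<otimes>\<^sub>t c))"
    by (simp add: tensor_map_pure clin clinear_lmult tensor_assoc_pure tensor_assoc_assoc' clinear_T1)
qed (intro clin clinear_lmult clinear_T1)+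

text \<open>With \<delta>(x) = \<Sum> m \<otimes> n, the element (a \<otimes> 1) \<delta>(x)
  \<delta>(p) splits into the terms (1 \<otimes> n)(a m \<otimes> 1) \<delta>(p): the left leg is
  absorbed by a.\<close>

lemma T2_lmult:
  assumes "multiplier_tensor t = \<delta>\<^sub>M x"
  shows "T2 (a \<otimes>\<^sub>t lmult x p) =
    tensor_lift (\<lambda>m n. tensor_map (\<lambda>x. x) (lmult n) (T2 (rmult m a \<otimes>\<^sub>t p))) t"
proof (rule to_multiplier2_eqD)
  have "to_multiplier (tensor_lift (\<lambda>m n. tensor_map (\<lambda>x. x) (lmult n) (T2 (rmult m a \<otimes>\<^sub>t p))) t) =
      multiplier_times (to_multiplier a) 1 * (multiplier_tensor t * \<delta> p)"
  proof (rule tensor_eqI[where t = t])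
    fix m n
    have "to_multiplier (tensor_map (\<lambda>x. x) (lmult n) s) = multiplier_times 1 n * to_multiplier s"
      for s :: "('a, 'a) tensor"
      using to_multiplier_tensor_map(1)[of 1 n s] by (simp add: lmult_fun)
    then show "to_multiplier (tensor_lift (\<lambda>m n. tensor_map (\<lambda>x. x) (lmult n) (T2 (rmult m a \<otimes>\<^sub>t p))) (m \<otimes>\<^sub>t n)) =
      multiplier_times (to_multiplier a) 1 * (multiplier_tensor (m \<otimes>\<^sub>t n) * \<delta> p)"
      by (simp add: tensor_lift_pure_tensor clin clinear_lmult multiplier_tensor_pure T2_pure
          mult_to_multiplier(2)[OF nondegenerate, symmetric] mult.assoc[symmetric] multiplier_times_mult)
  qed (intro clin clinear_lmult)+
  then show "to_multiplier (T2 (a \<otimes>\<^sub>t lmult x p)) =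
      to_multiplier (tensor_lift (\<lambda>m n. tensor_map (\<lambda>x. x) (lmult n) (T2 (rmult m a \<otimes>\<^sub>t p))) t)"
    by (simp add: T2_pure comult_lmult assms)
qed

text \<open>After \<open>T2_lmult\<close> has distributed the legs of \<delta>(x), id \<otimes> T1
  turns n into \<delta>(n) and passes through T2 \<otimes> id by the commutation axiom.\<close>

lemma last_legs_T2_id:
  assumes "multiplier_tensor t = \<delta>\<^sub>M x"
  shows "id_T1 (T2_id (tensor_assoc' (a \<otimes>\<^sub>t tensor_map (lmult x) (\<lambda>y. y) u))) =
    tensor_lift (\<lambda>m n. last_legs n (T2_id (tensor_assoc' (rmult m a \<otimes>\<^sub>t T1 u)))) t"
proof (rule tensor_eqI[where t = u])
  fix p q
  let ?f = "\<lambda>m n. tensor_map (\<lambda>x. x) (lmult n) (T2 (rmult m a \<otimes>\<^sub>t p))"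
  have "id_T1 (tensor_lift ?f s \<otimes>\<^sub>t q) =
      tensor_lift (\<lambda>m n. last_legs n (T2_id (tensor_assoc' (rmult m a \<otimes>\<^sub>t T1 (p \<otimes>\<^sub>t q))))) s" for s
  proof (rule tensor_eqI[where t = s])
    fix m n
    have "id_T1 (?f m n \<otimes>\<^sub>t q) = last_legs n (id_T1 (T2_id (tensor_assoc' (rmult m a \<otimes>\<^sub>t (p \<otimes>\<^sub>t q)))))"
      using id_T1_lmult[of n "T2 (rmult m a \<otimes>\<^sub>t p) \<otimes>\<^sub>t q"]
      by (simp add: tensor_map_pure clin clinear_lmult tensor_assoc'_pure clinear_T2)
    also have "\<dots> = last_legs n (T2_id (tensor_assoc' (rmult m a \<otimes>\<^sub>t T1 (p \<otimes>\<^sub>t q))))"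
      by (simp only: T2_id_T1_commute[symmetric] id_T1_pure)
    finally show "id_T1 (tensor_lift ?f (m \<otimes>\<^sub>t n) \<otimes>\<^sub>t q) =
        tensor_lift (\<lambda>m n. last_legs n (T2_id (tensor_assoc' (rmult m a \<otimes>\<^sub>t T1 (p \<otimes>\<^sub>t q))))) (m \<otimes>\<^sub>t n)"
      by (simp add: tensor_lift_pure_tensor clin clinear_lmult clinear_T2)
  qed (intro clin clinear_lmult clinear_T1 clinear_T2)+
  then show "id_T1 (T2_id (tensor_assoc' (a \<otimes>\<^sub>t tensor_map (lmult x) (\<lambda>y. y) (p \<otimes>\<^sub>t q)))) =
    tensor_lift (\<lambda>m n. last_legs n (T2_id (tensor_assoc' (rmult m a \<otimes>\<^sub>t T1 (p \<otimes>\<^sub>t q))))) t"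
    by (simp add: tensor_map_pure clin clinear_lmult tensor_assoc'_pure clinear_T2 T2_lmult[OF assms])
qed (rule clinear_tensor_lift_param | intro clin clinear_lmult clinear_T1 clinear_T2)+

lemma last_legs_right_legs: "last_legs n (right_legs r r' z) = right_legs r r' (last_legs n z)"
proof (rule tensor3_eqI[where t = z])
  fix x y c
  have "tensor_map (\<lambda>x. x * r') (\<lambda>x. x) (lmult m s) = lmult m (tensor_map (\<lambda>x. x * r') (\<lambda>x. x) s)"
    for m and s :: "('a, 'a) tensor"
    by (rule to_multiplier2_eqD)
       (simp add: to_multiplier_tensor_map mult_to_multiplier(1)[OF nondegenerate_tensor, symmetric] mult.assoc)
  moreover have "right_legs r r' (tensor_assoc' (x \<otimes>\<^sub>t v)) =
      tensor_assoc' ((x * r) \<otimes>\<^sub>t tensor_map (\<lambda>x. x * r') (\<lambda>x. x) v)" for v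
    by (rule tensor_eqI[where t = v])
       (intro clin | simp add: tensor_assoc'_pure tensor_map_pure clin)+
  ultimately show "last_legs n (right_legs r r' ((x \<otimes>\<^sub>t y) \<otimes>\<^sub>t c)) =
      right_legs r r' (last_legs n ((x \<otimes>\<^sub>t y) \<otimes>\<^sub>t c))"
    by (simp add: tensor_map_pure tensor_assoc_pure clin clinear_lmult)
qed (intro clin clinear_lmult)+

text \<open>The left leg m meets a and gives a m, while n acts through \<delta>(n) on the last two
  factors: the shape that \<open>last_legs_T2_id\<close> produces.\<close>

lemma left_leg_lmult:
  "left_leg a (tensor_assoc' (lmult (multiplier_tensor (tensor_map (\<lambda>x. x) \<delta>\<^sub>M t)) (tensor_assoc z))) =
    tensor_lift (\<lambda>m n. last_legs n (left_leg (rmult m a) z)) t"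
proof (rule tensor_eqI[where t = t])
  fix m n
  have bil: "cbilinear (\<lambda>m n. last_legs n (left_leg (rmult m a) z))"
    by (intro clin clinear_lmult)
  have *: "left_leg a (tensor_assoc' (x \<otimes>\<^sub>t v)) = tensor_assoc' ((a * x) \<otimes>\<^sub>t v)" for x v
    by (rule tensor_eqI[where t = v]) (intro clin | simp add: tensor_assoc'_pure tensor_map_pure clin)+
  show "left_leg a (tensor_assoc' (lmult (multiplier_tensor (tensor_map (\<lambda>x. x) \<delta>\<^sub>M (m \<otimes>\<^sub>t n))) (tensor_assoc z))) =
    tensor_lift (\<lambda>m n. last_legs n (left_leg (rmult m a) z)) (m \<otimes>\<^sub>t n)"
    unfolding tensor_lift_pure_tensor[OF bil]
    by (rule tensor3_eqI[where t = z])
       (intro clin clinear_lmult | simp add: tensor_map_pure clin multiplier_tensor_pure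
          lmult_multiplier_times clinear_lmult tensor_assoc_pure * rmult_lmult)+
qed (intro clin clinear_lmult)+

text \<open>Both sides are compared on \<delta>(p)(r \<otimes> r') \<otimes> c, which span, after
  multiplication by a \<otimes> 1 \<otimes> 1, which separates. There the left side is T2 \<otimes>
  id applied to a \<otimes> \<delta>(x) T1(u), up to right factors, and \<delta>(x) T1(u) = T1((x
  \<otimes> 1) u).\<close>

lemma coassociativity:
  assumes t: "multiplier_tensor t = \<delta>\<^sub>M x"
  shows "lmult (multiplier_tensor (tensor_map \<delta>\<^sub>M (\<lambda>y. y) t)) z =
    tensor_assoc' (lmult (multiplier_tensor (tensor_map (\<lambda>x. x) \<delta>\<^sub>M t)) (tensor_assoc z))"
    (is "?X z = ?Y z")
proof -
  have lin: "clinear ?X" "clinear ?Y" by (intro clin clinear_lmult)+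
  have pure: "?X (lmult (\<delta> p) (r \<otimes>\<^sub>t r') \<otimes>\<^sub>t c) = ?Y (lmult (\<delta> p) (r \<otimes>\<^sub>t r') \<otimes>\<^sub>t c)" for p r r' c
  proof (rule left_leg_separates)
    fix a
    \<comment> \<open>Writing p \<otimes> c as T1(u) is what brings id \<otimes> T1 into
      play.\<close>
    define u where "u = T1i (p \<otimes>\<^sub>t c)"
    have w: "lmult (\<delta> p) (r \<otimes>\<^sub>t r') \<otimes>\<^sub>t c = comult_left (r \<otimes>\<^sub>t r') (T1 u)"
      by (simp add: u_def tensor_lift_pure_tensor clin)
    have "left_leg a (?X (comult_left (r \<otimes>\<^sub>t r') (T1 u))) =
        right_legs r r' (T2_id (tensor_assoc' (a \<otimes>\<^sub>t lmult (\<delta>\<^sub>M x) (T1 u))))"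
      by (simp add: lmult_comult_left left_leg_comult_left t)
    also have "\<dots> = right_legs r r' (id_T1 (T2_id (tensor_assoc' (a \<otimes>\<^sub>t tensor_map (lmult x) (\<lambda>y. y) u))))"
      by (simp only: T2_id_T1_commute[symmetric] id_T1_pure T1_lmult)
    also have "\<dots> = right_legs r r'
        (tensor_lift (\<lambda>m n. last_legs n (T2_id (tensor_assoc' (rmult m a \<otimes>\<^sub>t T1 u)))) t)"
      by (simp only: last_legs_T2_id[OF t])
    also have "\<dots> = tensor_lift (\<lambda>m n. right_legs r r'
        (last_legs n (T2_id (tensor_assoc' (rmult m a \<otimes>\<^sub>t T1 u))))) t"
      by (rule clinear_tensor_lift_comp) (intro clin clinear_tensor_map clinear_lmult clinear_T2)+
    also have "\<dots> = tensor_lift (\<lambda>m n. last_legs n (left_leg (rmult m a) (comult_left (r \<otimes>\<^sub>t r') (T1 u)))) t"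
      by (simp only: last_legs_right_legs[symmetric] left_leg_comult_left)
    also have "\<dots> = left_leg a (?Y (comult_left (r \<otimes>\<^sub>t r') (T1 u)))"
      by (simp only: left_leg_lmult)
    finally show "left_leg a (?X (lmult (\<delta> p) (r \<otimes>\<^sub>t r') \<otimes>\<^sub>t c)) =
        left_leg a (?Y (lmult (\<delta> p) (r \<otimes>\<^sub>t r') \<otimes>\<^sub>t c))"
      by (simp only: w)
  qed
  have gen: "?X (lmult (\<delta> p) s \<otimes>\<^sub>t c) = ?Y (lmult (\<delta> p) s \<otimes>\<^sub>t c)" for p s c
    by (rule tensor_eqI[of "\<lambda>s. ?X (lmult (\<delta> p) s \<otimes>\<^sub>t c)"]) (intro clin clinear_lmult | rule pure)+
  have "?X (s \<otimes>\<^sub>t c) = ?Y (s \<otimes>\<^sub>t c)" for s c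
  proof (rule clinear_eq_on_span[of "\<lambda>s. ?X (s \<otimes>\<^sub>t c)" "\<lambda>s. ?Y (s \<otimes>\<^sub>t c)" "{lmult (\<delta> a) b | a b. True}"])
    show "s \<in> complex_vector.span {lmult (\<delta> a) b | a b. True}"
      using nondegenerate_comult by (simp add: nondegenerate_map_def)
    show "?X (y \<otimes>\<^sub>t c) = ?Y (y \<otimes>\<^sub>t c)" if "y \<in> {lmult (\<delta> a) b | a b. True}" for y
      using that gen by auto
  qed (intro clin)+
  then show ?thesis by (rule tensor_eqI[OF lin])
qed


section \<open>Slices of the comultiplication\<close>

text \<open>\<open>S m\<close> is (id \<otimes> f(b . c))(m). Covering f by b and c lets m act on
  elements of A \<otimes> A; the right action sends q' to (id \<otimes> f(. c))((q' \<otimes> b)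
  m).\<close>

lemma slice_right_multiplier_exists:
  assumes f: "clinear f"
  shows "\<exists>S. clinear S \<and>
    (\<forall>m q. lmult (S m) q = slice_right (\<lambda>y. f (b * y)) (lmult m (q \<otimes>\<^sub>t (c :: 'a)) :: ('a, 'a) tensor))"
proof -
  note [clin] = clinear_compose[OF f]
  have "\<exists>n. lmult n = (\<lambda>q. slice_right (\<lambda>y. f (b * y)) (lmult m ((q::'a) \<otimes>\<^sub>t c)))" for m :: "('a, 'a) tensor multiplier"
  proof (rule multiplier_exists_lmult)
    fix q q'
    have "slice_right (\<lambda>y. f (y * c)) s * q = slice_right f (s * (q \<otimes>\<^sub>t c))" for s :: "('a, 'a) tensor"
      by (rule tensor_eqI[where t = s])
         (intro clin f | simp add: slice_pure clin f tensor_mult_pure scaleC_mult_left)+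
    moreover have "q' * slice_right (\<lambda>y. f (b * y)) s = slice_right f ((q' \<otimes>\<^sub>t b) * s)" for s :: "('a, 'a) tensor"
      by (rule tensor_eqI[where t = s])
         (intro clin f | simp add: slice_pure clin f tensor_mult_pure scaleC_mult_right)+
    ultimately show "slice_right (\<lambda>y. f (y * c)) (rmult m (q' \<otimes>\<^sub>t b)) * q =
        q' * slice_right (\<lambda>y. f (b * y)) (lmult m ((q::'a) \<otimes>\<^sub>t c))"
      by (simp add: rmult_lmult)
  qed (intro clin)+
  then have "\<forall>m. \<exists>n. lmult n = (\<lambda>q. slice_right (\<lambda>y. f (b * y)) (lmult m ((q::'a) \<otimes>\<^sub>t c)))" by (rule allI)
  from choice[OF this] obtain S where "\<forall>m. lmult (S m) = (\<lambda>q. slice_right (\<lambda>y. f (b * y)) (lmult m ((q::'a) \<otimes>\<^sub>t c)))" by (rule exE)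
  then have S: "\<And>m. lmult (S m) = (\<lambda>q. slice_right (\<lambda>y. f (b * y)) (lmult m ((q::'a) \<otimes>\<^sub>t c)))" by (rule spec)
  have 1: "clinear (slice_right (\<lambda>y. f (b * y)) :: ('a, 'a) tensor \<Rightarrow> 'a)" by (intro clin)
  have "clinear S"
    by (rule clinearI; rule multiplier_eqI_lmult[OF nondegenerate]) (simp_all add: S clinear_add[OF 1] clinear_scaleC[OF 1])
  with S show ?thesis by auto
qed

lemma slice_left_multiplier_exists:
  assumes f: "clinear f"
  shows "\<exists>S. clinear S \<and>
    (\<forall>m q. lmult (S m) q = slice_left (\<lambda>y. f (b * y)) (lmult m ((c :: 'a) \<otimes>\<^sub>t q) :: ('a, 'a) tensor))"
proof -
  note [clin] = clinear_compose[OF f]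
  have "\<exists>n. lmult n = (\<lambda>q. slice_left (\<lambda>y. f (b * y)) (lmult m (c \<otimes>\<^sub>t (q::'a))))" for m :: "('a, 'a) tensor multiplier"
  proof (rule multiplier_exists_lmult)
    fix q q'
    have "slice_left (\<lambda>y. f (y * c)) s * q = slice_left f (s * (c \<otimes>\<^sub>t q))" for s :: "('a, 'a) tensor"
      by (rule tensor_eqI[where t = s])
         (intro clin f | simp add: slice_pure clin f tensor_mult_pure scaleC_mult_left)+
    moreover have "q' * slice_left (\<lambda>y. f (b * y)) s = slice_left f ((b \<otimes>\<^sub>t q') * s)" for s :: "('a, 'a) tensor"
      by (rule tensor_eqI[where t = s])
         (intro clin f | simp add: slice_pure clin f tensor_mult_pure scaleC_mult_right)+
    ultimately show "slice_left (\<lambda>y. f (y * c)) (rmult m (b \<otimes>\<^sub>t q')) * q =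
        q' * slice_left (\<lambda>y. f (b * y)) (lmult m (c \<otimes>\<^sub>t (q::'a)))"
      by (simp add: rmult_lmult)
  qed (intro clin)+
  then have "\<forall>m. \<exists>n. lmult n = (\<lambda>q. slice_left (\<lambda>y. f (b * y)) (lmult m (c \<otimes>\<^sub>t (q::'a))))" by (rule allI)
  from choice[OF this] obtain S where "\<forall>m. lmult (S m) = (\<lambda>q. slice_left (\<lambda>y. f (b * y)) (lmult m (c \<otimes>\<^sub>t (q::'a))))" by (rule exE)
  then have S: "\<And>m. lmult (S m) = (\<lambda>q. slice_left (\<lambda>y. f (b * y)) (lmult m (c \<otimes>\<^sub>t (q::'a))))" by (rule spec)
  have 1: "clinear (slice_left (\<lambda>y. f (b * y)) :: ('a, 'a) tensor \<Rightarrow> 'a)" by (intro clin)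
  have "clinear S"
    by (rule clinearI; rule multiplier_eqI_lmult[OF nondegenerate]) (simp_all add: S clinear_add[OF 1] clinear_scaleC[OF 1])
  with S show ?thesis by auto
qed

text \<open>With \<delta>(x) = \<Sum> m \<otimes> n, coassociativity turns \<delta> of the slice
  into \<Sum> m \<otimes> (id \<otimes> f(b . c))(\<delta>(n)), whose legs are multipliers of
  A.\<close>

lemma slice_right_in_AP:
  assumes t: "multiplier_tensor t = \<delta>\<^sub>M x" and f: "clinear f"
  shows "slice_right (\<lambda>n. f (b * lmult n c)) t \<in> AP \<delta>"
proof -
  note [clin] = clinear_compose[OF f]
  from slice_right_multiplier_exists[OF f, of b c] obtain S where "clinear S \<and>
    (\<forall>m q. lmult (S m) q = slice_right (\<lambda>y. f (b * y)) (lmult m ((q::'a) \<otimes>\<^sub>t c)))" by (rule exE)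
  then have S: "clinear S" "\<And>m q. lmult (S m) q = slice_right (\<lambda>y. f (b * y)) (lmult m ((q::'a) \<otimes>\<^sub>t c))"
    by simp_all
  note [clin] = S(1) clinear_compose[OF S(1)]
  have 1: "lmult (\<delta>\<^sub>M (slice_right (\<lambda>n. f (b * lmult n c)) t)) s =
      slice_right (\<lambda>y. f (b * y)) (lmult (multiplier_tensor (tensor_map \<delta>\<^sub>M (\<lambda>y. y) t)) (s \<otimes>\<^sub>t c))" for s
    by (rule tensor_eqI[where t = t])
       (intro clin | simp add: slice_pure clin tensor_map_pure multiplier_tensor_pure lmult_multiplier_times
          clinear_lmult clinear_scaleC[OF clinear_\<delta>\<^sub>M])+
  have 2: "lmult (multiplier_tensor (tensor_map (\<lambda>x. x) (\<lambda>n. S (\<delta>\<^sub>M n)) t)) (p \<otimes>\<^sub>t q) =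
      slice_right (\<lambda>y. f (b * y))
        (tensor_assoc' (lmult (multiplier_tensor (tensor_map (\<lambda>x. x) \<delta>\<^sub>M t)) (p \<otimes>\<^sub>t (q \<otimes>\<^sub>t c))))" for p q
  proof (rule tensor_eqI[where t = t])
    fix m n
    have "slice_right (\<lambda>y. f (b * y)) (tensor_assoc' (a \<otimes>\<^sub>t v)) = a \<otimes>\<^sub>t slice_right (\<lambda>y. f (b * y)) v"
      for a :: 'a and v :: "('a, 'a) tensor"
      by (rule tensor_eqI[where t = v])
         (intro clin | simp add: slice_pure clin tensor_assoc'_pure pure_tensor_linear)+
    then show "lmult (multiplier_tensor (tensor_map (\<lambda>x. x) (\<lambda>n. S (\<delta>\<^sub>M n)) (m \<otimes>\<^sub>t n))) (p \<otimes>\<^sub>t q) =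
      slice_right (\<lambda>y. f (b * y))
        (tensor_assoc' (lmult (multiplier_tensor (tensor_map (\<lambda>x. x) \<delta>\<^sub>M (m \<otimes>\<^sub>t n))) (p \<otimes>\<^sub>t (q \<otimes>\<^sub>t c))))"
      by (simp add: clin tensor_map_pure multiplier_tensor_pure lmult_multiplier_times clinear_lmult S(2))
  qed (intro clin)+
  have "\<delta>\<^sub>M (slice_right (\<lambda>n. f (b * lmult n c)) t) =
      multiplier_tensor (tensor_map (\<lambda>x. x) (\<lambda>n. S (\<delta>\<^sub>M n)) t)"
  proof (rule multiplier_eqI_lmult[OF nondegenerate_tensor])
    show "lmult (\<delta>\<^sub>M (slice_right (\<lambda>n. f (b * lmult n c)) t)) s =
        lmult (multiplier_tensor (tensor_map (\<lambda>x. x) (\<lambda>n. S (\<delta>\<^sub>M n)) t)) s" for s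
      by (rule tensor_eqI[where t = s])
         (intro clin clinear_lmult | simp add: 1 2 coassociativity[OF t] tensor_assoc_pure)+
  qed
  then show ?thesis by (simp add: AP_def)
qed

lemma slice_left_in_AP:
  assumes t: "multiplier_tensor t = \<delta>\<^sub>M x" and f: "clinear f"
  shows "slice_left (\<lambda>n. f (b * lmult n c)) t \<in> AP \<delta>"
proof -
  note [clin] = clinear_compose[OF f]
  from slice_left_multiplier_exists[OF f, of b c] obtain S where "clinear S \<and>
    (\<forall>m q. lmult (S m) q = slice_left (\<lambda>y. f (b * y)) (lmult m (c \<otimes>\<^sub>t (q::'a))))" by (rule exE)
  then have S: "clinear S" "\<And>m q. lmult (S m) q = slice_left (\<lambda>y. f (b * y)) (lmult m (c \<otimes>\<^sub>t (q::'a)))"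
    by simp_all
  note [clin] = S(1) clinear_compose[OF S(1)]
  have 1: "lmult (\<delta>\<^sub>M (slice_left (\<lambda>n. f (b * lmult n c)) t)) s =
      slice_left (\<lambda>y. f (b * y)) (lmult (multiplier_tensor (tensor_map (\<lambda>y. y) \<delta>\<^sub>M t)) (c \<otimes>\<^sub>t s))" for s
    by (rule tensor_eqI[where t = t])
       (intro clin | simp add: slice_pure clin tensor_map_pure multiplier_tensor_pure lmult_multiplier_times
          clinear_lmult clinear_scaleC[OF clinear_\<delta>\<^sub>M])+
  have 2: "lmult (multiplier_tensor (tensor_map (\<lambda>n. S (\<delta>\<^sub>M n)) (\<lambda>x. x) t)) (p \<otimes>\<^sub>t q) =
      slice_left (\<lambda>y. f (b * y))
        (tensor_assoc (lmult (multiplier_tensor (tensor_map \<delta>\<^sub>M (\<lambda>x. x) t)) ((c \<otimes>\<^sub>t p) \<otimes>\<^sub>t q)))" for p q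
  proof (rule tensor_eqI[where t = t])
    fix m n
    have "slice_left (\<lambda>y. f (b * y)) (tensor_assoc (v \<otimes>\<^sub>t a)) = slice_left (\<lambda>y. f (b * y)) v \<otimes>\<^sub>t a"
      for a :: 'a and v :: "('a, 'a) tensor"
      by (rule tensor_eqI[where t = v])
         (intro clin | simp add: slice_pure clin tensor_assoc_pure pure_tensor_linear)+
    then show "lmult (multiplier_tensor (tensor_map (\<lambda>n. S (\<delta>\<^sub>M n)) (\<lambda>x. x) (m \<otimes>\<^sub>t n))) (p \<otimes>\<^sub>t q) =
      slice_left (\<lambda>y. f (b * y))
        (tensor_assoc (lmult (multiplier_tensor (tensor_map \<delta>\<^sub>M (\<lambda>x. x) (m \<otimes>\<^sub>t n))) ((c \<otimes>\<^sub>t p) \<otimes>\<^sub>t q)))"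
      by (simp add: clin tensor_map_pure multiplier_tensor_pure lmult_multiplier_times clinear_lmult S(2))
  qed (intro clin)+
  have "\<delta>\<^sub>M (slice_left (\<lambda>n. f (b * lmult n c)) t) =
      multiplier_tensor (tensor_map (\<lambda>n. S (\<delta>\<^sub>M n)) (\<lambda>x. x) t)"
  proof (rule multiplier_eqI_lmult[OF nondegenerate_tensor])
    show "lmult (\<delta>\<^sub>M (slice_left (\<lambda>n. f (b * lmult n c)) t)) s =
        lmult (multiplier_tensor (tensor_map (\<lambda>n. S (\<delta>\<^sub>M n)) (\<lambda>x. x) t)) s" for s
      by (rule tensor_eqI[where t = s])
         (intro clin clinear_lmult | simp add: 1 2 coassociativity[OF t] tensor_assoc_pure tensor_assoc_assoc')+
  qed
  then show ?thesis by (simp add: AP_def)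
qed


section \<open>The Hopf *-algebra \<open>AP\<close>\<close>

abbreviation \<Delta> :: "'a multiplier \<Rightarrow> ('a multiplier, 'a multiplier) tensor" where "\<Delta> \<equiv> AP_comult \<delta>"

lemma multiplier_tensor_AP_comult: "x \<in> AP \<delta> \<Longrightarrow> multiplier_tensor (\<Delta> x) = \<delta>\<^sub>M x"
  by (simp add: AP_def AP_comult_def f_inv_into_f)

lemma AP_I: "multiplier_tensor t = \<delta>\<^sub>M x \<Longrightarrow> x \<in> AP \<delta>"
  unfolding AP_def by (metis mem_Collect_eq rangeI)

lemma AP_comult_eq: "multiplier_tensor t = \<delta>\<^sub>M x \<Longrightarrow> \<Delta> x = t"
  unfolding AP_comult_def by (rule inv_into_f_eq[OF inj_multiplier_tensor[OF nondegenerate nondegenerate]]) auto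

lemma AP_add: "multiplier_tensor (\<Delta> x + \<Delta> y) = \<delta>\<^sub>M (x + y)"
  and AP_mult: "multiplier_tensor (\<Delta> x * \<Delta> y) = \<delta>\<^sub>M (x * y)"
  and AP_scaleC: "multiplier_tensor (c *\<^sub>C \<Delta> x) = \<delta>\<^sub>M (c *\<^sub>C x)"
  if "x \<in> AP \<delta>" "y \<in> AP \<delta>"
  using that
  by (simp_all add: clinear_add[OF clinear_multiplier_tensor] clinear_scaleC[OF clinear_multiplier_tensor]
      multiplier_tensor_AP_comult clinear_add[OF clinear_\<delta>\<^sub>M] clinear_scaleC[OF clinear_\<delta>\<^sub>M]
      multiplier_tensor_mult \<delta>\<^sub>M_mult)

lemma AP_one: "multiplier_tensor 1 = \<delta>\<^sub>M 1"
  by (simp add: multiplier_tensor_one \<delta>\<^sub>M_one)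

lemma subspace_AP: "complex_vector.subspace (AP \<delta>)"
proof (rule complex_vector.subspaceI)
  show "0 \<in> AP \<delta>"
    by (rule AP_I[of 0]) (simp add: clinear_0[OF clinear_multiplier_tensor] clinear_0[OF clinear_\<delta>\<^sub>M])
qed (blast intro: AP_I AP_add AP_scaleC)+

lemma clinear_on_AP_comult: "clinear_on (AP \<delta>) \<Delta>"
  unfolding clinear_on_def by (blast intro: AP_comult_eq AP_add AP_scaleC)

text \<open>An arbitrary linear projection onto \<open>AP\<close>, used to make the comultiplication
  total and to detect membership in \<open>tensor_span\<close>.\<close>

definition AP_proj :: "'a multiplier \<Rightarrow> 'a multiplier"
  where "AP_proj = (SOME P. clinear P \<and> (\<forall>x. P x \<in> AP \<delta>) \<and> (\<forall>x\<in>AP \<delta>. P x = x))"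

lemma AP_proj: "clinear AP_proj" "AP_proj x \<in> AP \<delta>" "x \<in> AP \<delta> \<Longrightarrow> AP_proj x = x"
proof -
  have "\<exists>P. clinear P \<and> (\<forall>x. P x \<in> AP \<delta>) \<and> (\<forall>x\<in>AP \<delta>. P x = x)"
    using exists_projection[OF subspace_AP] by metis
  from someI_ex[OF this] show "clinear AP_proj" "AP_proj x \<in> AP \<delta>" "x \<in> AP \<delta> \<Longrightarrow> AP_proj x = x"
    unfolding AP_proj_def by blast+
qed

text \<open>A linear extension of \<open>\<Delta>\<close> to all of \<open>M(A)\<close>, which makes the maps \<open>\<Delta> \<otimes> id\<close> and \<open>id \<otimes> \<Delta>\<close> total.\<close>

definition \<Delta>\<^sub>P :: "'a multiplier \<Rightarrow> ('a multiplier, 'a multiplier) tensor" where "\<Delta>\<^sub>P x = \<Delta> (AP_proj x)"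

lemma \<Delta>\<^sub>P_AP: "x \<in> AP \<delta> \<Longrightarrow> \<Delta>\<^sub>P x = \<Delta> x"
  by (simp add: \<Delta>\<^sub>P_def AP_proj(3))

lemma clinear_\<Delta>\<^sub>P: "clinear \<Delta>\<^sub>P"
  using clinear_on_AP_comult AP_proj(2)
  by (intro clinearI)
     (simp_all add: \<Delta>\<^sub>P_def clinear_on_def clinear_add[OF AP_proj(1)] clinear_scaleC[OF AP_proj(1)])

lemmas [clin] = clinear_\<Delta>\<^sub>P clinear_compose[OF clinear_\<Delta>\<^sub>P]

text \<open>The covered functionals n \<mapsto> f(b n c) are the ones whose slices are known to lie
  in \<open>AP\<close>; that they separate M(A) makes them sufficient.\<close>

lemma multiplier_slices_separate:
  assumes "\<And>f b c. clinear f \<Longrightarrow> f (b * lmult n c) = (0::complex)"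
  shows "n = (0 :: 'a multiplier)"
proof (rule multiplier_eqI_lmult[OF nondegenerate], rule nondeg_right[OF nondegenerate])
  fix c b
  show "b * lmult n c = b * lmult 0 c"
    by (simp, rule functionals_separate) (rule assms)
qed

text \<open>Let Q be the identity minus the projection onto \<open>AP\<close>. The covered slices of
  \<Delta>(x) lie in \<open>AP\<close>, so every such slice of (id \<otimes> Q)(\<Delta>(x)) and of
  (Q \<otimes> id)(\<Delta>(x)) is zero.\<close>

lemma AP_comult_in_tensor_span:
  assumes x: "x \<in> AP \<delta>"
  shows "\<Delta> x \<in> tensor_span (AP \<delta>) (AP \<delta>)"
proof -
  define \<Omega> :: "('a multiplier \<Rightarrow> complex) set"
    where "\<Omega> = {\<lambda>n. f (b * lmult n c) | f b c. clinear f}"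
  let ?Q = "\<lambda>x. x - AP_proj x"
  note [clin] = AP_proj(1)
  have lin: "clinear g" if "g \<in> \<Omega>" for g
  proof -
    from that obtain f b c where "g = (\<lambda>n. f (b * lmult n c))" "clinear f" unfolding \<Omega>_def by blast
    then show ?thesis by (simp add: clinear_compose[of f] clin)
  qed
  have sep: "n = 0" if "\<And>g. g \<in> \<Omega> \<Longrightarrow> g n = 0" for n
  proof (rule multiplier_slices_separate)
    fix f :: "'a \<Rightarrow> complex" and b c assume "clinear f"
    then have "(\<lambda>n. f (b * lmult n c)) \<in> \<Omega>" unfolding \<Omega>_def by blast
    then show "f (b * lmult n c) = 0" by (rule that)
  qed
  have "tensor_map (\<lambda>x. x) ?Q (\<Delta> x) = 0"
  proof (rule slice_left_separates_on[of \<Omega>, OF lin sep])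
    fix g assume g: "g \<in> \<Omega>"
    then have "slice_left g (\<Delta> x) \<in> AP \<delta>"
      using slice_left_in_AP[OF multiplier_tensor_AP_comult[OF x]] unfolding \<Omega>_def by auto
    then show "slice_left g (tensor_map (\<lambda>x. x) ?Q (\<Delta> x)) = 0"
      by (subst slice_left_tensor_map) (simp_all add: lin g clin AP_proj(3))
  qed
  have "tensor_map ?Q (\<lambda>x. x) (\<Delta> x) = 0"
  proof (rule slice_right_separates[of \<Omega>, OF lin sep])
    fix g assume g: "g \<in> \<Omega>"
    then have "slice_right g (\<Delta> x) \<in> AP \<delta>"
      using slice_right_in_AP[OF multiplier_tensor_AP_comult[OF x]] unfolding \<Omega>_def by auto
    then show "slice_right g (tensor_map ?Q (\<lambda>x. x) (\<Delta> x)) = 0"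
      by (subst slice_right_tensor_map) (simp_all add: lin g clin AP_proj(3))
  qed
  \<comment> \<open>With P the projection: id = P \<otimes> P + id \<otimes> Q + (id \<otimes> P)(Q
    \<otimes> id). On \<Delta>(x) only the first term survives.\<close>
  have "t = tensor_map AP_proj AP_proj t + tensor_map (\<lambda>x. x) ?Q t +
      tensor_map (\<lambda>x. x) AP_proj (tensor_map ?Q (\<lambda>x. x) t)" for t
    by (rule tensor_eqI[where t = t])
       (intro clin | simp add: tensor_map_pure clin clinear_diff[OF clinear_pure_left[OF clinear_ident]]
          clinear_diff[OF clinear_pure_right[OF clinear_ident]]
          clinear_diff[OF clinear_tensor_map[OF clinear_ident AP_proj(1)]])+
  from this[of "\<Delta> x"] have "\<Delta> x = tensor_map AP_proj AP_proj (\<Delta> x)"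
    by (simp add: \<open>tensor_map (\<lambda>x. x) ?Q (\<Delta> x) = 0\<close> \<open>tensor_map ?Q (\<lambda>x. x) (\<Delta> x) = 0\<close>
        clinear_0[OF clinear_tensor_map[OF clinear_ident AP_proj(1)]])
  moreover have "tensor_map AP_proj AP_proj (\<Delta> x) \<in> tensor_span (AP \<delta>) (AP \<delta>)"
    by (rule tensor_map_in_tensor_span[OF AP_proj(1) AP_proj(1) AP_proj(2) AP_proj(2)])
  ultimately show ?thesis by simp
qed

lemma tensor_lift_on_AP:
  assumes "x \<in> AP \<delta>" "cbilinear f" "\<And>a b. a \<in> AP \<delta> \<Longrightarrow> b \<in> AP \<delta> \<Longrightarrow> g a b = f a b"
  shows "tensor_lift_on (AP \<delta>) (AP \<delta>) g (\<Delta> x) = tensor_lift f (\<Delta> x)"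
  by (rule tensor_lift_on_eq[OF subspace_AP AP_comult_in_tensor_span]) (use assms in auto)

lemma tensor_lift_cong_AP:
  assumes "x \<in> AP \<delta>" "cbilinear f" "cbilinear g" "\<And>a b. a \<in> AP \<delta> \<Longrightarrow> b \<in> AP \<delta> \<Longrightarrow> f a b = g a b"
  shows "tensor_lift f (\<Delta> x) = tensor_lift g (\<Delta> x)"
  by (rule tensor_lift_cong_tensor_span[OF subspace_AP AP_comult_in_tensor_span]) (use assms in auto)

text \<open>\<open>coassociativity\<close> identifies the two sides as multipliers of A \<otimes> (A
  \<otimes> A). The identity is pulled back along two injections: M(A) \<otimes> (M(A) \<otimes>
  M(A)) into M(A) \<otimes> M(A \<otimes> A), and the latter into M(A \<otimes> (A \<otimes>
  A)).\<close>

lemma AP_coassoc: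
  assumes x: "x \<in> AP \<delta>"
  shows "tensor_assoc (tensor_map \<Delta>\<^sub>P (\<lambda>y. y) (\<Delta> x)) = tensor_map (\<lambda>y. y) \<Delta>\<^sub>P (\<Delta> x)" (is "?u = ?v")
proof -
  note lin = clinear_multiplier_tensor
  have D: "multiplier_tensor (\<Delta>\<^sub>P y) = \<delta>\<^sub>M y" if "y \<in> AP \<delta>" for y
    using that by (simp add: \<Delta>\<^sub>P_AP multiplier_tensor_AP_comult)
  have 1: "tensor_map multiplier_tensor (\<lambda>y. y) (tensor_map \<Delta>\<^sub>P (\<lambda>y. y) (\<Delta> x)) = tensor_map \<delta>\<^sub>M (\<lambda>y. y) (\<Delta> x)"
    by (subst tensor_map_tensor_map; (intro lin clin)?)
       (rule tensor_map_on_tensor_span[OF _ _ _ _ _ _ AP_comult_in_tensor_span[OF x]]; (intro clin)?; simp add: D)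
  have 2: "tensor_map (\<lambda>y. y) multiplier_tensor ?v = tensor_map (\<lambda>y. y) \<delta>\<^sub>M (\<Delta> x)"
    by (subst tensor_map_tensor_map; (intro lin clin)?)
       (rule tensor_map_on_tensor_span[OF _ _ _ _ _ _ AP_comult_in_tensor_span[OF x]]; (intro clin)?; simp add: D)
  have assoc: "lmult (multiplier_tensor (tensor_map (\<lambda>y. y) multiplier_tensor (tensor_assoc u))) (tensor_assoc z) =
      tensor_assoc (lmult (multiplier_tensor (tensor_map multiplier_tensor (\<lambda>y. y) u)) z)"
    for u :: "(('a multiplier, 'a multiplier) tensor, 'a multiplier) tensor" and z
  proof (rule tensor3_eqI[where t = u])
    show "lmult (multiplier_tensor (tensor_map (\<lambda>y. y) multiplier_tensor (tensor_assoc ((k \<otimes>\<^sub>t m) \<otimes>\<^sub>t n)))) (tensor_assoc z) =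
      tensor_assoc (lmult (multiplier_tensor (tensor_map multiplier_tensor (\<lambda>y. y) ((k \<otimes>\<^sub>t m) \<otimes>\<^sub>t n))) z)"
      for k m n :: "'a multiplier"
      by (rule tensor3_eqI[where t = z])
         (intro lin clin clinear_lmult | simp add: tensor_assoc_pure tensor_map_pure lin clin clinear_lmult
            multiplier_tensor_pure lmult_multiplier_times)+
  qed (intro lin clin)+
  have "multiplier_tensor (tensor_map (\<lambda>y. y) multiplier_tensor ?u) =
      multiplier_tensor (tensor_map (\<lambda>y. y) multiplier_tensor ?v)"
  proof (rule multiplier_eqI_lmult[OF nondeg_tensor[OF nondegenerate nondegenerate_tensor]])
    fix w
    show "lmult (multiplier_tensor (tensor_map (\<lambda>y. y) multiplier_tensor ?u)) w =
        lmult (multiplier_tensor (tensor_map (\<lambda>y. y) multiplier_tensor ?v)) w"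
      using assoc[of "tensor_map \<Delta>\<^sub>P (\<lambda>y. y) (\<Delta> x)" "tensor_assoc' w"]
        coassociativity[OF multiplier_tensor_AP_comult[OF x], of "tensor_assoc' w"]
      by (simp add: tensor_assoc_assoc' 1 2)
  qed
  then have "tensor_map (\<lambda>y. y) multiplier_tensor ?u = tensor_map (\<lambda>y. y) multiplier_tensor ?v"
    by (rule injD[OF inj_multiplier_tensor[OF nondegenerate nondegenerate_tensor]])
  then show ?thesis
    by (rule tensor_map_inj[OF clinear_ident inj_on_id2 lin inj_multiplier_tensor[OF nondegenerate nondegenerate]])
qed

text \<open>Makes Sweedler calculations available: \<Sum> h(x1, x2, x3) may be evaluated with either
  bracketing.\<close>

lemma AP_coassoc_sweedler:
  assumes x: "x \<in> AP \<delta>"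
    and h: "\<And>q r. clinear (\<lambda>p. h p q r)" "\<And>p r. clinear (\<lambda>q. h p q r)" "\<And>p q. clinear (\<lambda>r. h p q r)"
  shows "tensor_lift (\<lambda>u v. tensor_lift (\<lambda>p q. h p q v) (\<Delta>\<^sub>P u)) (\<Delta> x) =
    tensor_lift (\<lambda>u v. tensor_lift (\<lambda>p q. h u p q) (\<Delta>\<^sub>P v)) (\<Delta> x)"
proof -
  have bil: "cbilinear (\<lambda>p q. h p q v)" "cbilinear (\<lambda>p q. h v p q)" for v by (intro clin h)+
  have L: "cbilinear (\<lambda>s v. tensor_lift (\<lambda>p q. h p q v) s)"
    by (rule cbilinearI) (rule clinear_tensor_lift_param | intro clin h)+
  have R: "cbilinear (\<lambda>u s. tensor_lift (\<lambda>p q. h u p q) s)"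
    by (rule cbilinearI) (rule clinear_tensor_lift_param | intro clin h)+
  have "tensor_lift (\<lambda>u s. tensor_lift (\<lambda>p q. h u p q) s) (tensor_assoc z) =
      tensor_lift (\<lambda>s v. tensor_lift (\<lambda>p q. h p q v) s) z" for z
    by (rule tensor3_eqI[where t = z])
       (intro clinear_tensor_lift[OF L] clinear_tensor_lift[OF R] clin |
        simp add: tensor_assoc_pure tensor_lift_pure_tensor[OF L] tensor_lift_pure_tensor[OF R]
          tensor_lift_pure_tensor[OF bil(1)] tensor_lift_pure_tensor[OF bil(2)])+
  from this[of "tensor_map \<Delta>\<^sub>P (\<lambda>y. y) (\<Delta> x)"] show ?thesis
    unfolding AP_coassoc[OF x]
    by (simp add: tensor_lift_tensor_map[OF _ _ L] tensor_lift_tensor_map[OF _ _ R] clin)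
qed

text \<open>Applying \<epsilon> \<otimes> id to \<delta>(x) T1(a \<otimes> b) = T1(x a \<otimes> b)
  in two ways gives (\<epsilon> \<otimes> id)(t) a b = x a b, and products span the algebra.\<close>

lemma counit_left:
  assumes t: "multiplier_tensor t = \<delta>\<^sub>M x"
  shows "slice_left \<epsilon>\<^sub>M t = x"
proof (rule multiplier_eqI_lmult[OF nondegenerate])
  fix c
  have gen: "slice_left \<epsilon> (lmult (multiplier_tensor t) s) = lmult (slice_left \<epsilon>\<^sub>M t) (slice_left \<epsilon> s)" for s
  proof (rule tensor_eqI[where t = t])
    show "slice_left \<epsilon> (lmult (multiplier_tensor (m \<otimes>\<^sub>t n)) s) = lmult (slice_left \<epsilon>\<^sub>M (m \<otimes>\<^sub>t n)) (slice_left \<epsilon> s)" for m n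
      by (rule tensor_eqI[where t = s])
         (intro clin | simp add: slice_pure clin multiplier_tensor_pure lmult_multiplier_times tensor_map_pure
            clinear_lmult counit_lmult scaleC_scaleC clinear_scaleC[OF clinear_lmult] mult.commute)+
  qed (intro clin)+
  have "lmult (slice_left \<epsilon>\<^sub>M t) (a * b) = lmult x (a * b)" for a b
  proof -
    have "lmult (slice_left \<epsilon>\<^sub>M t) (a * b) = slice_left \<epsilon> (lmult (\<delta>\<^sub>M x) (T1 (a \<otimes>\<^sub>t b)))"
      by (simp add: t[symmetric] gen counit_T1 mult_map_pure)
    also have "\<dots> = lmult x (a * b)"
      by (simp add: T1_lmult[symmetric] counit_T1 tensor_map_pure clin clinear_lmult mult_map_pure lmult_mult_right[OF nondegenerate])
    finally show ?thesis .
  qed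
  then have "lmult (slice_left \<epsilon>\<^sub>M t) y = lmult x y" if "y \<in> {a * b | a b. True}" for y
    using that by blast
  then show "lmult (slice_left \<epsilon>\<^sub>M t) c = lmult x c"
    by (rule clinear_eq_on_span[OF clinear_lmult clinear_lmult]) (assumption, unfold span_products, simp)
qed

lemma counit_right:
  assumes t: "multiplier_tensor t = \<delta>\<^sub>M x"
  shows "slice_right \<epsilon>\<^sub>M t = x"
proof (rule multiplier_eqI_rmult[OF nondegenerate])
  fix c
  have gen: "slice_right \<epsilon> (rmult (multiplier_tensor t) s) = rmult (slice_right \<epsilon>\<^sub>M t) (slice_right \<epsilon> s)" for s
  proof (rule tensor_eqI[where t = t])
    show "slice_right \<epsilon> (rmult (multiplier_tensor (m \<otimes>\<^sub>t n)) s) = rmult (slice_right \<epsilon>\<^sub>M (m \<otimes>\<^sub>t n)) (slice_right \<epsilon> s)" for m n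
      by (rule tensor_eqI[where t = s])
         (intro clin | simp add: slice_pure clin multiplier_tensor_pure rmult_multiplier_times tensor_map_pure
            clinear_rmult counit_rmult scaleC_scaleC clinear_scaleC[OF clinear_rmult] mult.commute)+
  qed (intro clin)+
  have "rmult (slice_right \<epsilon>\<^sub>M t) (a * b) = rmult x (a * b)" for a b
  proof -
    have "rmult (slice_right \<epsilon>\<^sub>M t) (a * b) = slice_right \<epsilon> (rmult (\<delta>\<^sub>M x) (T2 (a \<otimes>\<^sub>t b)))"
      by (simp add: t[symmetric] gen counit_T2 mult_map_pure)
    also have "\<dots> = rmult x (a * b)"
      by (simp add: T2_rmult[symmetric] counit_T2 tensor_map_pure clin clinear_rmult mult_map_pure rmult_mult_left[OF nondegenerate])
    finally show ?thesis .
  qed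
  then have "rmult (slice_right \<epsilon>\<^sub>M t) y = rmult x y" if "y \<in> {a * b | a b. True}" for y
    using that by blast
  then show "rmult (slice_right \<epsilon>\<^sub>M t) c = rmult x c"
    by (rule clinear_eq_on_span[OF clinear_rmult clinear_rmult]) (assumption, unfold span_products, simp)
qed

section \<open>The coinverse laws and their images under linear maps\<close>

lemma bilinear_\<kappa>\<^sub>M [clin]:
  "cbilinear (\<lambda>m n. \<kappa>\<^sub>M m * n)" "cbilinear (\<lambda>m n. m * \<kappa>\<^sub>M n)"
  "cbilinear (\<lambda>p q. lmult (\<kappa>\<^sub>0 p) q)" "cbilinear (\<lambda>p q. rmult (\<kappa>\<^sub>0 q) p)"
  by (intro clin)+

text \<open>From \<kappa>(m p) n q = \<kappa>(p) \<kappa>(m) n q, the map p \<otimes> q \<mapsto>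
  \<kappa>(p) q applied to \<delta>(x) T1(s) inserts the unknown sum in the middle. But \<delta>(x)
  T1(s) = T1((x \<otimes> 1) s), where the antipode law yields \<epsilon>(x) (\<epsilon> \<otimes>
  id)(s). Nondegeneracy of \<kappa> cancels the outer factor.\<close>

lemma coinverse_left:
  assumes t: "multiplier_tensor t = \<delta>\<^sub>M x"
  shows "tensor_lift (\<lambda>m n. \<kappa>\<^sub>M m * n) t = \<epsilon>\<^sub>M x *\<^sub>C 1" (is "?Y t = _")
proof (rule nondegenerate_map_cancel_left[OF nondegenerate nondegenerate_\<kappa>\<^sub>0], rule multiplier_eqI_lmult[OF nondegenerate])
  fix p q
  have gen: "tensor_lift (\<lambda>p q. lmult (\<kappa>\<^sub>0 p) q) (lmult (multiplier_tensor t) s) =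
      tensor_lift (\<lambda>p q. lmult (\<kappa>\<^sub>0 p) (lmult (?Y t) q)) s" for s
  proof (rule tensor_eqI[where t = t])
    show "tensor_lift (\<lambda>p q. lmult (\<kappa>\<^sub>0 p) q) (lmult (multiplier_tensor (m \<otimes>\<^sub>t n)) s) =
        tensor_lift (\<lambda>p q. lmult (\<kappa>\<^sub>0 p) (lmult (?Y (m \<otimes>\<^sub>t n)) q)) s" for m n
      by (rule tensor_eqI[where t = s])
         (intro clin | simp add: tensor_lift_pure_tensor clin multiplier_tensor_pure lmult_multiplier_times
            tensor_map_pure clinear_lmult \<kappa>\<^sub>0_lmult)+
  qed (rule clinear_tensor_lift_param | intro clin)+
  have "tensor_lift (\<lambda>p q. lmult (\<kappa>\<^sub>0 p) (lmult (?Y t) q)) (T1 s) = \<epsilon>\<^sub>M x *\<^sub>C slice_left \<epsilon> s" for s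
  proof -
    have "tensor_lift (\<lambda>p q. lmult (\<kappa>\<^sub>0 p) (lmult (?Y t) q)) (T1 s) =
        tensor_lift (\<lambda>p q. lmult (\<kappa>\<^sub>0 p) q) (T1 (tensor_map (lmult x) (\<lambda>y. y) s))"
      by (simp only: gen[symmetric] t T1_lmult)
    also have "\<dots> = slice_left \<epsilon> (tensor_map (lmult x) (\<lambda>y. y) s)" by (simp add: \<kappa>\<^sub>0_T1)
    also have "\<dots> = \<epsilon>\<^sub>M x *\<^sub>C slice_left \<epsilon> s"
      by (rule tensor_eqI[where t = s])
         (intro clin clinear_lmult | simp add: slice_pure clin tensor_map_pure clinear_lmult counit_lmult scaleC_scaleC)+
    finally show ?thesis .
  qed
  from this[of "T1i (p \<otimes>\<^sub>t q)"]
  show "lmult (\<kappa>\<^sub>0 p * ?Y t) q = lmult (\<kappa>\<^sub>0 p * (\<epsilon>\<^sub>M x *\<^sub>C 1)) q"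
    by (simp add: tensor_lift_pure_tensor clin lmult_\<kappa>\<^sub>0[symmetric] clinear_scaleC[OF clinear_lmult])
qed

lemma coinverse_right:
  assumes t: "multiplier_tensor t = \<delta>\<^sub>M x"
  shows "tensor_lift (\<lambda>m n. m * \<kappa>\<^sub>M n) t = \<epsilon>\<^sub>M x *\<^sub>C 1" (is "?Y t = _")
proof (rule nondegenerate_map_cancel[OF nondegenerate nondegenerate_\<kappa>\<^sub>0], rule multiplier_eqI_rmult[OF nondegenerate])
  fix q p
  have gen: "tensor_lift (\<lambda>p q. rmult (\<kappa>\<^sub>0 q) p) (rmult (multiplier_tensor t) s) =
      tensor_lift (\<lambda>p q. rmult (\<kappa>\<^sub>0 q) (rmult (?Y t) p)) s" for s
  proof (rule tensor_eqI[where t = t])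
    show "tensor_lift (\<lambda>p q. rmult (\<kappa>\<^sub>0 q) p) (rmult (multiplier_tensor (m \<otimes>\<^sub>t n)) s) =
        tensor_lift (\<lambda>p q. rmult (\<kappa>\<^sub>0 q) (rmult (?Y (m \<otimes>\<^sub>t n)) p)) s" for m n
      by (rule tensor_eqI[where t = s])
         (intro clin | simp add: tensor_lift_pure_tensor clin multiplier_tensor_pure rmult_multiplier_times
            tensor_map_pure clinear_rmult \<kappa>\<^sub>0_rmult)+
  qed (rule clinear_tensor_lift_param | intro clin)+
  have "tensor_lift (\<lambda>p q. rmult (\<kappa>\<^sub>0 q) (rmult (?Y t) p)) (T2 s) = \<epsilon>\<^sub>M x *\<^sub>C slice_right \<epsilon> s" for s
  proof -
    have "tensor_lift (\<lambda>p q. rmult (\<kappa>\<^sub>0 q) (rmult (?Y t) p)) (T2 s) =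
        tensor_lift (\<lambda>p q. rmult (\<kappa>\<^sub>0 q) p) (T2 (tensor_map (\<lambda>y. y) (rmult x) s))"
      by (simp only: gen[symmetric] t T2_rmult)
    also have "\<dots> = slice_right \<epsilon> (tensor_map (\<lambda>y. y) (rmult x) s)" by (simp add: \<kappa>\<^sub>0_T2)
    also have "\<dots> = \<epsilon>\<^sub>M x *\<^sub>C slice_right \<epsilon> s"
      by (rule tensor_eqI[where t = s])
         (intro clin clinear_rmult | simp add: slice_pure clin tensor_map_pure clinear_rmult counit_rmult
            scaleC_scaleC mult.commute)+
    finally show ?thesis .
  qed
  from this[of "T2i (p \<otimes>\<^sub>t q)"]
  show "rmult (?Y t * \<kappa>\<^sub>0 q) p = rmult ((\<epsilon>\<^sub>M x *\<^sub>C 1) * \<kappa>\<^sub>0 q) p"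
    by (simp add: tensor_lift_pure_tensor clin rmult_\<kappa>\<^sub>0[symmetric] clinear_scaleC[OF clinear_rmult])
qed

lemma AP_counit_left:
  assumes "x \<in> AP \<delta>" "clinear F"
  shows "tensor_lift (\<lambda>u v. \<epsilon>\<^sub>M u *\<^sub>C F v) (\<Delta> x) = F x"
proof -
  have "F (slice_left \<epsilon>\<^sub>M (\<Delta> x)) = tensor_lift (\<lambda>u v. F (\<epsilon>\<^sub>M u *\<^sub>C v)) (\<Delta> x)"
    by (rule clinear_tensor_lift_comp) (intro assms clin)+
  then show ?thesis
    by (simp add: counit_left[OF multiplier_tensor_AP_comult[OF assms(1)]] clinear_scaleC[OF assms(2)])
qed

lemma AP_counit_right:
  assumes "x \<in> AP \<delta>" "clinear F"
  shows "tensor_lift (\<lambda>u v. \<epsilon>\<^sub>M v *\<^sub>C F u) (\<Delta> x) = F x"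
proof -
  have "F (slice_right \<epsilon>\<^sub>M (\<Delta> x)) = tensor_lift (\<lambda>u v. F (\<epsilon>\<^sub>M v *\<^sub>C u)) (\<Delta> x)"
    by (rule clinear_tensor_lift_comp) (intro assms clin)+
  then show ?thesis
    by (simp add: counit_right[OF multiplier_tensor_AP_comult[OF assms(1)]] clinear_scaleC[OF assms(2)])
qed

lemma AP_coinverse_left:
  assumes "x \<in> AP \<delta>" "clinear F"
  shows "tensor_lift (\<lambda>p q. F (\<kappa>\<^sub>M p * q)) (\<Delta> x) = \<epsilon>\<^sub>M x *\<^sub>C F 1"
  using clinear_tensor_lift_comp[OF assms(2) bilinear_\<kappa>\<^sub>M(1), of "\<Delta> x"]
  by (simp add: coinverse_left[OF multiplier_tensor_AP_comult[OF assms(1)]] clinear_scaleC[OF assms(2)])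

lemma AP_coinverse_right:
  assumes "x \<in> AP \<delta>" "clinear F"
  shows "tensor_lift (\<lambda>p q. F (p * \<kappa>\<^sub>M q)) (\<Delta> x) = \<epsilon>\<^sub>M x *\<^sub>C F 1"
  using clinear_tensor_lift_comp[OF assms(2) bilinear_\<kappa>\<^sub>M(2), of "\<Delta> x"]
  by (simp add: coinverse_right[OF multiplier_tensor_AP_comult[OF assms(1)]] clinear_scaleC[OF assms(2)])

text \<open>In the convolution algebra of linear maps from \<open>AP\<close> to \<open>M(A \<otimes> A)\<close>, both \<open>x \<mapsto> \<delta>(\<kappa>(x))\<close> and
  \<open>x \<mapsto> flip_\<kappa> x = \<Sum> \<kappa>(x\<^sub>2) \<otimes> \<kappa>(x\<^sub>1)\<close> are inverse to \<open>\<delta>\<close>, hence they agree.\<close>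

definition flip_\<kappa> :: "'a multiplier \<Rightarrow> ('a, 'a) tensor multiplier"
  where "flip_\<kappa> u = tensor_lift (\<lambda>p q. multiplier_times (\<kappa>\<^sub>M q) (\<kappa>\<^sub>M p)) (\<Delta>\<^sub>P u)"

lemma clinear_flip_\<kappa>: "clinear flip_\<kappa>"
  unfolding flip_\<kappa>_def by (intro clin)

lemmas [clin] = clinear_flip_\<kappa> clinear_compose[OF clinear_flip_\<kappa>]

text \<open>In Sweedler notation: \<Sum> (\<kappa>(x1) \<otimes> 1)(x2 \<otimes> x3) = \<Sum>
  \<epsilon>(x1) (1 \<otimes> x2) = 1 \<otimes> x.\<close>

lemma convolution_left_leg:
  assumes x: "x \<in> AP \<delta>"
  shows "tensor_lift (\<lambda>p q. multiplier_times (\<kappa>\<^sub>M p) 1 * \<delta>\<^sub>M q) (\<Delta> x) = multiplier_times 1 x"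
proof -
  let ?h = "\<lambda>p q v. multiplier_times (\<kappa>\<^sub>M p * q) v"
  have bil: "cbilinear (\<lambda>u v. tensor_lift (\<lambda>p q. ?h u p q) (\<Delta>\<^sub>P v))"
    "cbilinear (\<lambda>u v. tensor_lift (\<lambda>p q. ?h p q v) (\<Delta>\<^sub>P u))"
    by (rule cbilinearI; (rule clinear_tensor_lift_param | intro clin)+)+
  have "tensor_lift (\<lambda>p q. multiplier_times (\<kappa>\<^sub>M p) 1 * \<delta>\<^sub>M q) (\<Delta> x) =
      tensor_lift (\<lambda>u v. tensor_lift (\<lambda>p q. ?h u p q) (\<Delta>\<^sub>P v)) (\<Delta> x)"
  proof (rule tensor_lift_cong_AP[OF x _ bil(1)])
    fix u v assume "v \<in> AP \<delta>"
    then have "\<delta>\<^sub>M v = tensor_lift multiplier_times (\<Delta>\<^sub>P v)"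
      by (simp add: \<Delta>\<^sub>P_AP multiplier_tensor_AP_comult[symmetric] multiplier_tensor_def)
    moreover have "multiplier_times (\<kappa>\<^sub>M u) 1 * tensor_lift multiplier_times (\<Delta>\<^sub>P v) =
        tensor_lift (\<lambda>p q. multiplier_times (\<kappa>\<^sub>M u) 1 * multiplier_times p q) (\<Delta>\<^sub>P v)"
      by (rule clinear_tensor_lift_comp) (intro clin cbilinear_multiplier_times)+
    ultimately show "multiplier_times (\<kappa>\<^sub>M u) 1 * \<delta>\<^sub>M v = tensor_lift (\<lambda>p q. ?h u p q) (\<Delta>\<^sub>P v)"
      by (simp add: multiplier_times_mult)
  qed (intro clin)
  also have "\<dots> = tensor_lift (\<lambda>u v. tensor_lift (\<lambda>p q. ?h p q v) (\<Delta>\<^sub>P u)) (\<Delta> x)"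
    by (rule AP_coassoc_sweedler[OF x, symmetric]) (intro clin)+
  also have "\<dots> = tensor_lift (\<lambda>u v. \<epsilon>\<^sub>M u *\<^sub>C multiplier_times 1 v) (\<Delta> x)"
  proof (rule tensor_lift_cong_AP[OF x bil(2)])
    fix u v assume "u \<in> AP \<delta>"
    then show "tensor_lift (\<lambda>p q. ?h p q v) (\<Delta>\<^sub>P u) = \<epsilon>\<^sub>M u *\<^sub>C multiplier_times 1 v"
      using AP_coinverse_left[of u "\<lambda>y. multiplier_times y v"] by (simp add: \<Delta>\<^sub>P_AP clin)
  qed (intro clin)
  also have "\<dots> = multiplier_times 1 x"
    by (rule AP_counit_left[OF x]) (intro clin)
  finally show ?thesis .
qed

text \<open>In Sweedler notation: \<Sum> (\<kappa>(x2) \<otimes> \<kappa>(x1)) \<delta>(x3) = \<Sum>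
  (1 \<otimes> \<kappa>(x1)) (\<kappa>(x2) \<otimes> 1) \<delta>(x3) = \<Sum> 1 \<otimes>
  \<kappa>(x1) x2, by \<open>convolution_left_leg\<close>.\<close>

lemma convolution_flip_\<kappa>:
  assumes x: "x \<in> AP \<delta>"
  shows "tensor_lift (\<lambda>u v. flip_\<kappa> u * \<delta>\<^sub>M v) (\<Delta> x) = \<epsilon>\<^sub>M x *\<^sub>C 1"
proof -
  let ?h = "\<lambda>p q v. multiplier_times (\<kappa>\<^sub>M q) (\<kappa>\<^sub>M p) * \<delta>\<^sub>M v"
  have bil: "cbilinear (\<lambda>u v. tensor_lift (\<lambda>p q. ?h u p q) (\<Delta>\<^sub>P v))"
    by (rule cbilinearI; (rule clinear_tensor_lift_param | intro clin)+)
  have "flip_\<kappa> u * \<delta>\<^sub>M v = tensor_lift (\<lambda>p q. ?h p q v) (\<Delta>\<^sub>P u)" for u v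
    unfolding flip_\<kappa>_def
    by (rule clinear_tensor_lift_comp[of "\<lambda>y. y * \<delta>\<^sub>M v"]) (intro clin)+
  then have "tensor_lift (\<lambda>u v. flip_\<kappa> u * \<delta>\<^sub>M v) (\<Delta> x) =
      tensor_lift (\<lambda>u v. tensor_lift (\<lambda>p q. ?h p q v) (\<Delta>\<^sub>P u)) (\<Delta> x)"
    by simp
  also have "\<dots> = tensor_lift (\<lambda>u v. tensor_lift (\<lambda>p q. ?h u p q) (\<Delta>\<^sub>P v)) (\<Delta> x)"
    by (rule AP_coassoc_sweedler[OF x]) (intro clin)+
  also have "\<dots> = tensor_lift (\<lambda>u v. multiplier_times 1 (\<kappa>\<^sub>M u * v)) (\<Delta> x)"
  proof (rule tensor_lift_cong_AP[OF x bil])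
    fix u v assume v: "v \<in> AP \<delta>"
    have "tensor_lift (\<lambda>p q. ?h u p q) (\<Delta>\<^sub>P v) =
        tensor_lift (\<lambda>p q. multiplier_times 1 (\<kappa>\<^sub>M u) * (multiplier_times (\<kappa>\<^sub>M p) 1 * \<delta>\<^sub>M q)) (\<Delta> v)"
      by (simp add: \<Delta>\<^sub>P_AP v mult.assoc[symmetric] multiplier_times_mult)
    also have "\<dots> = multiplier_times 1 (\<kappa>\<^sub>M u) * tensor_lift (\<lambda>p q. multiplier_times (\<kappa>\<^sub>M p) 1 * \<delta>\<^sub>M q) (\<Delta> v)"
      by (rule clinear_tensor_lift_comp[symmetric]) (intro clin)+
    also have "\<dots> = multiplier_times 1 (\<kappa>\<^sub>M u * v)"
      by (simp add: convolution_left_leg[OF v] multiplier_times_mult)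
    finally show "tensor_lift (\<lambda>p q. ?h u p q) (\<Delta>\<^sub>P v) = multiplier_times 1 (\<kappa>\<^sub>M u * v)" .
  qed (intro clin)
  also have "\<dots> = \<epsilon>\<^sub>M x *\<^sub>C multiplier_times 1 1"
    by (rule AP_coinverse_left[OF x]) (intro clin)
  finally show ?thesis by (simp add: multiplier_times_one)
qed

text \<open>A left and a right convolution inverse coincide: with F = \<open>flip_\<kappa>\<close>,
  evaluate \<Sum> F(x1) \<delta>(x2) \<delta>(\<kappa>(x3)) in both bracketings. The right inverse
  property is \<Sum> \<delta>(x1 \<kappa>(x2)) = \<epsilon>(x) 1.\<close>

lemma comult_\<kappa>\<^sub>M:
  assumes x: "x \<in> AP \<delta>"
  shows "\<delta>\<^sub>M (\<kappa>\<^sub>M x) = flip_\<kappa> x"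
proof -
  let ?h = "\<lambda>u p q. flip_\<kappa> u * (\<delta>\<^sub>M p * \<delta>\<^sub>M (\<kappa>\<^sub>M q))"
  have bil: "cbilinear (\<lambda>u v. tensor_lift (\<lambda>p q. ?h u p q) (\<Delta>\<^sub>P v))"
    "cbilinear (\<lambda>u v. tensor_lift (\<lambda>p q. ?h p q v) (\<Delta>\<^sub>P u))"
    by (rule cbilinearI; (rule clinear_tensor_lift_param | intro clin)+)+
  have "\<delta>\<^sub>M (\<kappa>\<^sub>M x) = tensor_lift (\<lambda>u v. \<epsilon>\<^sub>M u *\<^sub>C \<delta>\<^sub>M (\<kappa>\<^sub>M v)) (\<Delta> x)"
    by (rule AP_counit_left[OF x, symmetric]) (intro clin)
  also have "\<dots> = tensor_lift (\<lambda>u v. tensor_lift (\<lambda>p q. ?h p q v) (\<Delta>\<^sub>P u)) (\<Delta> x)"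
  proof (rule tensor_lift_cong_AP[OF x _ bil(2)])
    fix u v assume u: "u \<in> AP \<delta>"
    have "tensor_lift (\<lambda>p q. flip_\<kappa> p * \<delta>\<^sub>M q * \<delta>\<^sub>M (\<kappa>\<^sub>M v)) (\<Delta> u) =
        tensor_lift (\<lambda>p q. flip_\<kappa> p * \<delta>\<^sub>M q) (\<Delta> u) * \<delta>\<^sub>M (\<kappa>\<^sub>M v)"
      by (rule clinear_tensor_lift_comp[of "\<lambda>y. y * \<delta>\<^sub>M (\<kappa>\<^sub>M v)", symmetric]) (intro clin)+
    then show "\<epsilon>\<^sub>M u *\<^sub>C \<delta>\<^sub>M (\<kappa>\<^sub>M v) = tensor_lift (\<lambda>p q. ?h p q v) (\<Delta>\<^sub>P u)"
      by (simp add: \<Delta>\<^sub>P_AP u convolution_flip_\<kappa> scaleC_mult_left mult.assoc)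
  qed (intro clin)
  also have "\<dots> = tensor_lift (\<lambda>u v. tensor_lift (\<lambda>p q. ?h u p q) (\<Delta>\<^sub>P v)) (\<Delta> x)"
    by (rule AP_coassoc_sweedler[OF x]) (intro clin)+
  also have "\<dots> = tensor_lift (\<lambda>u v. \<epsilon>\<^sub>M v *\<^sub>C flip_\<kappa> u) (\<Delta> x)"
  proof (rule tensor_lift_cong_AP[OF x bil(1)])
    fix u v assume v: "v \<in> AP \<delta>"
    show "tensor_lift (\<lambda>p q. ?h u p q) (\<Delta>\<^sub>P v) = \<epsilon>\<^sub>M v *\<^sub>C flip_\<kappa> u"
      using AP_coinverse_right[OF v, of "\<lambda>y. flip_\<kappa> u * \<delta>\<^sub>M y"]
      by (simp add: \<Delta>\<^sub>P_AP v clin \<delta>\<^sub>M_mult \<delta>\<^sub>M_one)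
  qed (intro clin)
  also have "\<dots> = flip_\<kappa> x"
    by (rule AP_counit_right[OF x]) (intro clin)
  finally show ?thesis .
qed

lemma \<kappa>\<^sub>M_in_AP:
  assumes x: "x \<in> AP \<delta>"
  shows "\<kappa>\<^sub>M x \<in> AP \<delta>"
proof (rule AP_I)
  \<comment> \<open>The witness \<Sum> \<kappa>(x2) \<otimes> \<kappa>(x1) is a lift of
    \<open>flip_\<kappa> x\<close> to M(A) \<otimes> M(A).\<close>
  have "multiplier_tensor (tensor_lift (\<lambda>p q. \<kappa>\<^sub>M q \<otimes>\<^sub>t \<kappa>\<^sub>M p) (\<Delta>\<^sub>P x)) =
      tensor_lift (\<lambda>p q. multiplier_tensor (\<kappa>\<^sub>M q \<otimes>\<^sub>t \<kappa>\<^sub>M p)) (\<Delta>\<^sub>P x)"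
    by (rule clinear_tensor_lift_comp) (intro clinear_multiplier_tensor clin)+
  then show "multiplier_tensor (tensor_lift (\<lambda>p q. \<kappa>\<^sub>M q \<otimes>\<^sub>t \<kappa>\<^sub>M p) (\<Delta>\<^sub>P x)) = \<delta>\<^sub>M (\<kappa>\<^sub>M x)"
    by (simp add: comult_\<kappa>\<^sub>M[OF x] flip_\<kappa>_def multiplier_tensor_pure)
qed

end

text \<open>The zero family and the family with an identity matrix of positive size at one index
  have distinct preimages, which cannot both be zero.\<close>

lemma direct_sum_of_matrix_algebras_nonzero:
  assumes "direct_sum_of_matrix_algebras TYPE('a::complex_algebra)"
  shows "\<exists>a::'a. a \<noteq> 0"
proof -
  obtain I :: "'a set" and n \<phi> where I: "I \<noteq> {}" "\<forall>i\<in>I. n i > 0"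
    and \<phi>: "bij_betw \<phi> (UNIV :: 'a set) (matrix_direct_sum I n)"
    using assms unfolding direct_sum_of_matrix_algebras_def by blast
  obtain i where i: "i \<in> I" "n i > 0" using I by blast
  \<comment> \<open>Outside \<open>I\<close> the value has to be \<open>undefined\<close>, as the
    product of carriers is extensional.\<close>
  let ?z = "\<lambda>j. if j \<in> I then 0\<^sub>m (n j) (n j) :: complex mat else undefined"
  let ?y = "?z(i := 1\<^sub>m (n i))"
  have "{j \<in> I. ?y j \<noteq> 0\<^sub>m (n j) (n j)} \<subseteq> {i}" by auto
  then have "?y \<in> matrix_direct_sum I n"
    using i finite_subset unfolding matrix_direct_sum_def by (fastforce simp: PiE_iff extensional_def)
  moreover have "?z \<in> matrix_direct_sum I n"
    unfolding matrix_direct_sum_def by (auto simp: PiE_iff extensional_def cong: conj_cong)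
  moreover have "?y \<noteq> ?z"
  proof
    assume "?y = ?z"
    then have "1\<^sub>m (n i) = (0\<^sub>m (n i) (n i) :: complex mat)" using i by (simp add: fun_eq_iff split: if_splits)
    then have "1\<^sub>m (n i) $$ (0, 0) = (0\<^sub>m (n i) (n i) :: complex mat) $$ (0, 0)" by simp
    then show False using i by simp
  qed
  ultimately obtain a b where "\<phi> a = ?y" "\<phi> b = ?z" "a \<noteq> b"
    using bij_betw_imp_surj_on[OF \<phi>] by (metis (no_types, lifting) imageE)
  then show ?thesis by (cases "a = 0") auto
qed

theorem theorem4p4:
  fixes \<delta> :: "'a::star_algebra \<Rightarrow> ('a, 'a) tensor multiplier"
  assumes "discrete_quantum_group \<delta>"
  shows "hopf_star_algebra (AP \<delta>) (AP_comult \<delta>)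
    (hom_extension (counit \<delta>)) (antihom_extension (coinverse \<delta>))"
proof -
  interpret nonzero_multiplier_hopf_algebra \<delta>
    using assms direct_sum_of_matrix_algebras_nonzero
    by unfold_locales (auto simp: discrete_quantum_group_def multiplier_hopf_star_algebra_def)
  have star_comult: "\<delta> (star a) = star (\<delta> a)" for a
    using assms by (simp add: discrete_quantum_group_def multiplier_hopf_star_algebra_def)
  have star_one: "star (1 :: ('a, 'a) tensor multiplier) = 1" "star (1 :: 'a multiplier) = 1"
    by (metis mult.left_neutral mult.right_neutral star_mult star_star)+
  \<comment> \<open>Conjugating the extension by the involutions gives another unital homomorphic
    extension of \<delta>, so uniqueness of the extension applies.\<close>
  have "(\<lambda>x. star (\<delta>\<^sub>M (star x))) = \<delta>\<^sub>M"
  proof (rule \<delta>\<^sub>M_extension(4))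
    show "algebra_hom (\<lambda>x. star (\<delta>\<^sub>M (star x)))"
      unfolding algebra_hom_def
      by (intro conjI allI clinearI)
         (simp_all add: star_add star_scaleC star_mult \<delta>\<^sub>M_mult clinear_add[OF clinear_\<delta>\<^sub>M]
          clinear_scaleC[OF clinear_\<delta>\<^sub>M])
  qed (simp_all add: star_one \<delta>\<^sub>M_one star_to_multiplier \<delta>\<^sub>M_to_multiplier star_comult star_star)
  then have star_\<delta>\<^sub>M: "\<delta>\<^sub>M (star x) = star (\<delta>\<^sub>M x)" for x
    by (metis star_star)
  have star_AP: "multiplier_tensor (star (\<Delta> x)) = \<delta>\<^sub>M (star x)" if "x \<in> AP \<delta>" for x
    using that by (simp add: star_multiplier_tensor[symmetric] multiplier_tensor_AP_comult star_\<delta>\<^sub>M)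
  have coassoc: "tensor_assoc (tensor_lift_on (AP \<delta>) (AP \<delta>) (\<lambda>a b. \<Delta> a \<otimes>\<^sub>t b) (\<Delta> x)) =
      tensor_lift_on (AP \<delta>) (AP \<delta>) (\<lambda>a b. a \<otimes>\<^sub>t \<Delta> b) (\<Delta> x)" if x: "x \<in> AP \<delta>" for x
  proof -
    \<comment> \<open>\<open>\<Delta>\<^sub>P\<close> replaces \<open>\<Delta>\<close> here because
      \<open>tensor_lift_on_AP\<close> asks for a globally bilinear map that agrees on
      \<open>AP\<close>.\<close>
    have "tensor_lift_on (AP \<delta>) (AP \<delta>) (\<lambda>a b. \<Delta> a \<otimes>\<^sub>t b) (\<Delta> x) = tensor_map \<Delta>\<^sub>P (\<lambda>y. y) (\<Delta> x)"
      unfolding tensor_map_def by (rule tensor_lift_on_AP[OF x]) (intro clin, simp add: \<Delta>\<^sub>P_AP)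
    moreover have "tensor_lift_on (AP \<delta>) (AP \<delta>) (\<lambda>a b. a \<otimes>\<^sub>t \<Delta> b) (\<Delta> x) = tensor_map (\<lambda>y. y) \<Delta>\<^sub>P (\<Delta> x)"
      unfolding tensor_map_def by (rule tensor_lift_on_AP[OF x]) (intro clin, simp add: \<Delta>\<^sub>P_AP)
    ultimately show ?thesis by (simp add: AP_coassoc[OF x])
  qed
  have laws: "tensor_lift_on (AP \<delta>) (AP \<delta>) (\<lambda>a b. \<epsilon>\<^sub>M a *\<^sub>C b) (\<Delta> x) = x"
    "tensor_lift_on (AP \<delta>) (AP \<delta>) (\<lambda>a b. \<epsilon>\<^sub>M b *\<^sub>C a) (\<Delta> x) = x"
    "tensor_lift_on (AP \<delta>) (AP \<delta>) (\<lambda>a b. \<kappa>\<^sub>M a * b) (\<Delta> x) = \<epsilon>\<^sub>M x *\<^sub>C 1"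
    "tensor_lift_on (AP \<delta>) (AP \<delta>) (\<lambda>a b. a * \<kappa>\<^sub>M b) (\<Delta> x) = \<epsilon>\<^sub>M x *\<^sub>C 1" if x: "x \<in> AP \<delta>" for x
  proof -
    note t = multiplier_tensor_AP_comult[OF x]
    show "tensor_lift_on (AP \<delta>) (AP \<delta>) (\<lambda>a b. \<epsilon>\<^sub>M a *\<^sub>C b) (\<Delta> x) = x"
      by (subst tensor_lift_on_AP[OF x, where f = "\<lambda>a b. \<epsilon>\<^sub>M a *\<^sub>C b"])
         (intro clin | simp add: counit_left[OF t])+
    show "tensor_lift_on (AP \<delta>) (AP \<delta>) (\<lambda>a b. \<epsilon>\<^sub>M b *\<^sub>C a) (\<Delta> x) = x"
      by (subst tensor_lift_on_AP[OF x, where f = "\<lambda>a b. \<epsilon>\<^sub>M b *\<^sub>C a"])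
         (intro clin | simp add: counit_right[OF t])+
    show "tensor_lift_on (AP \<delta>) (AP \<delta>) (\<lambda>a b. \<kappa>\<^sub>M a * b) (\<Delta> x) = \<epsilon>\<^sub>M x *\<^sub>C 1"
      by (subst tensor_lift_on_AP[OF x bilinear_\<kappa>\<^sub>M(1)]) (simp_all add: coinverse_left[OF t])
    show "tensor_lift_on (AP \<delta>) (AP \<delta>) (\<lambda>a b. a * \<kappa>\<^sub>M b) (\<Delta> x) = \<epsilon>\<^sub>M x *\<^sub>C 1"
      by (subst tensor_lift_on_AP[OF x bilinear_\<kappa>\<^sub>M(2)]) (simp_all add: coinverse_right[OF t])
  qed
  have "unital_star_subalgebra (AP \<delta>)"
    unfolding unital_star_subalgebra_def
    by (blast intro: subspace_AP AP_I AP_one AP_mult star_AP)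
  moreover have "clinear_on (AP \<delta>) \<epsilon>\<^sub>M" "clinear_on (AP \<delta>) \<kappa>\<^sub>M"
    by (simp_all add: clinear_on_def clinear_add[OF \<epsilon>\<^sub>M(2)] clinear_scaleC[OF \<epsilon>\<^sub>M(2)]
        clinear_add[OF \<kappa>\<^sub>M(2)] clinear_scaleC[OF \<kappa>\<^sub>M(2)])
  moreover have "\<Delta> 1 = 1" by (rule AP_comult_eq[OF AP_one])
  moreover have "\<forall>x\<in>AP \<delta>. \<forall>y\<in>AP \<delta>. \<Delta> (x * y) = \<Delta> x * \<Delta> y" by (blast intro: AP_comult_eq AP_mult)
  moreover have "\<forall>x\<in>AP \<delta>. \<Delta> (star x) = star (\<Delta> x)" by (blast intro: AP_comult_eq star_AP)
  ultimately show ?thesis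
    unfolding hopf_star_algebra_def
    using clinear_on_AP_comult AP_comult_in_tensor_span coassoc laws \<kappa>\<^sub>M_in_AP \<epsilon>\<^sub>M(1,3) by simp
qed

end
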